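(* Let $\tau:I\to I$ be continuous, piecewise linear, and topologically mixing, with slopes $\pm s$, and with associated partition $a_0<a_1<\cdots<a_n$. Then $$DG(\tau)/DG(\tau)_{\rm inf}\;\cong\;\sum_{i=1}^n\mathbb Z[s,s^{-1}](a_i-a_{i-1})$$ (with the order inherited from $\mathbb R$, and with the action of $\mathcal L_*$ given by multiplication by $s$).
   Context: Let $I=[0,1]$. A continuous map $\tau:I\to I$ is piecewise monotonic if there are points $0=a_0<a_1<\dots<a_n=1$ such that $\tau$ is strictly monotonic on each $(a_{i-1},a_i)$; the points are chosen so that no $(a_{i-1},a_i)$ is contained in a larger open interval on which $\tau$ is strictly monotonic, and then $\{a_0,\dots,a_n\}$ is the partition associated with $\tau$. $\tau$ is piecewise linear if it is piecewise monotonic and is linear (affine) on each interval $(a_{i-1},a_i)$; slopes $\pm s$ means that for a fixed $s>0$ every slope is $s$ or $-s$. $\tau$ is topologically mixing if for all non-empty open $U,V\subset I$ there is $k_0$ with $\tau^k(U)\cap V\ne\emptyset$ for all $k\ge k_0$. The generalized orbit of $x\in I$ is the smallest subset of $I$ containing $x$ that is forward and backward invariant under $\tau$. $I_1$ is the union of the generalized orbits of $a_0,\dots,a_n$, and $I_0=I\setminus I_1$. $X$ is the totally ordered set obtained from $I$ by replacing each $x\in I_1\setminus\{0,1\}$ by two points $x^-<x^+$, with the order topology (homeomorphic to a compact subset of $\mathbb R$); $\pi:X\to I$ is the collapse map ($\pi(x^\pm)=x$), and $X_0=\pi^{-1}(I_0)$. The local homeomorphism associated with $\tau$ is the unique continuous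 map $\sigma:X\to X$ with $\pi\circ\sigma=\tau\circ\pi$ on $X_0$. Let $(\mathcal L f)(x)=\sum_{\sigma y=x}f(y)$ for $f\in C(X,\mathbb Z)$. $DG(\tau)$ is $C(X,\mathbb Z)$ modulo $f\sim g$ iff $\mathcal L^nf=\mathcal L^ng$ for some $n\ge0$, ordered by $[f]\ge0$ iff $\mathcal L^nf\ge0$ for some $n$, with order unit $e=[1]$, and $\mathcal L_*[f]=[\mathcal Lf]$ (an automorphism when $\tau$ is surjective). $DG(\tau)_{\rm inf}$ is the subgroup of $x$ with $-e\le kx\le e$ for all integers $k\ge0$; the quotient has as positive cone the image of $DG(\tau)^+$, and $\mathcal L_*$ acts on it. $\mathbb Z[s,s^{-1}]$ is the subring of $\mathbb R$ generated by $s$ and $s^{-1}$. The isomorphism is one of ordered groups. *)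

theory Defs
  imports "HOL-Analysis.Analysis" "HOL-Algebra.Coset"
begin

section \<open>Piecewise monotonic maps of the unit interval\<close>

text \<open>An interval map is a function \<open>real \<Rightarrow> real\<close> of which only the restriction to the
  unit interval is used.\<close>

definition strictly_monotonic_on :: "real set \<Rightarrow> (real \<Rightarrow> real) \<Rightarrow> bool" where
  "strictly_monotonic_on A \<tau> \<longleftrightarrow>
     monotone_on A (<) (<) \<tau> \<or> monotone_on A (<) (>) \<tau>"

definition associated_partition :: "(real \<Rightarrow> real) \<Rightarrow> nat \<Rightarrow> (nat \<Rightarrow> real) \<Rightarrow> bool" where
  "associated_partition \<tau> n a \<longleftrightarrow>
     a 0 = 0 \<and> a n = 1 \<and> (\<forall>i<n. a i < a (Suc i)) \<and>
     (\<forall>i\<in>{1..n}. strictly_monotonic_on {a (i - 1)<..<a i} \<tau>) \<and>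
     (\<forall>i\<in>{1..n}. \<forall>c d. 0 \<le> c \<longrightarrow> d \<le> 1 \<longrightarrow> {a (i - 1)<..<a i} \<subset> {c<..<d} \<longrightarrow>
        \<not> strictly_monotonic_on {c<..<d} \<tau>)"

definition linear_with_slopes_pm :: "(real \<Rightarrow> real) \<Rightarrow> nat \<Rightarrow> (nat \<Rightarrow> real) \<Rightarrow> real \<Rightarrow> bool" where
  "linear_with_slopes_pm \<tau> n a s \<longleftrightarrow>
     (\<forall>i\<in>{1..n}. \<exists>m\<in>{s, - s}. \<exists>b. \<forall>x\<in>{a (i - 1)<..<a i}. \<tau> x = m * x + b)"

definition topologically_mixing :: "(real \<Rightarrow> real) \<Rightarrow> bool" where
  "topologically_mixing \<tau> \<longleftrightarrow>
     (\<forall>U V. openin (top_of_set {0..1}) U \<longrightarrow> openin (top_of_set {0..1}) V \<longrightarrow>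
        U \<noteq> {} \<longrightarrow> V \<noteq> {} \<longrightarrow> (\<exists>k0. \<forall>k\<ge>k0. (\<tau> ^^ k) ` U \<inter> V \<noteq> {}))"

section \<open>The disconnected space and the local homeomorphism\<close>

definition generalized_orbit :: "(real \<Rightarrow> real) \<Rightarrow> real \<Rightarrow> real set" where
  "generalized_orbit \<tau> x =
     (\<lambda>A. A \<subseteq> {0..1} \<and> (\<forall>y\<in>{0..1}. y \<in> A \<longleftrightarrow> \<tau> y \<in> A)) hull {x}"

text \<open>For a continuous map the associated partition is unique, so the following set is
  \<open>{a 0, \<dots>, a n}\<close> for any \<open>n\<close> and \<open>a\<close> with \<open>associated_partition \<tau> n a\<close>.\<close>

definition partition_points :: "(real \<Rightarrow> real) \<Rightarrow> real set" where
  "partition_points \<tau> = {a i | n a i. associated_partition \<tau> n a \<and> i \<le> n}"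

definition I1 :: "(real \<Rightarrow> real) \<Rightarrow> real set" where
  "I1 \<tau> = (\<Union>x\<in>partition_points \<tau>. generalized_orbit \<tau> x)"

definition I0 :: "(real \<Rightarrow> real) \<Rightarrow> real set" where
  "I0 \<tau> = {0..1} - I1 \<tau>"

text \<open>A doubled point \<open>x\<close> is represented by \<open>x\<^sup>- = (x, False)\<close> and \<open>x\<^sup>+ = (x, True)\<close>, an
  undoubled point by \<open>(x, False)\<close>. The collapse map is \<^const>\<open>fst\<close>, and the order is
  lexicographic.\<close>

definition X_space :: "(real \<Rightarrow> real) \<Rightarrow> (real \<times> bool) set" where
  "X_space \<tau> = {0..1} \<times> {False} \<union> (I1 \<tau> - {0, 1}) \<times> {True}"

definition X_less :: "real \<times> bool \<Rightarrow> real \<times> bool \<Rightarrow> bool" where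
  "X_less p q \<longleftrightarrow> fst p < fst q \<or> fst p = fst q \<and> snd p < snd q"

text \<open>The order topology of the ordered set \<open>X\<close> itself. It is not the subspace topology inherited
  from the order topology of the lexicographic product \<open>real \<times> bool\<close>.\<close>

definition X_topology :: "(real \<Rightarrow> real) \<Rightarrow> (real \<times> bool) topology" where
  "X_topology \<tau> = topology_generated_by
     ({X_space \<tau>}
      \<union> {{q \<in> X_space \<tau>. X_less q p} | p. p \<in> X_space \<tau>}
      \<union> {{q \<in> X_space \<tau>. X_less p q} | p. p \<in> X_space \<tau>})"

definition X0 :: "(real \<Rightarrow> real) \<Rightarrow> (real \<times> bool) set" where
  "X0 \<tau> = {p \<in> X_space \<tau>. fst p \<in> I0 \<tau>}"

definition local_homeo :: "(real \<Rightarrow> real) \<Rightarrow> real \<times> bool \<Rightarrow> real \<times> bool" where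
  "local_homeo \<tau> = (THE \<sigma>. \<sigma> \<in> extensional (X_space \<tau>) \<and>
     continuous_map (X_topology \<tau>) (X_topology \<tau>) \<sigma> \<and>
     (\<forall>p\<in>X0 \<tau>. fst (\<sigma> p) = \<tau> (fst p)))"

section \<open>Ordered abelian groups\<close>

text \<open>Abelian groups are written multiplicatively, as in \<^theory>\<open>HOL-Algebra.Coset\<close>; the order is
  given by the positive cone.\<close>

record 'a ordered_grp = "'a monoid" +
  pos_cone :: "'a set"

definition grp_le :: "'a ordered_grp \<Rightarrow> 'a \<Rightarrow> 'a \<Rightarrow> bool" where
  "grp_le G x y \<longleftrightarrow> y \<otimes>\<^bsub>G\<^esub> inv\<^bsub>G\<^esub> x \<in> pos_cone G"

definition infinitesimals :: "'a ordered_grp \<Rightarrow> 'a \<Rightarrow> 'a set" where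
  "infinitesimals G e =
     {x \<in> carrier G. \<forall>k::nat. grp_le G (inv\<^bsub>G\<^esub> e) (x [^]\<^bsub>G\<^esub> k) \<and> grp_le G (x [^]\<^bsub>G\<^esub> k) e}"

definition quotient_grp :: "'a ordered_grp \<Rightarrow> 'a set \<Rightarrow> 'a set ordered_grp" where
  "quotient_grp G H =
     \<lparr>carrier = carrier (G Mod H), mult = mult (G Mod H), one = one (G Mod H),
      pos_cone = (\<lambda>x. H #>\<^bsub>G\<^esub> x) ` pos_cone G\<rparr>"

definition ordered_grp_iso :: "'a ordered_grp \<Rightarrow> 'b ordered_grp \<Rightarrow> ('a \<Rightarrow> 'b) set" where
  "ordered_grp_iso G H = {\<phi> \<in> iso G H. \<forall>x\<in>carrier G. x \<in> pos_cone G \<longleftrightarrow> \<phi> x \<in> pos_cone H}"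

definition real_ordered_grp :: "real set \<Rightarrow> real ordered_grp" where
  "real_ordered_grp S = \<lparr>carrier = S, mult = (+), one = 0, pos_cone = {x \<in> S. 0 \<le> x}\<rparr>"

section \<open>The dimension group\<close>

text \<open>Functions on \<open>X\<close> are extensional, so that equality of functions on \<open>X\<close> is equality in HOL.\<close>

definition CXZ :: "(real \<Rightarrow> real) \<Rightarrow> (real \<times> bool \<Rightarrow> int) set" where
  "CXZ \<tau> = {f \<in> extensional (X_space \<tau>).
     continuous_map (X_topology \<tau>) (discrete_topology UNIV) f}"

definition transfer :: "(real \<Rightarrow> real) \<Rightarrow> (real \<times> bool \<Rightarrow> int) \<Rightarrow> real \<times> bool \<Rightarrow> int" where
  "transfer \<tau> f = (\<lambda>p\<in>X_space \<tau>. \<Sum>q | q \<in> X_space \<tau> \<and> local_homeo \<tau> q = p. f q)"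

definition DG_rel ::
  "(real \<Rightarrow> real) \<Rightarrow> ((real \<times> bool \<Rightarrow> int) \<times> (real \<times> bool \<Rightarrow> int)) set" where
  "DG_rel \<tau> = {(f, g). f \<in> CXZ \<tau> \<and> g \<in> CXZ \<tau> \<and>
     (\<exists>n. (transfer \<tau> ^^ n) f = (transfer \<tau> ^^ n) g)}"

definition DG_class ::
  "(real \<Rightarrow> real) \<Rightarrow> (real \<times> bool \<Rightarrow> int) \<Rightarrow> (real \<times> bool \<Rightarrow> int) set" where
  "DG_class \<tau> f = DG_rel \<tau> `` {f}"

definition DG :: "(real \<Rightarrow> real) \<Rightarrow> (real \<times> bool \<Rightarrow> int) set ordered_grp" where
  "DG \<tau> =
     \<lparr>carrier = CXZ \<tau> // DG_rel \<tau>,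
      mult = (\<lambda>A B. \<Union>f\<in>A. \<Union>g\<in>B. DG_class \<tau> (\<lambda>p\<in>X_space \<tau>. f p + g p)),
      one = DG_class \<tau> (\<lambda>p\<in>X_space \<tau>. 0),
      pos_cone = {DG_class \<tau> f | f. f \<in> CXZ \<tau> \<and>
        (\<exists>n. \<forall>p\<in>X_space \<tau>. 0 \<le> (transfer \<tau> ^^ n) f p)}\<rparr>"

definition DG_unit :: "(real \<Rightarrow> real) \<Rightarrow> (real \<times> bool \<Rightarrow> int) set" where
  "DG_unit \<tau> = DG_class \<tau> (\<lambda>p\<in>X_space \<tau>. 1)"

definition transfer_star ::
  "(real \<Rightarrow> real) \<Rightarrow> (real \<times> bool \<Rightarrow> int) set \<Rightarrow> (real \<times> bool \<Rightarrow> int) set" where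
  "transfer_star \<tau> A = (\<Union>f\<in>A. DG_class \<tau> (transfer \<tau> f))"

definition DG_inf :: "(real \<Rightarrow> real) \<Rightarrow> (real \<times> bool \<Rightarrow> int) set set" where
  "DG_inf \<tau> = infinitesimals (DG \<tau>) (DG_unit \<tau>)"

section \<open>The target group\<close>

definition Z_adjoin_inv :: "real \<Rightarrow> real set" where
  "Z_adjoin_inv s =
     (\<lambda>R. 1 \<in> R \<and> (\<forall>x\<in>R. \<forall>y\<in>R. x - y \<in> R \<and> x * y \<in> R)) hull {s, inverse s}"

definition interval_module :: "real \<Rightarrow> nat \<Rightarrow> (nat \<Rightarrow> real) \<Rightarrow> real set" where
  "interval_module s n a =
     {\<Sum>i = 1..n. c i * (a i - a (i - 1)) | c. \<forall>i\<in>{1..n}. c i \<in> Z_adjoin_inv s}"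

end

theory Submission
  imports Defs
begin

text \<open>
  Integration against Lebesgue measure is additive on \<open>C(X, \<int>)\<close> and is multiplied by \<open>s\<close> under the transfer
  operator, so it induces a homomorphism from \<open>DG(\<tau>)\<close> to the reals. Its range is the group generated by
  \<open>I\<^sub>1\<close>. This group is a module over \<open>\<int>[s, s\<^sup>-\<^sup>1]\<close> because \<open>\<tau>\<close> is onto and has slopes \<open>\<plusminus> s\<close>, and it equals
  the interval module \<open>M\<close> because \<open>M \<inter> [0, 1]\<close> is fully invariant.

  Everything else follows from the fact that a function \<open>f\<close> with positive integral satisfies \<open>L\<^sup>n f \<ge> 0\<close> for some
  \<open>n\<close>; in particular the infinitesimals form the kernel. To prove this, write \<open>f = p - q\<close> with nonnegative
  combinations \<open>p\<close>, \<open>q\<close> of indicators of order intervals, and normalise the transfer operator to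
  \<open>P = L / s\<close>. As \<open>P\<^sup>k\<close> cuts an interval into a number of pieces that is at most \<open>2\<close> plus a multiple of its
  length, and shrinks the coefficients by \<open>s\<^sup>k\<close>, the total weight of \<open>P\<^sup>k p\<close> is eventually bounded by a multiple
  of the integral (Lasota--Yorke). Hence a fixed proportion of the mass sits on long intervals, and by mixing some
  iterate maps a piece of each long interval onto one common interval \<open>K\<close>. The same multiple of \<open>1\<^sub>K\<close> can then
  be subtracted from the images of \<open>p\<close> and \<open>q\<close> (Doeblin's coupling). Repeating this, the \<open>q\<close>-part tends to \<open>0\<close>
  uniformly while the integral of the \<open>p\<close>-part stays bounded below; since \<open>\<tau>\<close> is exact, \<open>K\<close> is eventually
  mapped onto the whole space, which makes the \<open>p\<close>-part uniformly positive.
\<close>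

text \<open>Constant slope makes Lebesgue measure an eigenmeasure: every branch stretches length by
  exactly \<open>s\<close>, so \<open>L\<close> multiplies the integral by \<open>s\<close>. The
  orbits of the partition points may be infinite, so there need be no finite transition matrix with
  a Perron vector; explicit lists of intervals with real coefficients take its place. The obstacle
  is that cutting creates ever more pieces. Weight and integral are therefore tracked together, and
  the cone in which the weight is at most \<open>4 * B\<close> times the integral is kept invariant.
  The coupling takes the same amount from both parts, so the gap between their integrals never
  changes while the smaller one decays geometrically. The final lower bound has to hold up to the
  ends of the unit interval, so it is not enough that images of an interval cover
  \<open>[e, 1 - e]\<close>; this is why exactness is proved.\<close>

section \<open>Laps and uniqueness of the associated partition\<close>

lemma strictly_monotonic_on_subset:
  "strictly_monotonic_on A f \<Longrightarrow> B \<subseteq> A \<Longrightarrow> strictly_monotonic_on B f"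
  unfolding strictly_monotonic_on_def monotone_on_def by blast

text \<open>The two points \<open>v < w\<close> of the overlap decide the direction: both
  restrictions increase or both decrease. A pair that straddles the overlap is then compared through
  \<open>v\<close>.\<close>

lemma strictly_monotonic_on_join:
  assumes f: "strictly_monotonic_on {p<..<q} f" and g: "strictly_monotonic_on {p'<..<q'} f"
    and le: "p \<le> p'" "p' < q" "q \<le> q'"
  shows "strictly_monotonic_on {p<..<q'} f"
proof -
  obtain v w where vw: "p' < v" "v < w" "w < q"
    using le(2) dense by meson
  have inc: "monotone_on {p<..<q'} (<) R f"
    if R: "\<And>x y z. R x y \<Longrightarrow> R y z \<Longrightarrow> R x z" and mf: "monotone_on {p<..<q} (<) R f"
      and mg: "monotone_on {p'<..<q'} (<) R f" for R :: "real \<Rightarrow> real \<Rightarrow> bool"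
  proof (rule monotone_onI)
    fix x y assume xy: "x \<in> {p<..<q'}" "y \<in> {p<..<q'}" "x < y"
    consider "y < q" | "p' < x" | "x \<le> p'" "q \<le> y" by linarith
    then show "R (f x) (f y)"
    proof cases
      case 1 then show ?thesis using xy le by (auto intro: monotone_onD[OF mf])
    next
      case 2 then show ?thesis using xy le by (auto intro: monotone_onD[OF mg])
    next
      case 3
      have "R (f x) (f v)" using xy 3 vw le by (auto intro: monotone_onD[OF mf])
      moreover have "R (f v) (f y)" using xy 3 vw le by (auto intro: monotone_onD[OF mg])
      ultimately show ?thesis by (rule R)
    qed
  qed
  have vwm: "v \<in> {p<..<q}" "w \<in> {p<..<q}" "v \<in> {p'<..<q'}" "w \<in> {p'<..<q'}"
    using vw le by auto
  have same: "(monotone_on {p<..<q} (<) (<) f \<longrightarrow> f v < f w) \<and> (monotone_on {p<..<q} (<) (>) f \<longrightarrow> f w < f v) \<and>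
     (monotone_on {p'<..<q'} (<) (<) f \<longrightarrow> f v < f w) \<and> (monotone_on {p'<..<q'} (<) (>) f \<longrightarrow> f w < f v)"
    using vwm vw(2) unfolding monotone_on_def by blast
  show ?thesis
  proof (cases "f v < f w")
    case True
    then have "monotone_on {p<..<q} (<) (<) f" "monotone_on {p'<..<q'} (<) (<) f"
      using same f g unfolding strictly_monotonic_on_def by auto
    then show ?thesis using inc[of "(<)"] by (auto simp: strictly_monotonic_on_def)
  next
    case False
    then have "monotone_on {p<..<q} (<) (>) f" "monotone_on {p'<..<q'} (<) (>) f"
      using same f g unfolding strictly_monotonic_on_def by auto
    then show ?thesis using inc[of "(>)"] by (auto simp: strictly_monotonic_on_def)
  qed
qed

lemma associated_partition_mono:
  assumes "associated_partition \<tau> n a" "i \<le> j" "j \<le> n"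
  shows "a i \<le> a j"
  using assms(2,3)
proof (induction rule: dec_induct)
  case (step k)
  then show ?case using assms(1) unfolding associated_partition_def
    by (metis Suc_le_eq less_imp_le order_trans)
qed simp

lemma associated_partition_lap:
  assumes P: "associated_partition \<tau> n a" and x: "0 \<le> x" "x < 1"
  obtains i where "1 \<le> i" "i \<le> n" "a (i - 1) \<le> x" "x < a i"
proof -
  have a: "a 0 = 0" "a n = 1" using P by (auto simp: associated_partition_def)
  define i where "i = (LEAST i. x < a i)"
  have 1: "x < a i" unfolding i_def by (rule LeastI[of _ n]) (use x a in simp)
  have 2: "i \<le> n" unfolding i_def by (rule Least_le) (use x a in simp)
  have 3: "i \<noteq> 0" using 1 x a by (intro notI) simp
  then have "\<not> x < a (i - 1)" using not_less_Least[of "i - 1" "\<lambda>i. x < a i"] i_def by simp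
  then show ?thesis using that[of i] 1 2 3 by simp
qed

text \<open>Maximality of laps makes the partition unique: a point of a rival partition that
  \<open>a\<close> misses lies inside a lap of \<open>a\<close>, so the rival lap ending there could
  be prolonged past it. Thus \<open>I1\<close>, defined without reference to \<open>a\<close>, can
  be computed from \<open>a\<close>.\<close>

lemma partition_points_eq:
  assumes P: "associated_partition \<tau> n a"
  shows "partition_points \<tau> = a ` {..n}"
proof
  show "a ` {..n} \<subseteq> partition_points \<tau>"
    unfolding partition_points_def using P by blast
  show "partition_points \<tau> \<subseteq> a ` {..n}"
  proof
    fix x assume "x \<in> partition_points \<tau>"
    then obtain m c i where c: "associated_partition \<tau> m c" and i: "i \<le> m" "x = c i"
      unfolding partition_points_def by blast
    have a01: "a 0 = 0" "a n = 1" using P by (auto simp: associated_partition_def)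
    have c01: "c 0 = 0" "c m = 1" using c by (auto simp: associated_partition_def)
    have cl: "\<And>i. i < m \<Longrightarrow> c i < c (Suc i)" using c by (auto simp: associated_partition_def)
    show "x \<in> a ` {..n}"
    proof (rule ccontr)
      assume nx: "x \<notin> a ` {..n}"
      have i0: "0 < i" "i < m" using nx i a01 c01 by (auto simp: image_iff intro: gr0I le_neq_implies_less)
      have x01: "0 \<le> x" "x < 1"
        using associated_partition_mono[OF c, of 0 i] associated_partition_mono[OF c, of "Suc i" m] cl[of i]
          i i0 c01 by auto
      obtain j where j: "1 \<le> j" "j \<le> n" "a (j - 1) \<le> x" "x < a j"
        using associated_partition_lap[OF P x01] by blast
      have j': "a (j - 1) < x" using nx j by (force simp: less_le)
      obtain d where d: "0 < d" "x + d < a j" "a (j - 1) < x - d" "c (i - 1) < x - d" "x + d < 1"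
      proof -
        have ci: "c (i - 1) < x" using cl[of "i - 1"] i0 i by simp
        define d where "d = Min {a j - x, x - a (j - 1), x - c (i - 1), 1 - x} / 2"
        have "0 < d" unfolding d_def using j j' ci x01 by auto
        moreover have "2 * d \<le> a j - x" "2 * d \<le> x - a (j - 1)" "2 * d \<le> x - c (i - 1)" "2 * d \<le> 1 - x"
          unfolding d_def by auto
        ultimately show ?thesis using that[of d] by linarith
      qed
      have m1: "strictly_monotonic_on {x - d<..<x + d} \<tau>"
      proof (rule strictly_monotonic_on_subset)
        have "j \<in> {1..n}" using j by simp
        then show "strictly_monotonic_on {a (j - 1)<..<a j} \<tau>"
          using P unfolding associated_partition_def by blast
      qed (use d in auto)
      have m2: "strictly_monotonic_on {c (i - 1)<..<x} \<tau>"
      proof -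
        have "i \<in> {1..m}" using i0 by simp
        then show ?thesis using c i unfolding associated_partition_def by blast
      qed
      have "strictly_monotonic_on {c (i - 1)<..<x + d} \<tau>"
        by (rule strictly_monotonic_on_join[OF m2 m1]) (use d in auto)
      moreover have "{c (i - 1)<..<c i} \<subset> {c (i - 1)<..<x + d}"
      proof
        show "{c (i - 1)<..<c i} \<subseteq> {c (i - 1)<..<x + d}" using i d by auto
        have "x \<in> {c (i - 1)<..<x + d}" using d by auto
        then show "{c (i - 1)<..<c i} \<noteq> {c (i - 1)<..<x + d}" using i by auto
      qed
      moreover have "0 \<le> c (i - 1)" using associated_partition_mono[OF c, of 0 "i - 1"] c01 i0 by auto
      moreover have "i \<in> {1..m}" "x + d \<le> 1" using i0 d by auto
      ultimately show False
        using c unfolding associated_partition_def by blast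
    qed
  qed
qed

section \<open>Elementary facts on affine maps and finite sets\<close>

lemma affine_preimage_between:
  fixes m b u v z :: real
  assumes m: "m \<noteq> 0" and uv: "u < v"
    and z: "min (m * u + b) (m * v + b) < z" "z < max (m * u + b) (m * v + b)"
  shows "u < (z - b) / m" "(z - b) / m < v"
proof -
  have mx: "m * ((z - b) / m) + b = z" using m by simp
  have "u < (z - b) / m \<and> (z - b) / m < v"
  proof (cases "0 < m")
    case True
    then have "m * u \<le> m * v" using uv by simp
    then have "m * u + b < z" "z < m * v + b" using z by auto
    then have "m * u < m * ((z - b) / m)" "m * ((z - b) / m) < m * v" using mx by linarith+
    then show ?thesis using True by (simp only: mult_less_cancel_left_pos)
  next
    case False
    then have m': "m < 0" using m by simp
    then have "m * v \<le> m * u" using uv by (intro mult_left_mono_neg) auto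
    then have "m * v + b < z" "z < m * u + b" using z by auto
    then have "m * v < m * ((z - b) / m)" "m * ((z - b) / m) < m * u" using mx by linarith+
    then show ?thesis using m' by (simp only: mult_less_cancel_left_neg)
  qed
  then show "u < (z - b) / m" "(z - b) / m < v" by auto
qed

lemma affine_image_between:
  fixes m b u v x :: real
  assumes m: "m \<noteq> 0" and x: "u < x" "x < v"
  shows "min (m * u + b) (m * v + b) < m * x + b" "m * x + b < max (m * u + b) (m * v + b)"
proof -
  have "(m * u < m * x \<and> m * x < m * v) \<or> (m * v < m * x \<and> m * x < m * u)"
    using m x by (cases "0 < m") (auto simp: mult_less_cancel_left)
  then show "min (m * u + b) (m * v + b) < m * x + b" "m * x + b < max (m * u + b) (m * v + b)"
    by (auto simp: min_less_iff_disj less_max_iff_disj)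
qed

text \<open>An interval no longer than the smallest gap \<open>g\<close> contains at most one point
  of \<open>S\<close>; for a longer one the crude bound \<open>card S\<close> is paid for by the
  length. Applied to break points, this becomes the Lasota--Yorke inequality.\<close>

lemma finite_gap_bound:
  fixes S :: "real set"
  assumes S: "finite S"
  obtains B where "0 \<le> B" "\<And>u v. u < v \<Longrightarrow> real (card (S \<inter> {u<..<v})) \<le> 1 + B * (v - u)"
proof -
  \<comment> \<open>The extra element 1 keeps the minimum meaningful when \<open>S\<close> has fewer
    than two points.\<close>
  define G where "G = insert 1 ((\<lambda>(x, y). \<bar>x - y\<bar>) ` {(x, y). x \<in> S \<and> y \<in> S \<and> x \<noteq> y})"
  have "finite {(x, y). x \<in> S \<and> y \<in> S \<and> x \<noteq> y}"
    by (rule finite_subset[of _ "S \<times> S"]) (use S in auto)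
  then have fin: "finite G" by (simp add: G_def)
  define g where "g = Min G"
  have "g \<in> G" unfolding g_def by (rule Min_in) (use fin in \<open>auto simp: G_def\<close>)
  then have g0: "0 < g" by (auto simp: G_def)
  have gap: "g \<le> \<bar>x - y\<bar>" if "x \<in> S" "y \<in> S" "x \<noteq> y" for x y
    unfolding g_def by (rule Min_le[OF fin]) (use that in \<open>force simp: G_def\<close>)
  show ?thesis
  proof (rule that[of "card S / g"])
    fix u v :: real assume uv: "u < v"
    let ?T = "S \<inter> {u<..<v}"
    have T: "finite ?T" using S by simp
    show "real (card ?T) \<le> 1 + card S / g * (v - u)"
    proof (cases "card ?T \<le> 1")
      case True
      then have "real (card ?T) \<le> 1" by simp
      moreover have "0 \<le> card S / g * (v - u)" using g0 uv by simp
      ultimately show ?thesis by linarith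
    next
      case False
      then have "\<not> (\<forall>x\<in>?T. \<forall>y\<in>?T. x = y)" using card_le_Suc0_iff_eq[OF T] by simp
      then obtain x y where xy: "x \<in> ?T" "y \<in> ?T" "x \<noteq> y" by blast
      have "\<bar>x - y\<bar> < v - u" using xy by auto
      then have "g < v - u" using gap[of x y] xy by simp
      then have "real (card S) * 1 \<le> real (card S) * ((v - u) / g)"
        using g0 by (intro mult_left_mono) auto
      moreover have "card ?T \<le> card S" using S by (intro card_mono) auto
      ultimately show ?thesis by simp
    qed
  qed (use g0 in simp)
qed

section \<open>Ordered groups and the quotient by infinitesimals\<close>

lemma real_ordered_grp_simps [simp]:
  "carrier (real_ordered_grp S) = S" "mult (real_ordered_grp S) = (+)" "one (real_ordered_grp S) = 0"
  "pos_cone (real_ordered_grp S) = {x \<in> S. 0 \<le> x}"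
  by (simp_all add: real_ordered_grp_def)

lemma group_real_ordered_grp:
  assumes "0 \<in> S" "\<And>x y. x \<in> S \<Longrightarrow> y \<in> S \<Longrightarrow> x - y \<in> S"
  shows "group (real_ordered_grp S)"
proof -
  have add: "x + y \<in> S" if "x \<in> S" "y \<in> S" for x y
    using assms(2)[OF that(1) assms(2)[OF assms(1) that(2)]] by simp
  show ?thesis
  proof (rule groupI)
    fix x assume "x \<in> carrier (real_ordered_grp S)"
    then show "\<exists>y\<in>carrier (real_ordered_grp S). y \<otimes>\<^bsub>real_ordered_grp S\<^esub> x = \<one>\<^bsub>real_ordered_grp S\<^esub>"
      using assms(2)[OF assms(1), of x] by (intro bexI[of _ "- x"]) auto
  qed (use assms add in auto)
qed

text \<open>Bounded multiples force the value 0. Conversely, if \<open>\<omega> x = 0\<close>, then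
  \<open>e\<close> plus or minus any multiple of \<open>x\<close> has value 1 and is therefore
  positive. The hypotheses leave open which elements of value 0 are positive.\<close>

lemma quotient_by_infinitesimals:
  fixes G :: "'a ordered_grp" and \<omega> :: "'a \<Rightarrow> real"
  assumes G: "group G" and S: "group (real_ordered_grp S)" and hom: "\<omega> \<in> hom G (real_ordered_grp S)"
    and img: "\<omega> ` carrier G = S"
    and e: "e \<in> carrier G" "\<omega> e = 1"
    and pos: "pos_cone G \<subseteq> carrier G" "\<And>x. x \<in> pos_cone G \<Longrightarrow> 0 \<le> \<omega> x"
      "\<And>x. x \<in> carrier G \<Longrightarrow> 0 < \<omega> x \<Longrightarrow> x \<in> pos_cone G" "\<one>\<^bsub>G\<^esub> \<in> pos_cone G"
  shows "\<exists>\<Phi> \<in> ordered_grp_iso (quotient_grp G (infinitesimals G e)) (real_ordered_grp S).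
    \<forall>x \<in> carrier G. \<Phi> (infinitesimals G e #>\<^bsub>G\<^esub> x) = \<omega> x"
proof -
  interpret G: group G by (rule G)
  interpret h: group_hom G "real_ordered_grp S" \<omega>
    using G S hom by (simp add: group_hom_def group_hom_axioms_def)
  have mult: "\<omega> (x \<otimes>\<^bsub>G\<^esub> y) = \<omega> x + \<omega> y" if "x \<in> carrier G" "y \<in> carrier G" for x y
    using h.hom_mult[OF that] by simp
  have one: "\<omega> \<one>\<^bsub>G\<^esub> = 0" using h.hom_one by simp
  have inv: "\<omega> (inv\<^bsub>G\<^esub> x) = - \<omega> x" if "x \<in> carrier G" for x
    using mult[of "inv\<^bsub>G\<^esub> x" x] that one by simp
  have pow: "\<omega> (x [^]\<^bsub>G\<^esub> (k::nat)) = real k * \<omega> x" if "x \<in> carrier G" for x k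
    by (induction k) (simp_all add: one mult that distrib_right)
  let ?K = "kernel G (real_ordered_grp S) \<omega>"
  have K: "infinitesimals G e = ?K"
  proof (rule equalityI; rule subsetI)
    fix x assume x: "x \<in> infinitesimals G e"
    then have xc: "x \<in> carrier G" by (simp add: infinitesimals_def)
    have b: "real k * \<bar>\<omega> x\<bar> \<le> 1" for k
    proof -
      have "grp_le G (inv\<^bsub>G\<^esub> e) (x [^]\<^bsub>G\<^esub> k)" "grp_le G (x [^]\<^bsub>G\<^esub> k) e"
        using x by (auto simp: infinitesimals_def)
      then have "0 \<le> \<omega> (x [^]\<^bsub>G\<^esub> k \<otimes>\<^bsub>G\<^esub> inv\<^bsub>G\<^esub> (inv\<^bsub>G\<^esub> e))" "0 \<le> \<omega> (e \<otimes>\<^bsub>G\<^esub> inv\<^bsub>G\<^esub> (x [^]\<^bsub>G\<^esub> k))"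
        unfolding grp_le_def using pos(2) by blast+
      then have "- 1 \<le> real k * \<omega> x" "real k * \<omega> x \<le> 1" using xc e by (simp_all add: mult inv pow del: h.hom_inv)
      then show ?thesis by (auto simp: abs_if)
    qed
    have "\<omega> x = 0"
    proof (rule ccontr)
      assume "\<omega> x \<noteq> 0"
      then obtain k :: nat where "1 < real k * \<bar>\<omega> x\<bar>" using ex_less_of_nat_mult[of "\<bar>\<omega> x\<bar>" 1] by auto
      then show False using b[of k] by simp
    qed
    then show "x \<in> ?K" using xc by (simp add: kernel_def)
  next
    fix x assume "x \<in> ?K"
    then have xc: "x \<in> carrier G" and x0: "\<omega> x = 0" by (auto simp: kernel_def)
    have "grp_le G (inv\<^bsub>G\<^esub> e) (x [^]\<^bsub>G\<^esub> k) \<and> grp_le G (x [^]\<^bsub>G\<^esub> k) e" for k :: nat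
      unfolding grp_le_def using xc e x0 by (intro conjI pos(3)) (simp_all add: mult inv pow del: h.hom_inv)
    then show "x \<in> infinitesimals G e" using xc by (simp add: infinitesimals_def)
  qed
  define \<Phi> where "\<Phi> Y = the_elem (\<omega> ` Y)" for Y
  have val: "\<Phi> (?K #>\<^bsub>G\<^esub> x) = \<omega> x" if x: "x \<in> carrier G" for x
  proof -
    have "\<omega> ` (?K #>\<^bsub>G\<^esub> x) = {\<omega> x}"
    proof
      show "\<omega> ` (?K #>\<^bsub>G\<^esub> x) \<subseteq> {\<omega> x}" using x by (auto simp: r_coset_def kernel_def mult)
      have "\<one>\<^bsub>G\<^esub> \<otimes>\<^bsub>G\<^esub> x \<in> ?K #>\<^bsub>G\<^esub> x" unfolding r_coset_def kernel_def using one by auto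
      then show "{\<omega> x} \<subseteq> \<omega> ` (?K #>\<^bsub>G\<^esub> x)" using x by force
    qed
    then show ?thesis by (simp add: \<Phi>_def)
  qed
  have "(\<lambda>Y. the_elem (\<omega> ` Y)) \<in> iso (G Mod ?K) (real_ordered_grp S)"
    by (rule h.FactGroup_iso_set) (simp add: img)
  then have iso: "\<Phi> \<in> iso (quotient_grp G ?K) (real_ordered_grp S)"
    unfolding \<Phi>_def[abs_def] by (simp add: iso_def hom_def quotient_grp_def)
  have cone: "Y \<in> pos_cone (quotient_grp G ?K) \<longleftrightarrow> \<Phi> Y \<in> pos_cone (real_ordered_grp S)"
    if Y: "Y \<in> carrier (quotient_grp G ?K)" for Y
  proof -
    obtain x where x: "x \<in> carrier G" "Y = ?K #>\<^bsub>G\<^esub> x"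
      using Y by (auto simp: quotient_grp_def FactGroup_def RCOSETS_def)
    have S: "\<omega> x \<in> S" using x img by blast
    show ?thesis
    proof
      assume "Y \<in> pos_cone (quotient_grp G ?K)"
      then obtain y where y: "y \<in> pos_cone G" "Y = ?K #>\<^bsub>G\<^esub> y" by (auto simp: quotient_grp_def)
      then have "\<Phi> Y = \<omega> y" using val pos(1) by blast
      moreover have "\<omega> y \<in> S" using y(1) pos(1) img by blast
      ultimately show "\<Phi> Y \<in> pos_cone (real_ordered_grp S)" using pos(2)[OF y(1)] by simp
    next
      assume "\<Phi> Y \<in> pos_cone (real_ordered_grp S)"
      then have "0 \<le> \<omega> x" using val x by simp
      then consider "0 < \<omega> x" | "\<omega> x = 0" by linarith
      then show "Y \<in> pos_cone (quotient_grp G ?K)"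
      proof cases
        case 1
        then show ?thesis using pos(3) x by (auto simp: quotient_grp_def)
      next
        \<comment> \<open>Here \<open>x\<close> itself may fail to be positive, but its coset is
          that of the identity, which is.\<close>
        case 2
        then have "x \<in> ?K" using x by (simp add: kernel_def)
        then have "Y = ?K #>\<^bsub>G\<^esub> \<one>\<^bsub>G\<^esub>"
          using x G.coset_join2[OF x(1) h.subgroup_kernel] G.coset_join2[OF G.one_closed h.subgroup_kernel]
            subgroup.one_closed[OF h.subgroup_kernel] by simp
        then show ?thesis using pos(4) by (auto simp: quotient_grp_def)
      qed
    qed
  qed
  show ?thesis
  proof (intro bexI[of _ \<Phi>] ballI)
    show "\<Phi> \<in> ordered_grp_iso (quotient_grp G (infinitesimals G e)) (real_ordered_grp S)"
      unfolding K ordered_grp_iso_def using iso cone by blast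
    show "\<Phi> (infinitesimals G e #>\<^bsub>G\<^esub> x) = \<omega> x" if "x \<in> carrier G" for x
      unfolding K by (rule val[OF that])
  qed
qed

locale pm_slope_map =
  fixes \<tau> :: "real \<Rightarrow> real" and s :: real and n :: nat and a :: "nat \<Rightarrow> real"
  assumes cont: "continuous_on {0..1} \<tau>" and maps: "\<tau> ` {0..1} \<subseteq> {0..1}"
    and part: "associated_partition \<tau> n a"
    and s_pos: "s > 0" and lin: "linear_with_slopes_pm \<tau> n a s"
    and mix: "topologically_mixing \<tau>"
begin

subsection \<open>The interval map\<close>

lemma a_0: "a 0 = 0" and a_n: "a n = 1" and a_less: "i < n \<Longrightarrow> a i < a (Suc i)"
  using part by (auto simp: associated_partition_def)

lemma a_mono: "i \<le> j \<Longrightarrow> j \<le> n \<Longrightarrow> a i \<le> a j"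
  using associated_partition_mono[OF part] .

lemma a_01: "i \<le> n \<Longrightarrow> 0 \<le> a i" "i \<le> n \<Longrightarrow> a i \<le> 1"
  using a_mono[of 0 i] a_mono[of i n] a_0 a_n by auto

lemma n_pos: "0 < n"
  using a_0 a_n by (cases n) auto

lemma tau_01: "x \<in> {0..1} \<Longrightarrow> \<tau> x \<in> {0..1}"
  using maps by blast

lemma iter_01: "x \<in> {0..1} \<Longrightarrow> (\<tau> ^^ k) x \<in> {0..1}"
  by (induction k) (auto intro: tau_01 simp del: atLeastAtMost_iff)

lemma cont_iter: "continuous_on {0..1} (\<tau> ^^ k)"
proof (induction k)
  case (Suc k)
  have "continuous_on ((\<tau> ^^ k) ` {0..1}) \<tau>"
    by (rule continuous_on_subset[OF cont]) (use iter_01 in auto)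
  then have "continuous_on {0..1} (\<tau> \<circ> (\<tau> ^^ k))" using Suc by (rule continuous_on_compose[rotated])
  then show ?case by simp
qed (simp add: continuous_on_id)

text \<open>The hypothesis speaks of the open lap; continuity extends the formula to its
  endpoints.\<close>

lemma lap_affine:
  assumes "1 \<le> i" "i \<le> n"
  obtains m b where "m = s \<or> m = - s" "\<And>x. a (i - 1) \<le> x \<Longrightarrow> x \<le> a i \<Longrightarrow> \<tau> x = m * x + b"
proof -
  obtain m b where m: "m \<in> {s, - s}" and b: "\<And>x. x \<in> {a (i - 1)<..<a i} \<Longrightarrow> \<tau> x = m * x + b"
    using lin assms unfolding linear_with_slopes_pm_def by fastforce
  have lt: "a (i - 1) < a i" using a_less[of "i - 1"] assms by simp
  have cl: "closure {a (i - 1)<..<a i} = {a (i - 1)..a i}" using lt by simp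
  have eq: "\<tau> x - m * x = b" if "a (i - 1) \<le> x" "x \<le> a i" for x
  proof (rule continuous_constant_on_closure[of "{a (i - 1)<..<a i}" "\<lambda>x. \<tau> x - m * x"])
    show "continuous_on (closure {a (i - 1)<..<a i}) (\<lambda>x. \<tau> x - m * x)"
      unfolding cl using a_01[of "i - 1"] a_01[of i] assms
      by (intro continuous_intros continuous_on_subset[OF cont]) auto
  qed (use cl that b in auto)
  have "\<tau> x = m * x + b" if "a (i - 1) \<le> x" "x \<le> a i" for x
    using eq[OF that] by linarith
  then show ?thesis using that m by blast
qed

lemma lap_at:
  assumes "0 \<le> x" "x < 1"
  obtains i m b where "1 \<le> i" "i \<le> n" "a (i - 1) \<le> x" "x < a i" "m = s \<or> m = - s"
    "\<And>y. a (i - 1) \<le> y \<Longrightarrow> y \<le> a i \<Longrightarrow> \<tau> y = m * y + b"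
proof -
  obtain i where i: "1 \<le> i" "i \<le> n" "a (i - 1) \<le> x" "x < a i"
    using associated_partition_lap[OF part assms] .
  show ?thesis by (rule lap_affine[OF i(1,2)]) (rule that[OF i])
qed

lemma right_affine:
  assumes "0 \<le> x" "x < 1"
  obtains \<delta> m where "\<delta> > 0" "x + \<delta> \<le> 1" "m = s \<or> m = - s"
    "\<And>y. x \<le> y \<Longrightarrow> y \<le> x + \<delta> \<Longrightarrow> \<tau> y = \<tau> x + m * (y - x)"
proof -
  obtain i m b where i: "1 \<le> i" "i \<le> n" "a (i - 1) \<le> x" "x < a i" and m: "m = s \<or> m = - s"
    and b: "\<And>x. a (i - 1) \<le> x \<Longrightarrow> x \<le> a i \<Longrightarrow> \<tau> x = m * x + b"
    by (rule lap_at[OF assms]) blast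
  show ?thesis
  proof (rule that[of "a i - x" m])
    fix y assume "x \<le> y" "y \<le> x + (a i - x)"
    then show "\<tau> y = \<tau> x + m * (y - x)" using b[of x] b[of y] i by (simp add: right_diff_distrib)
  qed (use i m a_01(2)[of i] in auto)
qed

text \<open>The lap needed here ends at or after \<open>x\<close> and begins strictly before it,
  whereas \<open>associated_partition_lap\<close> selects the lap to the right of
  \<open>x\<close>.\<close>

lemma left_affine:
  assumes "0 < x" "x \<le> 1"
  obtains \<delta> m where "\<delta> > 0" "0 \<le> x - \<delta>" "m = s \<or> m = - s"
    "\<And>y. x - \<delta> \<le> y \<Longrightarrow> y \<le> x \<Longrightarrow> \<tau> y = \<tau> x + m * (y - x)"
proof -
  define i where "i = (LEAST i. x \<le> a i)"
  have 1: "x \<le> a i" unfolding i_def by (rule LeastI[of _ n]) (use assms a_n in simp)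
  have 2: "i \<le> n" unfolding i_def by (rule Least_le) (use assms a_n in simp)
  have 3: "i \<noteq> 0" using 1 assms a_0 by (intro notI) simp
  then have "\<not> x \<le> a (i - 1)" using not_less_Least[of "i - 1" "\<lambda>i. x \<le> a i"] i_def by simp
  then have i: "1 \<le> i" "i \<le> n" "a (i - 1) < x" "x \<le> a i" using 1 2 3 by auto
  obtain m b where m: "m = s \<or> m = - s" and b: "\<And>x. a (i - 1) \<le> x \<Longrightarrow> x \<le> a i \<Longrightarrow> \<tau> x = m * x + b"
    by (rule lap_affine[OF i(1,2)]) blast
  show ?thesis
  proof (rule that[of "x - a (i - 1)" m])
    fix y assume "x - (x - a (i - 1)) \<le> y" "y \<le> x"
    then show "\<tau> y = \<tau> x + m * (y - x)" using b[of x] b[of y] i by (simp add: right_diff_distrib)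
  qed (use i m a_01(1)[of "i - 1"] in auto)
qed

lemma tau_lipschitz:
  assumes "x \<in> {0..1}" "y \<in> {0..1}"
  shows "\<bar>\<tau> x - \<tau> y\<bar> \<le> s * \<bar>x - y\<bar>"
proof -
  have "s-lipschitz_on {0..1} \<tau>"
  proof (rule lipschitz_on_closed_Union[of "{1..n}" s "\<lambda>i. {a (i - 1)..a i}"])
    fix i assume "i \<in> {1..n}"
    then have i: "1 \<le> i" "i \<le> n" by auto
    obtain m b where m: "m = s \<or> m = - s" and b: "\<And>x. a (i - 1) \<le> x \<Longrightarrow> x \<le> a i \<Longrightarrow> \<tau> x = m * x + b"
      by (rule lap_affine[OF i]) blast
    show "s-lipschitz_on {a (i - 1)..a i} \<tau>"
    proof (rule lipschitz_onI)
      fix x y assume "x \<in> {a (i - 1)..a i}" "y \<in> {a (i - 1)..a i}"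
      then have "\<tau> x - \<tau> y = m * (x - y)" using b[of x] b[of y] by (simp add: right_diff_distrib)
      then show "dist (\<tau> x) (\<tau> y) \<le> s * dist x y" using m s_pos by (auto simp: dist_real_def abs_mult)
    qed (use s_pos in simp)
  next
    show "{0..1} \<subseteq> (\<Union>i\<in>{1..n}. {a (i - 1)..a i})"
    proof
      fix x :: real assume x: "x \<in> {0..1}"
      show "x \<in> (\<Union>i\<in>{1..n}. {a (i - 1)..a i})"
      proof (cases "x = 1")
        case True
        then show ?thesis using n_pos a_n a_01(2)[of "n - 1"] by (intro UN_I[of n]) auto
      next
        case False
        then have "0 \<le> x" "x < 1" using x by auto
        then obtain i where "1 \<le> i" "i \<le> n" "a (i - 1) \<le> x" "x < a i"
          by (rule associated_partition_lap[OF part])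
        then show ?thesis by (intro UN_I[of i]) auto
      qed
    qed
  qed (use s_pos in auto)
  then show ?thesis using lipschitz_onD[of s "{0..1}" \<tau> x y] assms by (simp add: dist_real_def)
qed

section \<open>Consequences of mixing: expansion, surjectivity, exactness\<close>

lemma mixD:
  assumes "openin (top_of_set {0..1}) U" "openin (top_of_set {0..1}) V" "U \<noteq> {}" "V \<noteq> {}"
  shows "\<exists>k0. \<forall>k\<ge>k0. (\<tau> ^^ k) ` U \<inter> V \<noteq> {}"
  using mix assms unfolding topologically_mixing_def by blast

lemma openin_01: "open T \<Longrightarrow> openin (top_of_set {0..1::real}) ({0..1} \<inter> T)"
  by (rule openin_open_Int)

text \<open>All late images of the interval meet both end neighbourhoods and are connected. The
  endpoints themselves are not obtained, since mixing only speaks of open sets.\<close>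

lemma covers:
  assumes uv: "0 \<le> u" "u < v" "v \<le> 1" and e: "0 < e" "e < 1"
  obtains k0 where "\<And>k. k \<ge> k0 \<Longrightarrow> {e..1 - e} \<subseteq> (\<tau> ^^ k) ` {u<..<v}"
proof -
  have U: "openin (top_of_set {0..1::real}) {u<..<v}"
  proof -
    have "{u<..<v} = {0..1} \<inter> {u<..<v}" using uv by auto
    then show ?thesis using openin_01[of "{u<..<v}"] by simp
  qed
  have "0 \<in> {0..1} \<inter> {..<e}" "1 \<in> {0..1} \<inter> {1 - e<..}" using e by auto
  then have ne: "{0..1} \<inter> {..<e} \<noteq> {}" "{0..1} \<inter> {1 - e<..} \<noteq> {}" "{u<..<v} \<noteq> {}"
    using uv by (blast, blast, simp)
  obtain k1 where k1: "\<forall>k\<ge>k1. (\<tau> ^^ k) ` {u<..<v} \<inter> ({0..1} \<inter> {..<e}) \<noteq> {}"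
    using mixD[OF U openin_01[of "{..<e}"] ne(3,1)] by auto
  obtain k2 where k2: "\<forall>k\<ge>k2. (\<tau> ^^ k) ` {u<..<v} \<inter> ({0..1} \<inter> {1 - e<..}) \<noteq> {}"
    using mixD[OF U openin_01[of "{1 - e<..}"] ne(3,2)] by auto
  show ?thesis
  proof (rule that[of "max k1 k2"])
    fix k assume k: "k \<ge> max k1 k2"
    have "connected ((\<tau> ^^ k) ` {u<..<v})"
      by (intro connected_continuous_image continuous_on_subset[OF cont_iter]) (use uv in auto)
    moreover obtain p where "p \<in> (\<tau> ^^ k) ` {u<..<v}" "p < e" using k1 k by fastforce
    moreover obtain q where "q \<in> (\<tau> ^^ k) ` {u<..<v}" "1 - e < q" using k2 k by fastforce
    ultimately have "{p..q} \<subseteq> (\<tau> ^^ k) ` {u<..<v}" by (simp add: connected_contains_Icc)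
    moreover have "{e..1 - e} \<subseteq> {p..q}" using \<open>p < e\<close> \<open>1 - e < q\<close> by auto
    ultimately show "{e..1 - e} \<subseteq> (\<tau> ^^ k) ` {u<..<v}" by (rule subset_trans[rotated])
  qed
qed

text \<open>If \<open>s \<le> 1\<close>, no iterate increases distances, so no image of an interval
  of length 1/2 could contain both 1/8 and 7/8.\<close>

lemma s_gt_1: "1 < s"
proof (rule ccontr)
  assume "\<not> 1 < s"
  then have s: "s \<le> 1" by simp
  have c: "\<bar>(\<tau> ^^ k) x - (\<tau> ^^ k) y\<bar> \<le> \<bar>x - y\<bar>" if "x \<in> {0..1}" "y \<in> {0..1}" for k x y
  proof (induction k)
    case (Suc k)
    have "\<bar>\<tau> ((\<tau> ^^ k) x) - \<tau> ((\<tau> ^^ k) y)\<bar> \<le> s * \<bar>(\<tau> ^^ k) x - (\<tau> ^^ k) y\<bar>"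
      by (intro tau_lipschitz iter_01 that)
    also have "\<dots> \<le> \<bar>(\<tau> ^^ k) x - (\<tau> ^^ k) y\<bar>"
      using s s_pos by (simp add: mult_left_le_one_le)
    finally show ?case using Suc by simp
  qed simp
  obtain k0 where k: "\<And>k. k \<ge> k0 \<Longrightarrow> {1/8..1 - 1/8} \<subseteq> (\<tau> ^^ k) ` {0<..<1/2}"
    using covers[of 0 "1/2" "1/8"] by auto
  have "1/8 \<in> (\<tau> ^^ k0) ` {0<..<1/2}" "7/8 \<in> (\<tau> ^^ k0) ` {0<..<1/2}"
    using k[of k0] by (auto simp: subset_iff)
  then obtain x y where "x \<in> {0<..<1/2}" "y \<in> {0<..<1/2}" "1/8 = (\<tau> ^^ k0) x" "7/8 = (\<tau> ^^ k0) y"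
    by blast
  then show False using c[of x y k0] by auto
qed

text \<open>The image is closed, so its complement would be an open set that no iterate enters after
  the first step.\<close>

lemma tau_surj: "\<tau> ` {0..1} = {0..1}"
proof (rule ccontr)
  assume "\<tau> ` {0..1} \<noteq> {0..1}"
  then have ne: "{0..1} \<inter> - (\<tau> ` {0..1}) \<noteq> {}" using maps by auto
  have "closed (\<tau> ` {0..1})"
    by (intro compact_imp_closed compact_continuous_image cont) simp
  then have op: "openin (top_of_set {0..1::real}) ({0..1} \<inter> - (\<tau> ` {0..1}))"
    by (intro openin_01) (simp add: open_Compl)
  obtain k0 where k0: "\<forall>k\<ge>k0. (\<tau> ^^ k) ` {0..1} \<inter> ({0..1} \<inter> - (\<tau> ` {0..1})) \<noteq> {}"
    using mixD[OF _ op _ ne, of "{0..1}"] by auto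
  have "(\<tau> ^^ Suc k0) ` {0..1} \<subseteq> \<tau> ` {0..1}" using iter_01 by (auto simp del: atLeastAtMost_iff)
  then show False using k0[rule_format, of "Suc k0"] by auto
qed

lemma finite_fibre: "finite {x \<in> {0..1}. \<tau> x = y}"
proof -
  have "{x \<in> {0..1}. \<tau> x = y} \<subseteq> insert 1 (\<Union>i\<in>{1..n}. {x. a (i - 1) \<le> x \<and> x \<le> a i \<and> \<tau> x = y})"
  proof
    fix x assume x: "x \<in> {x \<in> {0..1}. \<tau> x = y}"
    show "x \<in> insert 1 (\<Union>i\<in>{1..n}. {x. a (i - 1) \<le> x \<and> x \<le> a i \<and> \<tau> x = y})"
    proof (cases "x = 1")
      case False
      then obtain i where "1 \<le> i" "i \<le> n" "a (i - 1) \<le> x" "x < a i"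
        using associated_partition_lap[OF part, of x] x by auto
      then show ?thesis using x by (auto intro!: bexI[of _ i])
    qed simp
  qed
  moreover have fin: "finite {x. a (i - 1) \<le> x \<and> x \<le> a i \<and> \<tau> x = y}" if "i \<in> {1..n}" for i
  proof -
    have i: "1 \<le> i" "i \<le> n" using that by auto
    obtain m b where m: "m = s \<or> m = - s" and b: "\<And>x. a (i - 1) \<le> x \<Longrightarrow> x \<le> a i \<Longrightarrow> \<tau> x = m * x + b"
      by (rule lap_affine[OF i]) blast
    have "{x. a (i - 1) \<le> x \<and> x \<le> a i \<and> \<tau> x = y} \<subseteq> {(y - b) / m}"
      using b m s_pos by (auto simp: field_simps)
    then show ?thesis by (rule finite_subset) simp
  qed
  ultimately show ?thesis using finite_UN_I[OF _ fin] by (auto elim!: finite_subset simp del: atLeastAtMost_iff)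
qed

lemma finite_preimage:
  assumes "finite F" shows "finite {x \<in> {0..1}. \<tau> x \<in> F}"
proof -
  have "{x \<in> {0..1}. \<tau> x \<in> F} = (\<Union>y\<in>F. {x \<in> {0..1}. \<tau> x = y})" by auto
  then show ?thesis using assms finite_fibre by auto
qed

lemma finite_iter_fibre: "finite {x \<in> {0..1}. (\<tau> ^^ k) x = y}"
proof (induction k arbitrary: y)
  case (Suc k)
  have "{x \<in> {0..1}. (\<tau> ^^ Suc k) x = y} = {x \<in> {0..1}. \<tau> x \<in> {z \<in> {0..1}. (\<tau> ^^ k) z = y}}"
    using tau_01 by (auto simp: funpow_Suc_right simp del: funpow.simps)
  then show ?case using finite_preimage[OF Suc] by simp
qed (simp add: finite_subset[of _ "{y}"] subset_iff)

text \<open>Otherwise the backward orbit \<open>B\<close> of \<open>b\<close> consists of endpoints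
  only. Counting preimages shows that \<open>\<tau>\<close> maps \<open>B\<close> onto itself and no
  other point into it, and since \<open>s > 1\<close> the set \<open>B\<close> repels. Points at
  distance at least \<open>\<epsilon>\<close> from \<open>B\<close> then keep that distance forever,
  against mixing.\<close>

lemma backward_orbit_of_endpoint_meets_interior:
  assumes b: "b = 0 \<or> b = 1"
  shows "\<exists>m y. 0 < y \<and> y < 1 \<and> (\<tau> ^^ m) y = b"
proof (rule ccontr)
  assume neg: "\<not> ?thesis"
  define B where "B = {x \<in> {0..1}. \<exists>m. (\<tau> ^^ m) x = b}"
  have bB: "b \<in> B" using b by (auto simp: B_def intro!: exI[of _ 0])
  have B01: "B \<subseteq> {0, 1}"
  proof
    fix x assume "x \<in> B"
    then obtain m where "0 \<le> x" "x \<le> 1" "(\<tau> ^^ m) x = b" by (auto simp: B_def)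
    moreover from this have "\<not> (0 < x \<and> x < 1)" using neg by blast
    ultimately show "x \<in> {0, 1}" by auto
  qed
  then have finB: "finite B" by (rule finite_subset) simp
  have bwd: "x \<in> B" if "x \<in> {0..1}" "\<tau> x \<in> B" for x
  proof -
    from that(2) obtain m where "(\<tau> ^^ m) (\<tau> x) = b" by (auto simp: B_def)
    then have "(\<tau> ^^ Suc m) x = b" by (simp add: funpow_Suc_right del: funpow.simps)
    then show ?thesis using that(1) unfolding B_def by blast
  qed
  define P where "P = {x \<in> {0..1}. \<tau> x \<in> B}"
  have "P \<subseteq> B" using bwd by (auto simp: P_def)
  have "\<tau> ` P = B"
  proof
    show "\<tau> ` P \<subseteq> B" by (auto simp: P_def)
    show "B \<subseteq> \<tau> ` P"
    proof
      fix z assume z: "z \<in> B"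
      then have "z \<in> \<tau> ` {0..1}" using tau_surj by (auto simp: B_def)
      then show "z \<in> \<tau> ` P" using z by (auto simp: P_def)
    qed
  qed
  then have "card B \<le> card P"
    using card_image_le[of P \<tau>] finite_subset[OF \<open>P \<subseteq> B\<close> finB] by simp
  then have "P = B" using card_seteq[OF finB \<open>P \<subseteq> B\<close>] by simp
  then have fwd: "\<tau> x \<in> B" if "x \<in> B" for x using that by (auto simp: P_def)
  obtain d0 m0 where d0: "d0 > 0" "m0 = s \<or> m0 = - s"
    "\<And>y. 0 \<le> y \<Longrightarrow> y \<le> 0 + d0 \<Longrightarrow> \<tau> y = \<tau> 0 + m0 * (y - 0)"
    by (rule right_affine[of 0]) (simp, simp, blast)
  obtain d1 m1 where d1: "d1 > 0" "m1 = s \<or> m1 = - s"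
    "\<And>y. 1 - d1 \<le> y \<Longrightarrow> y \<le> 1 \<Longrightarrow> \<tau> y = \<tau> 1 + m1 * (y - 1)"
    by (rule left_affine[of 1]) (simp, simp, blast)
  \<comment> \<open>Within \<open>r\<close> of an endpoint the affine germ applies, and the bound
    \<open>1 / (2 * s)\<close> keeps the image within 1/2 of the endpoint's image, hence at least
    1/2 away from the other endpoint.\<close>
  define r where "r = min (min d0 d1) (1 / (2 * s))"
  have r: "0 < r" "r \<le> d0" "r \<le> d1" "s * r \<le> 1 / 2"
  proof -
    have "r \<le> 1 / (2 * s)" by (simp add: r_def)
    then show "s * r \<le> 1 / 2" using s_pos by (simp add: field_simps)
  qed (use d0 d1 s_pos in \<open>auto simp: r_def\<close>)
  have expand: "\<bar>\<tau> x - \<tau> \<beta>\<bar> = s * \<bar>x - \<beta>\<bar>"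
    if "x \<in> {0..1}" "\<beta> \<in> {0, 1}" "\<bar>x - \<beta>\<bar> < r" for x \<beta>
  proof (cases "\<beta> = 0")
    case True
    then have "\<tau> x - \<tau> \<beta> = m0 * (x - \<beta>)" using d0(3)[of x] that r by auto
    then show ?thesis using d0(2) s_pos by (auto simp: abs_mult)
  next
    case False
    then have "\<beta> = 1" using that by auto
    then have "\<tau> x - \<tau> \<beta> = m1 * (x - \<beta>)" using d1(3)[of x] that r by auto
    then show ?thesis using d1(2) s_pos by (auto simp: abs_mult)
  qed
  define C where "C = {x \<in> {0..1}. \<forall>\<beta>\<in>B. r \<le> \<bar>x - \<beta>\<bar>}"
  have "closed C"
  proof -
    have "C = {0..1} \<inter> (\<Inter>\<beta>\<in>B. {x. r \<le> \<bar>x - \<beta>\<bar>})" by (auto simp: C_def)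
    moreover have "closed {x. r \<le> \<bar>x - \<beta>\<bar>}" for \<beta> :: real
      by (intro closed_Collect_le continuous_intros)
    ultimately show ?thesis by auto
  qed
  then have "compact C"
    by (metis (no_types, lifting) C_def bounded_closed_interval bounded_subset compact_eq_bounded_closed mem_Collect_eq subsetI)
  then have closed_tC: "closed (\<tau> ` C)"
    by (intro compact_imp_closed compact_continuous_image continuous_on_subset[OF cont]) (auto simp: C_def)
  \<comment> \<open>This is backward invariance of \<open>B\<close>; compactness of \<open>C\<close>
    turns it into the positive distances \<open>c\<close>.\<close>
  have avoid: "\<beta> \<notin> \<tau> ` C" if "\<beta> \<in> B" for \<beta>
    using bwd that r(1) by (force simp: C_def)
  have "\<exists>c>0. \<forall>z\<in>\<tau> ` C. c \<le> \<bar>\<beta> - z\<bar>" if "\<beta> \<in> B" for \<beta>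
    using separate_point_closed[OF closed_tC avoid[OF that]] by (simp add: dist_real_def)
  then obtain c where c: "\<And>\<beta>. \<beta> \<in> B \<Longrightarrow> c \<beta> > 0 \<and> (\<forall>z\<in>\<tau> ` C. c \<beta> \<le> \<bar>\<beta> - z\<bar>)" by metis
  \<comment> \<open>The value 1/3 puts the middle third inside \<open>W\<close> and stays below the
    1/2 secured by the choice of \<open>r\<close>.\<close>
  define \<epsilon> where "\<epsilon> = min (1/3) (Min (c ` B))"
  have eps: "0 < \<epsilon>" "\<epsilon> \<le> 1/3" "\<And>\<beta>. \<beta> \<in> B \<Longrightarrow> \<epsilon> \<le> c \<beta>"
  proof -
    have ne: "finite (c ` B)" "c ` B \<noteq> {}" using finB bB by auto
    have "0 < Min (c ` B)" using Min_in[OF ne] c by auto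
    then show "0 < \<epsilon>" by (simp add: \<epsilon>_def)
    show "\<epsilon> \<le> c \<beta>" if "\<beta> \<in> B" for \<beta>
      using Min_le[OF ne(1), of "c \<beta>"] that by (auto simp: \<epsilon>_def)
  qed (simp add: \<epsilon>_def)
  define W where "W = {x \<in> {0..1}. \<forall>\<beta>\<in>B. \<epsilon> \<le> \<bar>x - \<beta>\<bar>}"
  have inv: "\<tau> x \<in> W" if x: "x \<in> W" for x
  proof -
    have x01: "x \<in> {0..1}" using x by (simp add: W_def)
    have "\<epsilon> \<le> \<bar>\<tau> x - \<beta>\<bar>" if \<beta>: "\<beta> \<in> B" for \<beta>
    proof (cases "x \<in> C")
      case True
      then have "c \<beta> \<le> \<bar>\<beta> - \<tau> x\<bar>" using c[OF \<beta>] by auto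
      then show ?thesis using eps(3)[OF \<beta>] by auto
    next
      case False
      then obtain \<gamma> where g: "\<gamma> \<in> B" "\<bar>x - \<gamma>\<bar> < r" using x01 by (auto simp: C_def)
      then have e: "\<bar>\<tau> x - \<tau> \<gamma>\<bar> = s * \<bar>x - \<gamma>\<bar>" using expand x01 B01 by blast
      show ?thesis
      proof (cases "\<beta> = \<tau> \<gamma>")
        case True
        have "\<epsilon> \<le> \<bar>x - \<gamma>\<bar>" using x g by (auto simp: W_def)
        also have "\<dots> \<le> s * \<bar>x - \<gamma>\<bar>" using s_gt_1 mult_right_mono[of 1 s "\<bar>x - \<gamma>\<bar>"] by simp
        finally show ?thesis using True e by simp
      next
        case False
        have "s * \<bar>x - \<gamma>\<bar> \<le> s * r" using g s_pos by auto
        then have "\<bar>\<tau> x - \<tau> \<gamma>\<bar> \<le> 1/2" using e r(4) by linarith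
        moreover have "\<bar>\<beta> - \<tau> \<gamma>\<bar> = 1"
        proof -
          have "\<beta> \<in> {0, 1}" "\<tau> \<gamma> \<in> {0, 1}" using \<beta> fwd[OF g(1)] B01 by blast+
          then show ?thesis using False by auto
        qed
        ultimately show ?thesis using eps(2) by linarith
      qed
    qed
    then show ?thesis using tau_01[OF x01] by (simp add: W_def)
  qed
  have invk: "(\<tau> ^^ k) x \<in> W" if "x \<in> W" for k x
    by (induction k) (use that inv in auto)
  \<comment> \<open>With \<open>\<epsilon>/2\<close> the covered interval contains a point too close
    to \<open>b\<close> to lie in \<open>W\<close>.\<close>
  obtain k where "{\<epsilon>/2..1 - \<epsilon>/2} \<subseteq> (\<tau> ^^ k) ` {1/3<..<2/3}"
  proof -
    have "0 < \<epsilon>/2" "\<epsilon>/2 < 1" using eps by auto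
    then obtain k0 where k0: "\<And>k. k \<ge> k0 \<Longrightarrow> {\<epsilon>/2..1 - \<epsilon>/2} \<subseteq> (\<tau> ^^ k) ` {1/3<..<2/3}"
      by (rule covers[of "1/3" "2/3" "\<epsilon>/2", rotated 3]) (blast, simp, simp, simp)
    then show thesis using that by blast
  qed
  moreover have "{1/3<..<2/3} \<subseteq> W"
  proof
    fix x :: real assume x: "x \<in> {1/3<..<2/3}"
    have "\<epsilon> \<le> \<bar>x - \<beta>\<bar>" if "\<beta> \<in> B" for \<beta>
    proof -
      have "\<beta> \<in> {0, 1}" using that B01 by blast
      then show ?thesis using x eps by auto
    qed
    then show "x \<in> W" using x by (simp add: W_def)
  qed
  ultimately have "{\<epsilon>/2..1 - \<epsilon>/2} \<subseteq> W" using invk by blast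
  moreover have "\<epsilon>/2 \<in> {\<epsilon>/2..1 - \<epsilon>/2}" "1 - \<epsilon>/2 \<in> {\<epsilon>/2..1 - \<epsilon>/2}" using eps by auto
  ultimately have "\<epsilon>/2 \<in> W" "1 - \<epsilon>/2 \<in> W" by blast+
  then show False using bB b eps by (auto simp: W_def)
qed

text \<open>Each endpoint has an interior ancestor \<open>y\<close>, which all late images contain
  by \<open>covers\<close>; \<open>m\<close> steps later they contain the endpoint. Connectedness
  supplies the rest.\<close>

lemma exact:
  assumes uv: "0 \<le> u" "u < v" "v \<le> 1"
  shows "\<exists>k. (\<tau> ^^ k) ` {u<..<v} = {0..1}"
proof -
  have end_hit: "\<exists>k0. \<forall>k\<ge>k0. b \<in> (\<tau> ^^ k) ` {u<..<v}" if b: "b = 0 \<or> b = 1" for b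
  proof -
    obtain m y where y: "0 < y" "y < 1" "(\<tau> ^^ m) y = b"
      using backward_orbit_of_endpoint_meets_interior[OF b] by blast
    have "0 < min y (1 - y)" "min y (1 - y) < 1" using y by auto
    then obtain k0 where k0: "\<And>k. k \<ge> k0 \<Longrightarrow> {min y (1 - y)..1 - min y (1 - y)} \<subseteq> (\<tau> ^^ k) ` {u<..<v}"
      using covers[OF uv] by blast
    have "b \<in> (\<tau> ^^ k) ` {u<..<v}" if "k \<ge> m + k0" for k
    proof -
      have "y \<in> (\<tau> ^^ (k - m)) ` {u<..<v}" using k0[of "k - m"] that by (auto simp: subset_iff min_def)
      then obtain x where x: "x \<in> {u<..<v}" "y = (\<tau> ^^ (k - m)) x" by blast
      have "(\<tau> ^^ (m + (k - m))) x = (\<tau> ^^ m) ((\<tau> ^^ (k - m)) x)" by (simp only: funpow_add o_apply)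
      then have "(\<tau> ^^ k) x = b" using that x(2) y(3) by simp
      then show ?thesis using x(1) by blast
    qed
    then show ?thesis by blast
  qed
  obtain k0 k1 where k: "\<forall>k\<ge>k0. 0 \<in> (\<tau> ^^ k) ` {u<..<v}" "\<forall>k\<ge>k1. 1 \<in> (\<tau> ^^ k) ` {u<..<v}"
    using end_hit[of 0] end_hit[of 1] by blast
  let ?k = "max k0 k1"
  have "connected ((\<tau> ^^ ?k) ` {u<..<v})"
    by (intro connected_continuous_image continuous_on_subset[OF cont_iter]) (use uv in auto)
  then have "{0..1} \<subseteq> (\<tau> ^^ ?k) ` {u<..<v}" using k by (simp add: connected_contains_Icc)
  moreover have "(\<tau> ^^ ?k) ` {u<..<v} \<subseteq> {0..1}"
  proof
    fix z assume "z \<in> (\<tau> ^^ ?k) ` {u<..<v}"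
    then obtain x where "u < x" "x < v" "z = (\<tau> ^^ ?k) x" by auto
    then show "z \<in> {0..1}" using iter_01[of x ?k] uv by simp
  qed
  ultimately show ?thesis by blast
qed

text \<open>The possible break points of \<open>\<tau> ^^ k\<close>, between which the iterate is
  affine; \<open>brk 0\<close> is empty, as befits the identity.\<close>

definition brk :: "nat \<Rightarrow> real set" where
  "brk k = {x \<in> {0..1}. \<exists>j<k. (\<tau> ^^ j) x \<in> a ` {..n}}"

lemma finite_brk: "finite (brk k)"
proof -
  have "brk k = (\<Union>j<k. \<Union>i\<le>n. {x \<in> {0..1}. (\<tau> ^^ j) x = a i})" by (auto simp: brk_def)
  then show ?thesis using finite_iter_fibre by simp
qed

lemma affine_off_partition:
  assumes uv: "0 \<le> u" "u < v" "v \<le> 1" and no: "{u<..<v} \<inter> a ` {..n} = {}"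
  obtains m b where "m = s \<or> m = - s" "\<And>x. u \<le> x \<Longrightarrow> x \<le> v \<Longrightarrow> \<tau> x = m * x + b"
proof -
  obtain i where i: "1 \<le> i" "i \<le> n" "a (i - 1) \<le> u" "u < a i"
    using associated_partition_lap[OF part, of u] uv by auto
  have "a i \<notin> {u<..<v}" using no i(2) by blast
  then have v: "v \<le> a i" using i(4) by simp
  obtain m b where m: "m = s \<or> m = - s" and b: "\<And>x. a (i - 1) \<le> x \<Longrightarrow> x \<le> a i \<Longrightarrow> \<tau> x = m * x + b"
    by (rule lap_affine[OF i(1,2)]) blast
  show ?thesis by (rule that[OF m]) (use b i(3) v in force)
qed

text \<open>A partition point inside the image under \<open>\<tau> ^^ k\<close> would pull back to a
  member of \<open>brk (Suc k)\<close>; so the image lies within one lap.\<close>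

lemma iter_affine:
  assumes uv: "0 \<le> u" "u < v" "v \<le> 1" and no: "{u<..<v} \<inter> brk k = {}"
  shows "\<exists>m b. (m = s ^ k \<or> m = - (s ^ k)) \<and> (\<forall>x. u \<le> x \<longrightarrow> x \<le> v \<longrightarrow> (\<tau> ^^ k) x = m * x + b)"
  using no
proof (induction k)
  case 0
  show ?case by (intro exI[of _ 1] exI[of _ 0]) simp
next
  case (Suc k)
  have "{u<..<v} \<inter> brk k = {}" using Suc.prems by (auto simp: brk_def intro: less_SucI)
  then obtain m b where m: "m = s ^ k \<or> m = - (s ^ k)"
    and b: "\<And>x. u \<le> x \<Longrightarrow> x \<le> v \<Longrightarrow> (\<tau> ^^ k) x = m * x + b" using Suc.IH by blast
  have m0: "m \<noteq> 0" using m s_pos by auto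
  define p where "p = min (m * u + b) (m * v + b)"
  define q where "q = max (m * u + b) (m * v + b)"
  have "m * u \<noteq> m * v" using m0 uv by simp
  then have pq: "p < q" unfolding p_def q_def min_def max_def by (smt (verit))
  have ends: "(\<tau> ^^ k) u = m * u + b" "(\<tau> ^^ k) v = m * v + b" using b uv by auto
  have p01: "0 \<le> p" "q \<le> 1"
    using iter_01[of u k] iter_01[of v k] uv unfolding p_def q_def ends by auto
  have inside: "p \<le> m * x + b \<and> m * x + b \<le> q" if "u \<le> x" "x \<le> v" for x
    using affine_image_between[OF m0, of u x v b] that unfolding p_def q_def
    by (cases "x = u"; cases "x = v") auto
  have "{p<..<q} \<inter> a ` {..n} = {}"
  proof (rule ccontr)
    assume "\<not> ?thesis"
    then obtain i where i: "i \<le> n" "p < a i" "a i < q" by auto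
    define x where "x = (a i - b) / m"
    have mx: "m * x + b = a i" using m0 by (simp add: x_def)
    have "u < x \<and> x < v"
      using affine_preimage_between[OF m0 uv(2), of b "a i"] i unfolding x_def p_def q_def by auto
    moreover from this have "(\<tau> ^^ k) x = a i" using b mx by simp
    ultimately have "x \<in> {u<..<v} \<inter> brk (Suc k)" using i uv by (auto simp: brk_def intro!: exI[of _ k])
    then show False using Suc.prems by blast
  qed
  then obtain m' b' where m': "m' = s \<or> m' = - s" and b': "\<And>x. p \<le> x \<Longrightarrow> x \<le> q \<Longrightarrow> \<tau> x = m' * x + b'"
    by (rule affine_off_partition[OF p01(1) pq p01(2)]) blast
  show ?case
  proof (intro exI conjI allI impI)
    show "m' * m = s ^ Suc k \<or> m' * m = - (s ^ Suc k)" using m m' by auto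
    fix x assume x: "u \<le> x" "x \<le> v"
    have "\<tau> (m * x + b) = m' * (m * x + b) + b'" using b' inside[OF x] by blast
    then show "(\<tau> ^^ Suc k) x = m' * m * x + (m' * b + b')"
      using b[OF x] by (simp add: algebra_simps)
  qed
qed

section \<open>The invariant set \<open>I1\<close> and its density\<close>

text \<open>The interface to \<open>I1\<close> as the least fully invariant set that contains the
  partition points; generalized orbits are not unfolded again.\<close>

lemma I1_subset: "I1 \<tau> \<subseteq> {0..1}"
  and I1_tau: "x \<in> {0..1} \<Longrightarrow> \<tau> x \<in> I1 \<tau> \<longleftrightarrow> x \<in> I1 \<tau>"
  and partition_I1: "i \<le> n \<Longrightarrow> a i \<in> I1 \<tau>"
  and I1_least: "A \<subseteq> {0..1} \<Longrightarrow> (\<And>y. y \<in> {0..1} \<Longrightarrow> y \<in> A \<longleftrightarrow> \<tau> y \<in> A) \<Longrightarrow>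
    (\<And>i. i \<le> n \<Longrightarrow> a i \<in> A) \<Longrightarrow> I1 \<tau> \<subseteq> A"
proof -
  have pp: "partition_points \<tau> = a ` {..n}" by (rule partition_points_eq[OF part])
  let ?P = "\<lambda>A. A \<subseteq> {0..1} \<and> (\<forall>y\<in>{0..1}. y \<in> A \<longleftrightarrow> \<tau> y \<in> A)"
  have go: "generalized_orbit \<tau> x \<subseteq> {0..1} \<and> (\<forall>y\<in>{0..1}. y \<in> generalized_orbit \<tau> x \<longleftrightarrow> \<tau> y \<in> generalized_orbit \<tau> x)
      \<and> x \<in> generalized_orbit \<tau> x" if "x \<in> {0..1}" for x
  proof -
    have "?P {0..1}" using tau_01 by auto
    then have "?P (\<Inter>{A. ?P A \<and> {x} \<subseteq> A})" using that by blast
    then show ?thesis unfolding generalized_orbit_def hull_def by blast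
  qed
  have a01: "a i \<in> {0..1}" if "i \<le> n" for i using a_01 that by simp
  show "I1 \<tau> \<subseteq> {0..1}" unfolding I1_def pp using go a01 by blast
  show "\<tau> x \<in> I1 \<tau> \<longleftrightarrow> x \<in> I1 \<tau>" if "x \<in> {0..1}"
    unfolding I1_def pp using go[OF a01] that by blast
  show "a i \<in> I1 \<tau>" if "i \<le> n" unfolding I1_def pp using go[OF a01[OF that]] that by blast
  show "I1 \<tau> \<subseteq> A" if A: "A \<subseteq> {0..1}" "\<And>y. y \<in> {0..1} \<Longrightarrow> y \<in> A \<longleftrightarrow> \<tau> y \<in> A" "\<And>i. i \<le> n \<Longrightarrow> a i \<in> A"
  proof -
    have "generalized_orbit \<tau> (a i) \<subseteq> A" if "i \<le> n" for i
      unfolding generalized_orbit_def by (rule hull_minimal) (use A that in auto)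
    then show ?thesis unfolding I1_def pp by blast
  qed
qed

lemma I1_01: "x \<in> I1 \<tau> \<Longrightarrow> 0 \<le> x" "x \<in> I1 \<tau> \<Longrightarrow> x \<le> 1"
  using subsetD[OF I1_subset, of x] by auto

lemma zero_I1: "0 \<in> I1 \<tau>" and one_I1: "1 \<in> I1 \<tau>"
  using partition_I1[of 0] partition_I1[of n] a_0 a_n by auto

lemma I1_iter: "x \<in> {0..1} \<Longrightarrow> (\<tau> ^^ k) x \<in> I1 \<tau> \<longleftrightarrow> x \<in> I1 \<tau>"
  by (induction k) (use I1_tau iter_01 in auto)

lemma brk_subset_I1: "brk k \<subseteq> I1 \<tau>"
proof
  fix x assume "x \<in> brk k"
  then obtain j i where "x \<in> {0..1}" "i \<le> n" "(\<tau> ^^ j) x = a i" by (auto simp: brk_def)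
  then show "x \<in> I1 \<tau>" using I1_iter[of x j] partition_I1[of i] by metis
qed

text \<open>The set \<open>A\<close> of points whose forward orbit meets that of a partition point
  is fully invariant, and it is countable because all iterates have finite fibres.\<close>

lemma countable_I1: "countable (I1 \<tau>)"
proof -
  define A where "A = {x \<in> {0..1}. \<exists>m k. \<exists>i\<le>n. (\<tau> ^^ m) x = (\<tau> ^^ k) (a i)}"
  have "A = (\<Union>m. \<Union>k. \<Union>i\<le>n. {x \<in> {0..1}. (\<tau> ^^ m) x = (\<tau> ^^ k) (a i)})" by (auto simp: A_def)
  moreover have "countable \<dots>"
    by (intro countable_UN countableI_type countable_finite[OF finite_iter_fibre] countable_finite[OF finite_atMost])
  ultimately have "countable A" by simp
  moreover have "I1 \<tau> \<subseteq> A"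
  proof (rule I1_least)
    show "y \<in> A \<longleftrightarrow> \<tau> y \<in> A" if y: "y \<in> {0..1}" for y
    proof
      assume "y \<in> A"
      then obtain m k i where i: "i \<le> n" "(\<tau> ^^ m) y = (\<tau> ^^ k) (a i)" by (auto simp: A_def)
      have "(\<tau> ^^ m) (\<tau> y) = \<tau> ((\<tau> ^^ m) y)" by (simp add: funpow_swap1)
      also have "\<dots> = (\<tau> ^^ Suc k) (a i)" using i by simp
      finally show "\<tau> y \<in> A" using i(1) tau_01[OF y] unfolding A_def by blast
    next
      assume "\<tau> y \<in> A"
      then obtain m k i where i: "i \<le> n" "(\<tau> ^^ m) (\<tau> y) = (\<tau> ^^ k) (a i)" by (auto simp: A_def)
      then have "(\<tau> ^^ Suc m) y = (\<tau> ^^ k) (a i)" by (simp add: funpow_swap1)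
      then show "y \<in> A" using i(1) y unfolding A_def by blast
    qed
    show "a i \<in> A" if "i \<le> n" for i
      unfolding A_def using a_01[OF that] that by (auto intro!: exI[of _ 0] exI[of _ i])
  qed (auto simp: A_def)
  ultimately show ?thesis by (rule countable_subset[rotated])
qed

text \<open>With a single lap, \<open>\<tau> 1 - \<tau> 0\<close> would be plus or minus
  \<open>s\<close>, which is too large in absolute value.\<close>

lemma partition_interior: "0 < a 1" "a 1 < 1" "1 < n"
proof -
  show "1 < n"
  proof (rule ccontr)
    assume "\<not> 1 < n"
    then have n1: "n = 1" using n_pos by simp
    obtain m b where m: "m = s \<or> m = - s" and b: "\<And>x. a (1 - 1) \<le> x \<Longrightarrow> x \<le> a 1 \<Longrightarrow> \<tau> x = m * x + b"
      by (rule lap_affine[of 1]) (use n1 in auto)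
    have "\<tau> 1 - \<tau> 0 = m" using b[of 0] b[of 1] a_0 a_n n1 by simp
    moreover have "0 \<le> \<tau> 0" "\<tau> 0 \<le> 1" "0 \<le> \<tau> 1" "\<tau> 1 \<le> 1" using tau_01[of 0] tau_01[of 1] by auto
    ultimately show False using m s_gt_1 by auto
  qed
  then show "0 < a 1" "a 1 < 1" using a_less[of 0] a_less[of 1] a_mono[of 2 n] a_0 a_n
    by (auto simp: numeral_2_eq_2)
qed

text \<open>By exactness every interval contains a preimage of the interior partition point
  \<open>a 1\<close>. Density provides cut points wherever they are wanted.\<close>

lemma I1_dense:
  assumes "0 \<le> u" "u < v" "v \<le> 1"
  obtains x where "x \<in> I1 \<tau>" "u < x" "x < v"
proof -
  obtain k where "(\<tau> ^^ k) ` {u<..<v} = {0..1}" using exact[OF assms] by blast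
  then have "a 1 \<in> (\<tau> ^^ k) ` {u<..<v}" using partition_interior by auto
  then obtain x where x: "u < x" "x < v" "(\<tau> ^^ k) x = a 1" by auto
  then have "x \<in> I1 \<tau>" using I1_iter[of x k] partition_I1[of 1] partition_interior assms by auto
  then show ?thesis using that x by blast
qed

text \<open>\<open>I1\<close> is countable. This density is what makes \<open>X0\<close> dense in
  \<open>X\<close> and the local homeomorphism unique.\<close>

lemma I0_dense:
  assumes "0 \<le> u" "u < v" "v \<le> 1"
  obtains x where "x \<in> I0 \<tau>" "u < x" "x < v"
proof -
  have "\<not> {u<..<v} \<subseteq> I1 \<tau>"
    using countable_I1 uncountable_open_interval[of u v] assms countable_subset by blast
  then obtain x where "x \<in> {u<..<v}" "x \<notin> I1 \<tau>" by blast
  moreover from this have "x \<in> I0 \<tau>" using assms by (simp add: I0_def)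
  ultimately show ?thesis using that by simp
qed

lemma I0_01: "x \<in> I0 \<tau> \<Longrightarrow> 0 < x" "x \<in> I0 \<tau> \<Longrightarrow> x < 1"
  using zero_I1 one_I1 by (auto simp: I0_def less_le)

subsection \<open>The order topology and the local homeomorphism\<close>

abbreviation X :: "(real \<times> bool) set" where "X \<equiv> X_space \<tau>"

lemma X_iff: "p \<in> X \<longleftrightarrow> 0 \<le> fst p \<and> fst p \<le> 1 \<and> (snd p \<longrightarrow> fst p \<in> I1 \<tau> \<and> 0 < fst p \<and> fst p < 1)"
  by (cases p; cases "snd p") (use I1_01 in \<open>force simp: X_space_def\<close>)+

text \<open>A point of \<open>X\<close> is approached from the left unless it is \<open>0\<close> or some \<open>x\<^sup>+\<close>, and from the right unless
  it is \<open>1\<close> or some \<open>x\<^sup>-\<close>.\<close>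

definition appL :: "real \<times> bool \<Rightarrow> bool" where
  "appL p \<longleftrightarrow> \<not> snd p \<and> 0 < fst p"

definition appR :: "real \<times> bool \<Rightarrow> bool" where
  "appR p \<longleftrightarrow> snd p \<or> fst p = 0 \<or> fst p < 1 \<and> fst p \<notin> I1 \<tau>"

text \<open>One-sided metric neighbourhoods, which replace the rays of the order topology. The twin
  of a doubled point \<open>p\<close> is never in \<open>nb p \<epsilon>\<close>.\<close>

definition nb :: "real \<times> bool \<Rightarrow> real \<Rightarrow> (real \<times> bool) set" where
  "nb p \<epsilon> = {q \<in> X. q = p \<or> appL p \<and> fst p - \<epsilon> < fst q \<and> fst q < fst p
      \<or> appR p \<and> fst p < fst q \<and> fst q < fst p + \<epsilon>}"

lemma nb_mono: "\<epsilon> \<le> \<delta> \<Longrightarrow> nb p \<epsilon> \<subseteq> nb p \<delta>"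
  by (auto simp: nb_def)

lemma nb_self: "p \<in> X \<Longrightarrow> p \<in> nb p \<epsilon>"
  by (simp add: nb_def)

lemma not_appR_iff: "p \<in> X \<Longrightarrow> \<not> appR p \<Longrightarrow> \<not> snd p \<and> 0 < fst p \<and> (fst p = 1 \<or> fst p \<in> I1 \<tau> \<and> fst p < 1)"
  by (auto simp: appR_def X_iff)

lemma openin_X: "openin (X_topology \<tau>) X"
  unfolding X_topology_def openin_topology_generated_by_iff
  by (rule generate_topology_on.Basis) blast

lemma openin_ray:
  assumes "p \<in> X"
  shows "openin (X_topology \<tau>) {q \<in> X. X_less q p}" "openin (X_topology \<tau>) {q \<in> X. X_less p q}"
  unfolding X_topology_def openin_topology_generated_by_iff
  by (rule generate_topology_on.Basis; use assms in blast)+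

lemma nb_contains_open:
  assumes p: "p \<in> X" and e: "\<epsilon> > 0"
  obtains V where "openin (X_topology \<tau>) V" "p \<in> V" "V \<subseteq> nb p \<epsilon>"
proof -
  obtain x b where pb: "p = (x, b)" by (cases p)
  have x: "0 \<le> x" "x \<le> 1" "b \<Longrightarrow> x \<in> I1 \<tau> \<and> 0 < x \<and> x < 1" using p pb by (auto simp: X_iff)
  \<comment> \<open>The left cut is at \<open>\<epsilon>/2\<close> because the ray above
    \<open>(x - \<epsilon>/2, False)\<close> also contains the twin
    \<open>(x - \<epsilon>/2, True)\<close> if there is one; the ray on the right has no such extra
    point. On a side from which \<open>p\<close> is not approached, the twin of \<open>p\<close>, if
    any, is the bound.\<close>
  define A where "A = (if appL p then {q \<in> X. X_less (max (x - \<epsilon>/2) 0, False) q}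
     else if b then {q \<in> X. X_less (x, False) q} else X)"
  define B where "B = (if appR p then {q \<in> X. X_less q (min (x + \<epsilon>) 1, False)}
     else if x < 1 then {q \<in> X. X_less q (x, True)} else X)"
  have mem: "(max (x - \<epsilon>/2) 0, False) \<in> X" "(x, False) \<in> X" "(min (x + \<epsilon>) 1, False) \<in> X"
    using x e by (auto simp: X_iff)
  have "(x, True) \<in> X" if "x < 1" "\<not> appR p" using that x not_appR_iff[OF p] pb by (auto simp: X_iff)
  then have "openin (X_topology \<tau>) B"
    unfolding B_def using openin_ray(1)[OF mem(3)] openin_ray(1)[of "(x, True)"] openin_X by auto
  moreover have "openin (X_topology \<tau>) A"
    unfolding A_def using openin_ray(2)[OF mem(1)] openin_ray(2)[OF mem(2)] openin_X by auto
  moreover have "p \<in> A" using p x e by (auto simp: A_def pb X_less_def appL_def max_def)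
  moreover have "p \<in> B" using p x e not_appR_iff[OF p] by (auto simp: B_def pb X_less_def appR_def min_def)
  moreover have "A \<inter> B \<subseteq> nb p \<epsilon>"
  proof
    fix q assume q: "q \<in> A \<inter> B"
    then have qX: "q \<in> X" by (auto simp: A_def split: if_splits)
    obtain y c where qc: "q = (y, c)" by (cases q)
    have y: "0 \<le> y" "y \<le> 1" "c \<Longrightarrow> y \<in> I1 \<tau> \<and> 0 < y \<and> y < 1" using qX qc by (auto simp: X_iff)
    have left: "y < x \<Longrightarrow> appL p \<and> x - \<epsilon> < y" using q x y e
      by (auto simp: A_def pb qc X_less_def appL_def split: if_splits)
    have right: "x < y \<Longrightarrow> appR p \<and> y < x + \<epsilon>" using q x y e not_appR_iff[OF p]
      by (auto simp: B_def pb qc X_less_def split: if_splits)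
    have "q = p" if "y = x"
    proof -
      have "c = b"
      proof (rule ccontr)
        assume "c \<noteq> b"
        then consider "c" "\<not> b" | "b" "\<not> c" by auto
        then show False
        proof cases
          case 1
          then have "\<not> appR p" using y x \<open>y = x\<close> by (auto simp: appR_def pb)
          then show False using q 1 y(3) \<open>y = x\<close> by (auto simp: B_def pb qc X_less_def split: if_splits)
        next
          case 2
          then show False using q \<open>y = x\<close> by (auto simp: A_def pb qc X_less_def appL_def split: if_splits)
        qed
      qed
      then show ?thesis using that pb qc by simp
    qed
    then show "q \<in> nb p \<epsilon>" using left right qX unfolding nb_def pb qc by force
  qed
  ultimately show ?thesis using that[of "A \<inter> B"] by (auto intro: openin_Int)
qed

lemma openin_X_iff:
  "openin (X_topology \<tau>) U \<longleftrightarrow> U \<subseteq> X \<and> (\<forall>p\<in>U. \<exists>\<epsilon>>0. nb p \<epsilon> \<subseteq> U)" (is "_ = ?T U")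
proof
  assume "openin (X_topology \<tau>) U"
  then have gen: "generate_topology_on ({X}
      \<union> {{q \<in> X. X_less q p} | p. p \<in> X} \<union> {{q \<in> X. X_less p q} | p. p \<in> X}) U"
    unfolding X_topology_def openin_topology_generated_by_iff .
  show "?T U"
  proof (rule generate_topology_on_coarsest[OF _ _ gen])
    show "istopology ?T"
      unfolding istopology_def
    proof (intro conjI allI impI)
      fix S T assume S: "?T S" and T: "?T T"
      show "S \<inter> T \<subseteq> X" using S by blast
      show "\<forall>p\<in>S \<inter> T. \<exists>\<epsilon>>0. nb p \<epsilon> \<subseteq> S \<inter> T"
      proof
        fix p assume "p \<in> S \<inter> T"
        then obtain d e where "d > 0" "nb p d \<subseteq> S" "e > 0" "nb p e \<subseteq> T" using S T by blast
        then show "\<exists>\<epsilon>>0. nb p \<epsilon> \<subseteq> S \<inter> T"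
          using nb_mono[of "min d e" d p] nb_mono[of "min d e" e p]
          by (intro exI[of _ "min d e"]) auto
      qed
    next
      fix K assume K: "\<forall>S\<in>K. ?T S"
      show "\<Union>K \<subseteq> X" using K by blast
      show "\<forall>p\<in>\<Union>K. \<exists>\<epsilon>>0. nb p \<epsilon> \<subseteq> \<Union>K"
      proof
        fix p assume "p \<in> \<Union>K"
        then obtain S where S: "S \<in> K" "p \<in> S" by blast
        then obtain e where "e > 0" "nb p e \<subseteq> S" using K by blast
        then show "\<exists>\<epsilon>>0. nb p \<epsilon> \<subseteq> \<Union>K" using S by blast
      qed
    qed
    have lo: "?T {q \<in> X. X_less q r}" if r: "r \<in> X" for r
    proof (intro conjI ballI)
      fix p assume p: "p \<in> {q \<in> X. X_less q r}"
      show "\<exists>\<epsilon>>0. nb p \<epsilon> \<subseteq> {q \<in> X. X_less q r}"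
      proof (cases "fst p < fst r")
        case True
        then show ?thesis using p by (intro exI[of _ "fst r - fst p"]) (auto simp: nb_def X_less_def)
      next
        case False
        then have "fst p = fst r" "\<not> snd p" "snd r" using p by (auto simp: X_less_def)
        then have "\<not> appR p" using r by (auto simp: appR_def X_iff)
        then show ?thesis using p \<open>fst p = fst r\<close> by (intro exI[of _ 1]) (auto simp: nb_def X_less_def)
      qed
    qed auto
    have hi: "?T {q \<in> X. X_less r q}" if r: "r \<in> X" for r
    proof (intro conjI ballI)
      fix p assume p: "p \<in> {q \<in> X. X_less r q}"
      show "\<exists>\<epsilon>>0. nb p \<epsilon> \<subseteq> {q \<in> X. X_less r q}"
      proof (cases "fst r < fst p")
        case True
        then show ?thesis using p by (intro exI[of _ "fst p - fst r"]) (auto simp: nb_def X_less_def)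
      next
        case False
        then have "fst p = fst r" "snd p" using p by (auto simp: X_less_def)
        then have "\<not> appL p" by (auto simp: appL_def)
        then show ?thesis using p \<open>fst p = fst r\<close> by (intro exI[of _ 1]) (auto simp: nb_def X_less_def)
      qed
    qed auto
    have "?T X" by (auto simp: nb_def intro!: exI[of _ 1])
    then show "?T S" if "S \<in> {X} \<union> {{q \<in> X. X_less q p} | p. p \<in> X} \<union> {{q \<in> X. X_less p q} | p. p \<in> X}" for S
      using that lo hi by blast
  qed
next
  assume T: "?T U"
  show "openin (X_topology \<tau>) U"
  proof (subst openin_subopen, intro ballI)
    fix p assume p: "p \<in> U"
    then obtain e where e: "e > 0" "nb p e \<subseteq> U" using T by blast
    have "p \<in> X" using p T by blast
    then obtain V where "openin (X_topology \<tau>) V" "p \<in> V" "V \<subseteq> nb p e"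
      using nb_contains_open e(1) by blast
    then show "\<exists>V. openin (X_topology \<tau>) V \<and> p \<in> V \<and> V \<subseteq> U" using e(2) by blast
  qed
qed

lemma topspace_X: "topspace (X_topology \<tau>) = X"
proof
  show "topspace (X_topology \<tau>) \<subseteq> X" using openin_X_iff openin_topspace by blast
  have "openin (X_topology \<tau>) X"
    by (auto simp: openin_X_iff nb_def intro!: exI[of _ 1])
  then show "X \<subseteq> topspace (X_topology \<tau>)" by (rule openin_subset)
qed

lemma openin_nb:
  assumes "\<epsilon> > 0" shows "openin (X_topology \<tau>) (nb p \<epsilon>)"
  unfolding openin_X_iff
proof (intro conjI ballI)
  fix q assume q: "q \<in> nb p \<epsilon>"
  show "\<exists>\<delta>>0. nb q \<delta> \<subseteq> nb p \<epsilon>"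
  proof (cases "q = p")
    case True
    then show ?thesis using assms by auto
  next
    case False
    then consider "appL p" "fst p - \<epsilon> < fst q" "fst q < fst p" | "appR p" "fst p < fst q" "fst q < fst p + \<epsilon>"
      using q by (auto simp: nb_def)
    then show ?thesis
    proof cases
      case 1
      then show ?thesis
        by (intro exI[of _ "min (fst q - (fst p - \<epsilon>)) (fst p - fst q)"]) (auto simp: nb_def)
    next
      case 2
      then show ?thesis
        by (intro exI[of _ "min (fst q - fst p) (fst p + \<epsilon> - fst q)"]) (auto simp: nb_def)
    qed
  qed
qed (auto simp: nb_def)

lemma nb_dist: "q \<in> nb p \<epsilon> \<Longrightarrow> 0 < \<epsilon> \<Longrightarrow> \<bar>fst q - fst p\<bar> < \<epsilon>"
  by (auto simp: nb_def)

lemma nb_subset_X: "nb p \<epsilon> \<subseteq> X"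
  by (auto simp: nb_def)

text \<open>Twins are separated by neighbourhoods of any radius, as one is approached only from the
  left and the other only from the right.\<close>

lemma Hausdorff_X: "Hausdorff_space (X_topology \<tau>)"
  unfolding Hausdorff_space_def topspace_X
proof (intro allI impI)
  fix p q assume pq: "p \<in> X \<and> q \<in> X \<and> p \<noteq> q"
  have "\<exists>\<epsilon>>0. disjnt (nb p \<epsilon>) (nb q \<epsilon>)"
  proof (cases "fst p = fst q")
    case False
    have "disjnt (nb p (\<bar>fst p - fst q\<bar> / 2)) (nb q (\<bar>fst p - fst q\<bar> / 2))"
      unfolding disjnt_iff
    proof (intro allI notI)
      fix r assume "r \<in> nb p (\<bar>fst p - fst q\<bar> / 2) \<and> r \<in> nb q (\<bar>fst p - fst q\<bar> / 2)"
      then have "\<bar>fst r - fst p\<bar> < \<bar>fst p - fst q\<bar> / 2" "\<bar>fst r - fst q\<bar> < \<bar>fst p - fst q\<bar> / 2"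
        using nb_dist[of r p "\<bar>fst p - fst q\<bar> / 2"] nb_dist[of r q "\<bar>fst p - fst q\<bar> / 2"] False by auto
      moreover have "\<bar>fst p - fst q\<bar> \<le> \<bar>fst r - fst p\<bar> + \<bar>fst r - fst q\<bar>" by linarith
      ultimately show False by argo
    qed
    then show ?thesis using False by (intro exI[of _ "\<bar>fst p - fst q\<bar> / 2"]) simp
  next
    case True
    then have "snd p \<noteq> snd q" using pq by (auto simp: prod_eq_iff)
    then have "disjnt (nb p 1) (nb q 1)"
      using True pq by (cases "snd p") (auto simp: disjnt_def nb_def appL_def appR_def X_iff)
    then show ?thesis by (intro exI[of _ 1]) simp
  qed
  then obtain e where "e > 0" and dj: "disjnt (nb p e) (nb q e)" by blast
  then show "\<exists>U V. openin (X_topology \<tau>) U \<and> openin (X_topology \<tau>) V \<and> p \<in> U \<and> q \<in> V \<and> disjnt U V"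
    using openin_nb[OF \<open>e > 0\<close>] nb_self pq
    by (intro exI[of _ "nb p e"] exI[of _ "nb q e"] conjI dj) auto
qed

lemma continuous_map_X_I:
  assumes "\<And>p. p \<in> X \<Longrightarrow> g p \<in> X"
    and nb: "\<And>p \<epsilon>. p \<in> X \<Longrightarrow> \<epsilon> > 0 \<Longrightarrow> \<exists>\<delta>>0. \<forall>q\<in>nb p \<delta>. g q \<in> nb (g p) \<epsilon>"
  shows "continuous_map (X_topology \<tau>) (X_topology \<tau>) g"
  unfolding continuous_map_def topspace_X
proof (intro conjI allI impI)
  show "g \<in> X \<rightarrow> X" using assms(1) by blast
  fix U assume U: "openin (X_topology \<tau>) U"
  show "openin (X_topology \<tau>) {x \<in> X. g x \<in> U}"
    unfolding openin_X_iff
  proof (intro conjI ballI)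
    fix p assume p: "p \<in> {x \<in> X. g x \<in> U}"
    then obtain e where "e > 0" "nb (g p) e \<subseteq> U" using U unfolding openin_X_iff by blast
    moreover from this(1) obtain d where "d > 0" "\<forall>q\<in>nb p d. g q \<in> nb (g p) e" using nb p by blast
    ultimately show "\<exists>\<delta>>0. nb p \<delta> \<subseteq> {x \<in> X. g x \<in> U}"
      using nb_subset_X by (intro exI[of _ d]) blast
  qed auto
qed

lemma continuous_map_discrete_iff:
  "continuous_map (X_topology \<tau>) (discrete_topology UNIV) f \<longleftrightarrow>
     (\<forall>p\<in>X. \<exists>\<delta>>0. \<forall>q\<in>nb p \<delta>. f q = f p)"
proof
  assume f: "continuous_map (X_topology \<tau>) (discrete_topology UNIV) f"
  show "\<forall>p\<in>X. \<exists>\<delta>>0. \<forall>q\<in>nb p \<delta>. f q = f p"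
  proof
    fix p assume p: "p \<in> X"
    have "openin (X_topology \<tau>) {x \<in> X. f x \<in> {f p}}"
      using openin_continuous_map_preimage[OF f, of "{f p}"] by (simp add: topspace_X)
    then show "\<exists>\<delta>>0. \<forall>q\<in>nb p \<delta>. f q = f p" using p unfolding openin_X_iff by blast
  qed
next
  assume R: "\<forall>p\<in>X. \<exists>\<delta>>0. \<forall>q\<in>nb p \<delta>. f q = f p"
  show "continuous_map (X_topology \<tau>) (discrete_topology UNIV) f"
    unfolding continuous_map_def topspace_X
  proof (intro conjI allI impI)
    fix U
    show "openin (X_topology \<tau>) {x \<in> X. f x \<in> U}"
      unfolding openin_X_iff
    proof (intro conjI ballI)
      fix p assume p: "p \<in> {x \<in> X. f x \<in> U}"
      then obtain d where "d > 0" "\<forall>q\<in>nb p d. f q = f p" using R by blast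
      then show "\<exists>\<delta>>0. nb p \<delta> \<subseteq> {x \<in> X. f x \<in> U}"
        using p by (intro exI[of _ d]) (auto simp: nb_def)
    qed auto
  qed auto
qed

section \<open>Density of \<open>X0\<close> and the explicit local homeomorphism\<close>

lemma nb_meets_X0:
  assumes p: "p \<in> X" and e: "\<epsilon> > 0"
  shows "nb p \<epsilon> \<inter> X0 \<tau> \<noteq> {}"
proof -
  have x: "0 \<le> fst p" "fst p \<le> 1" using p by (auto simp: X_iff)
  have *: "\<exists>y\<in>I0 \<tau>. appL p \<and> fst p - \<epsilon> < y \<and> y < fst p \<or> appR p \<and> fst p < y \<and> y < fst p + \<epsilon>"
  proof (cases "appR p")
    case True
    then have "fst p < 1" using p by (auto simp: appR_def X_iff)
    then obtain y where "y \<in> I0 \<tau>" "fst p < y" "y < min 1 (fst p + \<epsilon>)"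
      using I0_dense[of "fst p" "min 1 (fst p + \<epsilon>)"] x e by auto
    then show ?thesis using True by auto
  next
    case False
    then have L: "appL p" "0 < fst p" using not_appR_iff[OF p] by (auto simp: appL_def)
    then obtain y where "y \<in> I0 \<tau>" "max 0 (fst p - \<epsilon>) < y" "y < fst p"
      using I0_dense[of "max 0 (fst p - \<epsilon>)" "fst p"] x e by auto
    then show ?thesis using L by auto
  qed
  then obtain y where "y \<in> I0 \<tau>" and y: "appL p \<and> fst p - \<epsilon> < y \<and> y < fst p \<or> appR p \<and> fst p < y \<and> y < fst p + \<epsilon>"
    by blast
  then have "(y, False) \<in> X0 \<tau>" using I0_01[of y] by (auto simp: X0_def X_iff)
  moreover from this have "(y, False) \<in> nb p \<epsilon>" using y by (auto simp: nb_def X0_def)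
  ultimately show ?thesis by blast
qed

lemma closure_of_X0:
  assumes "p \<in> X" shows "p \<in> X_topology \<tau> closure_of X0 \<tau>"
  unfolding in_closure_of topspace_X
proof (intro conjI allI impI)
  fix U assume U: "p \<in> U \<and> openin (X_topology \<tau>) U"
  then obtain e where "e > 0" "nb p e \<subseteq> U" unfolding openin_X_iff by blast
  then show "\<exists>y. y \<in> X0 \<tau> \<and> y \<in> U" using nb_meets_X0[OF assms, of e] by blast
qed (rule assms)

text \<open>At a point of \<open>I1\<close>, which is approached from one side only, \<open>up\<close> records whether \<open>\<tau>\<close> approaches its
  value there from above; this decides between \<open>\<tau> x\<^sup>+\<close> and \<open>\<tau> x\<^sup>-\<close>.\<close>

definition up :: "real \<times> bool \<Rightarrow> bool" where
  "up p \<longleftrightarrow> (\<exists>\<delta>>0. \<forall>y. (if snd p \<or> fst p = 0 then fst p < y \<and> y < fst p + \<delta>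
      else fst p - \<delta> < y \<and> y < fst p) \<longrightarrow> \<tau> (fst p) < \<tau> y)"

text \<open>The explicit candidate for \<open>local_homeo \<tau>\<close>; the side is consulted only
  when the value is a doubled point.\<close>

definition sg :: "real \<times> bool \<Rightarrow> real \<times> bool" where
  "sg p = (\<tau> (fst p), \<tau> (fst p) \<in> I1 \<tau> - {0, 1} \<and> up p)"

lemma up_right:
  assumes side: "snd p \<or> fst p = 0" and d: "\<delta> > 0" and m: "m = s \<or> m = - s"
    and aff: "\<And>y. fst p \<le> y \<Longrightarrow> y \<le> fst p + \<delta> \<Longrightarrow> \<tau> y = \<tau> (fst p) + m * (y - fst p)"
  shows "up p \<longleftrightarrow> 0 < m"
proof
  assume "up p"
  then obtain e where e: "e > 0" "\<And>y. fst p < y \<Longrightarrow> y < fst p + e \<Longrightarrow> \<tau> (fst p) < \<tau> y"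
    using side unfolding up_def by auto
  define y where "y = fst p + min e \<delta> / 2"
  have y: "fst p < y" "y < fst p + e" "y \<le> fst p + \<delta>" using e(1) d by (auto simp: y_def min_def)
  have "0 < m * (y - fst p)" using e(2)[OF y(1,2)] aff[of y] y by simp
  then show "0 < m" using y(1) by (simp add: zero_less_mult_iff)
next
  assume "0 < m"
  show "up p" unfolding up_def
  proof (intro exI[of _ \<delta>] conjI allI impI d)
    fix y assume "if snd p \<or> fst p = 0 then fst p < y \<and> y < fst p + \<delta> else fst p - \<delta> < y \<and> y < fst p"
    then have y: "fst p < y" "y < fst p + \<delta>" using side by auto
    have "0 < m * (y - fst p)" using \<open>0 < m\<close> y by simp
    then show "\<tau> (fst p) < \<tau> y" using aff[of y] y by simp
  qed
qed

lemma up_left: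
  assumes side: "\<not> snd p" "fst p \<noteq> 0" and d: "\<delta> > 0" and m: "m = s \<or> m = - s"
    and aff: "\<And>y. fst p - \<delta> \<le> y \<Longrightarrow> y \<le> fst p \<Longrightarrow> \<tau> y = \<tau> (fst p) + m * (y - fst p)"
  shows "up p \<longleftrightarrow> m < 0"
proof
  assume "up p"
  then obtain e where e: "e > 0" "\<And>y. fst p - e < y \<Longrightarrow> y < fst p \<Longrightarrow> \<tau> (fst p) < \<tau> y"
    using side unfolding up_def by auto
  define y where "y = fst p - min e \<delta> / 2"
  have y: "y < fst p" "fst p - e < y" "fst p - \<delta> \<le> y" using e(1) d by (auto simp: y_def min_def)
  have "0 < m * (y - fst p)" using e(2)[OF y(2,1)] aff[of y] y by simp
  then show "m < 0" using y(1) by (simp add: zero_less_mult_iff)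
next
  assume "m < 0"
  show "up p" unfolding up_def
  proof (intro exI[of _ \<delta>] conjI allI impI d)
    fix y assume "if snd p \<or> fst p = 0 then fst p < y \<and> y < fst p + \<delta> else fst p - \<delta> < y \<and> y < fst p"
    then have y: "y < fst p" "fst p - \<delta> < y" using side by auto
    have "0 < m * (y - fst p)" using \<open>m < 0\<close> y by (simp add: mult_neg_neg)
    then show "\<tau> (fst p) < \<tau> y" using aff[of y] y by simp
  qed
qed

lemma sg_X: "p \<in> X \<Longrightarrow> sg p \<in> X"
  using tau_01[of "fst p"] I1_01 by (force simp: X_iff sg_def less_le)

lemma fst_sg [simp]: "fst (sg p) = \<tau> (fst p)"
  by (simp add: sg_def)

lemma I0_tau: "x \<in> I0 \<tau> \<Longrightarrow> \<tau> x \<in> I0 \<tau>"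
  using I1_tau tau_01 by (auto simp: I0_def simp del: atLeastAtMost_iff)

text \<open>The sign of the slope decides whether the side of approach is kept or reversed. The
  value cannot be the endpoint that would forbid this side, because the affine piece stays inside
  the unit interval.\<close>

lemma sg_right:
  assumes p: "p \<in> X" and R: "appR p" and d: "\<delta> > 0" "fst p + \<delta> \<le> 1" and m: "m = s \<or> m = - s"
    and aff: "\<And>y. fst p \<le> y \<Longrightarrow> y \<le> fst p + \<delta> \<Longrightarrow> \<tau> y = \<tau> (fst p) + m * (y - fst p)"
  shows "0 < m \<Longrightarrow> appR (sg p)" "m < 0 \<Longrightarrow> appL (sg p)"
proof -
  have x: "0 \<le> fst p" "fst p < 1" using p d by (auto simp: X_iff)
  have t01: "0 \<le> \<tau> (fst p)" "\<tau> (fst p) \<le> 1" using tau_01[of "fst p"] x by auto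
  have y01: "0 \<le> \<tau> (fst p + \<delta>)" "\<tau> (fst p + \<delta>) \<le> 1" using tau_01[of "fst p + \<delta>"] x d by auto
  have ty: "\<tau> (fst p + \<delta>) = \<tau> (fst p) + m * \<delta>" using aff[of "fst p + \<delta>"] d by simp
  consider "snd p \<or> fst p = 0" | "fst p \<in> I0 \<tau>" "\<not> snd p"
    using R x by (auto simp: appR_def I0_def)
  then have "(0 < m \<longrightarrow> appR (sg p)) \<and> (m < 0 \<longrightarrow> appL (sg p))"
  proof cases
    case 1
    then have I: "fst p \<in> I1 \<tau>" using p zero_I1 by (auto simp: X_iff)
    have I': "\<tau> (fst p) \<in> I1 \<tau>" using I1_tau[of "fst p"] I x by simp
    have u: "up p \<longleftrightarrow> 0 < m" by (rule up_right[OF 1 d(1) m aff])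
    have "m > 0 \<Longrightarrow> \<tau> (fst p) < 1" using ty y01 mult_pos_pos[OF _ d(1), of m] by linarith
    moreover have "m < 0 \<Longrightarrow> 0 < \<tau> (fst p)" using ty y01 mult_neg_pos[OF _ d(1), of m] by linarith
    ultimately show ?thesis using u I' t01 by (auto simp: appR_def appL_def sg_def)
  next
    case 2
    then have "\<tau> (fst p) \<in> I0 \<tau>" by (intro I0_tau)
    then show ?thesis using I0_01 by (auto simp: appR_def appL_def sg_def I0_def)
  qed
  then show "0 < m \<Longrightarrow> appR (sg p)" "m < 0 \<Longrightarrow> appL (sg p)" by auto
qed

lemma sg_left:
  assumes p: "p \<in> X" and L: "appL p" and d: "\<delta> > 0" "0 \<le> fst p - \<delta>" and m: "m = s \<or> m = - s"
    and aff: "\<And>y. fst p - \<delta> \<le> y \<Longrightarrow> y \<le> fst p \<Longrightarrow> \<tau> y = \<tau> (fst p) + m * (y - fst p)"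
  shows "0 < m \<Longrightarrow> appL (sg p)" "m < 0 \<Longrightarrow> appR (sg p)"
proof -
  have x: "0 < fst p" "fst p \<le> 1" "\<not> snd p" using p d L by (auto simp: X_iff appL_def)
  have t01: "0 \<le> \<tau> (fst p)" "\<tau> (fst p) \<le> 1" using tau_01[of "fst p"] x by auto
  have y01: "0 \<le> \<tau> (fst p - \<delta>)" "\<tau> (fst p - \<delta>) \<le> 1" using tau_01[of "fst p - \<delta>"] x d by auto
  have ty: "\<tau> (fst p - \<delta>) = \<tau> (fst p) - m * \<delta>" using aff[of "fst p - \<delta>"] d by simp
  have "(0 < m \<longrightarrow> appL (sg p)) \<and> (m < 0 \<longrightarrow> appR (sg p))"
  proof (cases "fst p \<in> I1 \<tau>")
    case True
    have I': "\<tau> (fst p) \<in> I1 \<tau>" using I1_tau[of "fst p"] True x by simp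
    have "fst p \<noteq> 0" using x by simp
    have u: "up p \<longleftrightarrow> m < 0" by (rule up_left[OF x(3) \<open>fst p \<noteq> 0\<close> d(1) m aff])
    have "m > 0 \<Longrightarrow> 0 < \<tau> (fst p)" using ty y01 mult_pos_pos[OF _ d(1), of m] by linarith
    moreover have "m < 0 \<Longrightarrow> \<tau> (fst p) < 1" using ty y01 mult_neg_pos[OF _ d(1), of m] by linarith
    ultimately show ?thesis using u I' t01 by (auto simp: appR_def appL_def sg_def)
  next
    case False
    then have "fst p \<in> I0 \<tau>" using x by (simp add: I0_def)
    then have "\<tau> (fst p) \<in> I0 \<tau>" by (intro I0_tau)
    then show ?thesis using I0_01 by (auto simp: appR_def appL_def sg_def I0_def)
  qed
  then show "0 < m \<Longrightarrow> appL (sg p)" "m < 0 \<Longrightarrow> appR (sg p)" by auto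
qed

lemma sg_nb:
  assumes p: "p \<in> X" and e: "\<epsilon> > 0"
  shows "\<exists>\<delta>>0. \<forall>q\<in>nb p \<delta>. sg q \<in> nb (sg p) \<epsilon>"
proof -
  have x: "0 \<le> fst p" "fst p \<le> 1" using p by (auto simp: X_iff)
  have cls: "sg q \<in> nb (sg p) \<epsilon>"
    if "q \<in> X" "(appR (sg p) \<and> 0 < d) \<or> (appL (sg p) \<and> d < 0)" "\<bar>d\<bar> < \<epsilon>" "\<tau> (fst q) = \<tau> (fst p) + d" for q d
    using that sg_X[OF that(1)] by (auto simp: nb_def)
  obtain d1 where d1: "d1 > 0" "\<And>q. q \<in> X \<Longrightarrow> appR p \<Longrightarrow> fst p < fst q \<Longrightarrow> fst q < fst p + d1 \<Longrightarrow> sg q \<in> nb (sg p) \<epsilon>"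
  proof (cases "appR p")
    case True
    then have "fst p < 1" using p by (auto simp: appR_def X_iff)
    then obtain d m where d: "d > 0" "fst p + d \<le> 1" and m: "m = s \<or> m = - s"
      and aff: "\<And>y. fst p \<le> y \<Longrightarrow> y \<le> fst p + d \<Longrightarrow> \<tau> y = \<tau> (fst p) + m * (y - fst p)"
      by (rule right_affine[OF x(1)]) blast
    show ?thesis
    proof (rule that[of "min d (\<epsilon> / s)"])
      fix q assume q: "q \<in> X" "fst p < fst q" "fst q < fst p + min d (\<epsilon> / s)"
      have "fst q - fst p < \<epsilon> / s" using q by simp
      then have "s * (fst q - fst p) < \<epsilon>" using s_pos by (simp add: field_simps)
      then have "\<bar>m * (fst q - fst p)\<bar> < \<epsilon>" using m q s_pos by (auto simp: abs_mult)
      moreover have "0 < m \<and> 0 < m * (fst q - fst p) \<or> m < 0 \<and> m * (fst q - fst p) < 0"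
        using m q s_pos by (auto simp: mult_neg_pos)
      ultimately show "sg q \<in> nb (sg p) \<epsilon>"
        using sg_right[OF p True d m aff] q
        by (intro cls[of q "m * (fst q - fst p)"]) (auto intro: aff)
    qed (use d s_pos e in auto)
  qed (use that[of 1] in auto)
  obtain d2 where d2: "d2 > 0" "\<And>q. q \<in> X \<Longrightarrow> appL p \<Longrightarrow> fst p - d2 < fst q \<Longrightarrow> fst q < fst p \<Longrightarrow> sg q \<in> nb (sg p) \<epsilon>"
  proof (cases "appL p")
    case True
    then have "0 < fst p" by (auto simp: appL_def)
    then obtain d m where d: "d > 0" "0 \<le> fst p - d" and m: "m = s \<or> m = - s"
      and aff: "\<And>y. fst p - d \<le> y \<Longrightarrow> y \<le> fst p \<Longrightarrow> \<tau> y = \<tau> (fst p) + m * (y - fst p)"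
      by (rule left_affine[OF _ x(2)]) blast
    show ?thesis
    proof (rule that[of "min d (\<epsilon> / s)"])
      fix q assume q: "q \<in> X" "fst p - min d (\<epsilon> / s) < fst q" "fst q < fst p"
      have "fst p - fst q < \<epsilon> / s" using q by simp
      then have "s * (fst p - fst q) < \<epsilon>" using s_pos by (simp add: field_simps)
      then have "\<bar>m * (fst q - fst p)\<bar> < \<epsilon>" using m q s_pos by (auto simp: abs_mult)
      moreover have "0 < m \<and> m * (fst q - fst p) < 0 \<or> m < 0 \<and> 0 < m * (fst q - fst p)"
        using m q s_pos by (auto simp: mult_pos_neg mult_neg_neg)
      ultimately show "sg q \<in> nb (sg p) \<epsilon>"
        using sg_left[OF p True d m aff] q
        by (intro cls[of q "m * (fst q - fst p)"]) (auto intro: aff)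
    qed (use d s_pos e in auto)
  qed (use that[of 1] in auto)
  show ?thesis
  proof (intro exI[of _ "min d1 d2"] conjI ballI)
    fix q assume q: "q \<in> nb p (min d1 d2)"
    then have "q \<in> X" by (auto simp: nb_def)
    consider "q = p" | "appL p" "fst p - d2 < fst q" "fst q < fst p" | "appR p" "fst p < fst q" "fst q < fst p + d1"
      using q by (auto simp: nb_def)
    then show "sg q \<in> nb (sg p) \<epsilon>"
    proof cases
      case 1
      then show ?thesis using nb_self sg_X[OF p] by simp
    qed (use d1 d2 \<open>q \<in> X\<close> in auto)
  qed (use d1 d2 in auto)
qed

text \<open>On \<open>X0\<close> the values are not doubled, so the semiconjugacy determines the map
  there; continuity determines it on the closure, since \<open>X\<close> is Hausdorff.\<close>

lemma local_homeo_eq: "local_homeo \<tau> = restrict sg X"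
  unfolding local_homeo_def
proof (rule the_equality)
  have eqv: "\<sigma> p = sg p"
    if "fst (\<sigma> p) = \<tau> (fst p)" "\<sigma> p \<in> X" "p \<in> X0 \<tau>" for \<sigma> p
  proof -
    have "\<tau> (fst p) \<in> I0 \<tau>" using that(3) I0_tau by (auto simp: X0_def)
    then show ?thesis using that by (auto simp: prod_eq_iff sg_def I0_def X_iff)
  qed
  have cont_sg: "continuous_map (X_topology \<tau>) (X_topology \<tau>) (restrict sg X)"
    by (rule continuous_map_eq[of _ _ sg])
      (auto intro!: continuous_map_X_I sg_X sg_nb simp: topspace_X)
  then show "restrict sg X \<in> extensional X \<and> continuous_map (X_topology \<tau>) (X_topology \<tau>) (restrict sg X)
      \<and> (\<forall>p\<in>X0 \<tau>. fst (restrict sg X p) = \<tau> (fst p))"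
    by (auto simp: X0_def)
  fix \<sigma> assume s: "\<sigma> \<in> extensional X \<and> continuous_map (X_topology \<tau>) (X_topology \<tau>) \<sigma>
      \<and> (\<forall>p\<in>X0 \<tau>. fst (\<sigma> p) = \<tau> (fst p))"
  show "\<sigma> = restrict sg X"
  proof
    fix p
    show "\<sigma> p = restrict sg X p"
    proof (cases "p \<in> X")
      case True
      show ?thesis
      proof (rule forall_in_closure_of_eq[OF closure_of_X0[OF True] Hausdorff_X _ cont_sg])
        show "continuous_map (X_topology \<tau>) (X_topology \<tau>) \<sigma>" using s by blast
        fix q assume q: "q \<in> X0 \<tau>"
        then have "q \<in> X" by (simp add: X0_def)
        moreover from this have "\<sigma> q \<in> X" using s by (auto simp: continuous_map_def topspace_X)
        ultimately show "\<sigma> q = restrict sg X q" using eqv[of \<sigma> q] q s by simp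
      qed
    next
      case False
      then show ?thesis using s extensional_arb[of \<sigma> X p] by simp
    qed
  qed
qed

lemma finite_sg_fibre: "finite {q \<in> X. sg q = p}"
proof -
  have "{q \<in> X. sg q = p} \<subseteq> {x \<in> {0..1}. \<tau> x = fst p} \<times> UNIV"
    by (auto simp: X_iff sg_def)
  then show ?thesis by (rule finite_subset) (use finite_fibre in auto)
qed

subsection \<open>Order intervals and the transfer operator\<close>

definition seg :: "real \<Rightarrow> real \<Rightarrow> bool" where
  "seg u v \<longleftrightarrow> u \<in> I1 \<tau> \<and> v \<in> I1 \<tau> \<and> u < v"

lemma seg_01: "seg u v \<Longrightarrow> 0 \<le> u \<and> u < v \<and> v \<le> 1"
  using I1_01 by (auto simp: seg_def)

text \<open>The order interval from \<open>u\<^sup>+\<close> to \<open>v\<^sup>-\<close>; the endpoint \<open>0\<close> is not doubled, hence \<open>u \<noteq> 0\<close>.\<close>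

definition ibox :: "real \<Rightarrow> real \<Rightarrow> (real \<times> bool) set" where
  "ibox u v = {q \<in> X. u < fst q \<and> fst q < v \<or> q = (u, u \<noteq> 0) \<or> q = (v, False)}"

text \<open>Real-valued although \<open>C(X, \<int>)\<close> is integral: normalisation by
  \<open>s\<close> and coupling both leave the integers.\<close>

definition bx :: "real \<Rightarrow> real \<Rightarrow> real \<times> bool \<Rightarrow> real" where
  "bx u v p = of_bool (p \<in> ibox u v)"

lemma left_end_X: "seg u v \<Longrightarrow> (u, u \<noteq> 0) \<in> X"
  using seg_01[of u v] by (auto simp: X_iff seg_def)

lemma right_end_X: "seg u v \<Longrightarrow> (v, False) \<in> X"
  using seg_01[of u v] by (auto simp: X_iff)

lemma bx_split:
  assumes "seg u e" "seg e v" "p \<in> X"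
  shows "bx u v p = bx u e p + bx e v p"
proof -
  have "0 \<le> u" "u < e" "e < v" using assms seg_01 by auto
  then show ?thesis using assms(3)
    by (cases p; cases "snd p"; cases "fst p < e"; cases "fst p = e") (auto simp: bx_def ibox_def)
qed

lemma bx_0_1: "p \<in> X \<Longrightarrow> bx 0 1 p = 1"
  by (cases p; cases "snd p") (auto simp: bx_def ibox_def X_iff)

lemma bx_integral:
  assumes "seg u v"
  shows "((\<lambda>x. bx u v (x, False)) has_integral (v - u)) {0..1}"
proof -
  have uv: "0 \<le> u" "u < v" "v \<le> 1" using seg_01[OF assms] by auto
  have "((\<lambda>x. indicat_real {u..v} x) has_integral (v - u)) {0..1}"
    using has_integral_restrict_closed_subinterval[of "\<lambda>x. 1::real" "v - u" u v 0 1] uv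
      has_integral_const_real[of "1::real" u v]
    by (simp add: indicator_def of_bool_def if_distrib cong: if_cong)
  then show ?thesis
    by (rule has_integral_spike_finite[of "{u, v}", rotated 2])
      (use uv in \<open>auto simp: bx_def ibox_def X_iff indicator_def\<close>)
qed

text \<open>The order interval is clopen: at \<open>u\<close> and \<open>v\<close> the twins fall on
  different sides of its boundary, and their neighbourhoods are one-sided.\<close>

lemma bx_locally_constant:
  assumes uv: "seg u v" and p: "p \<in> X"
  shows "\<exists>\<delta>>0. \<forall>q\<in>nb p \<delta>. bx u v q = bx u v p"
proof -
  have b: "0 \<le> u" "u < v" "v \<le> 1" and I: "u \<in> I1 \<tau>" "v \<in> I1 \<tau>"
    using seg_01[OF uv] uv by (auto simp: seg_def)
  have far: "\<exists>\<delta>>0. \<forall>q\<in>nb p \<delta>. bx u v q = bx u v p" if "fst p \<noteq> u" "fst p \<noteq> v"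
  proof -
    define d where "d = min \<bar>fst p - u\<bar> \<bar>fst p - v\<bar>"
    have "d > 0" using that by (simp add: d_def)
    moreover have "bx u v q = bx u v p" if q: "q \<in> nb p d" for q
    proof -
      have "\<bar>fst q - fst p\<bar> < d" using nb_dist[OF q \<open>d > 0\<close>] .
      then have "(u < fst q \<longleftrightarrow> u < fst p) \<and> (fst q < v \<longleftrightarrow> fst p < v) \<and> fst q \<noteq> u \<and> fst q \<noteq> v"
        unfolding d_def by (auto simp: abs_if split: if_splits)
      then show ?thesis using \<open>fst p \<noteq> u\<close> \<open>fst p \<noteq> v\<close> q p nb_subset_X
        by (cases p; cases q) (auto simp: bx_def ibox_def)
    qed
    ultimately show ?thesis by blast
  qed
  consider "fst p \<noteq> u" "fst p \<noteq> v" | "fst p = u" | "fst p = v" by blast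
  then show ?thesis
  proof cases
    case 1 then show ?thesis by (rule far)
  next
    case 2
    show ?thesis
    proof (cases "appR p")
      case True
      then have nl: "\<not> appL p" "p = (u, u \<noteq> 0)" using 2 I b p by (auto simp: appR_def appL_def X_iff prod_eq_iff)
      then show ?thesis using b p
        by (intro exI[of _ "v - u"]) (auto simp: nb_def bx_def ibox_def)
    next
      case False
      then have "p = (u, False)" "u \<noteq> 0" using 2 by (auto simp: appR_def prod_eq_iff)
      then show ?thesis using False b
        by (intro exI[of _ 1]) (auto simp: nb_def bx_def ibox_def)
    qed
  next
    case 3
    show ?thesis
    proof (cases "appL p")
      case True
      then have nl: "\<not> appR p" "p = (v, False)" using 3 I b p by (auto simp: appR_def appL_def X_iff prod_eq_iff)
      then show ?thesis using b p
        by (intro exI[of _ "v - u"]) (auto simp: nb_def bx_def ibox_def)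
    next
      case False
      then have "p = (v, True)" using 3 b by (auto simp: appL_def prod_eq_iff)
      then show ?thesis using False b
        by (intro exI[of _ 1]) (auto simp: nb_def bx_def ibox_def)
    qed
  qed
qed

section \<open>The real transfer operator and affine branches\<close>

text \<open>The operator \<open>transfer\<close> on real-valued functions, with \<open>sg\<close> in
  place of the definite description.\<close>

definition tr :: "(real \<times> bool \<Rightarrow> real) \<Rightarrow> real \<times> bool \<Rightarrow> real" where
  "tr f p = (\<Sum>q | q \<in> X \<and> sg q = p. f q)"

lemma tr_cong: "(\<And>p. p \<in> X \<Longrightarrow> f p = g p) \<Longrightarrow> tr f = tr g"
  unfolding tr_def by (intro ext sum.cong) auto

lemma tr_add: "tr (\<lambda>p. f p + g p) = (\<lambda>p. tr f p + tr g p)"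
  by (simp add: tr_def sum.distrib fun_eq_iff)

lemma tr_scale: "tr (\<lambda>p. c * f p) = (\<lambda>p. c * tr f p)"
  by (simp add: tr_def sum_distrib_left fun_eq_iff)

lemma trk_cong: "(\<And>p. p \<in> X \<Longrightarrow> f p = g p) \<Longrightarrow> p \<in> X \<Longrightarrow> (tr ^^ k) f p = (tr ^^ k) g p"
  using tr_cong[of f g] by (cases k) (simp_all add: funpow_Suc_right del: funpow.simps)

lemma trk_add: "(tr ^^ k) (\<lambda>p. f p + g p) = (\<lambda>p. (tr ^^ k) f p + (tr ^^ k) g p)"
  by (induction k) (simp_all add: tr_add)

lemma trk_scale: "(tr ^^ k) (\<lambda>p. c * f p) = (\<lambda>p. c * (tr ^^ k) f p)"
  by (induction k) (simp_all add: tr_scale)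

lemma trk_diff: "(tr ^^ k) (\<lambda>p. f p - g p) = (\<lambda>p. (tr ^^ k) f p - (tr ^^ k) g p)"
  using trk_add[of k f "\<lambda>p. - 1 * g p"] unfolding trk_scale by simp

lemma trk_zero: "(tr ^^ k) (\<lambda>p. 0) = (\<lambda>p. 0)"
  using trk_scale[of k 0 "\<lambda>p. 0"] by simp

lemma tr_mono: "(\<And>q. q \<in> X \<Longrightarrow> f q \<le> g q) \<Longrightarrow> tr f p \<le> tr g p"
  unfolding tr_def by (rule sum_mono) simp

lemma trk_mono: "(\<And>q. q \<in> X \<Longrightarrow> f q \<le> g q) \<Longrightarrow> p \<in> X \<Longrightarrow> (tr ^^ k) f p \<le> (tr ^^ k) g p"
  by (induction k arbitrary: p) (simp_all add: tr_mono)

text \<open>An increasing branch preserves the signs of doubled points, a decreasing one exchanges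
  them.\<close>

lemma sg_in_interior:
  assumes uv: "seg u v" and m: "m = s \<or> m = - s" and aff: "\<And>x. u \<le> x \<Longrightarrow> x \<le> v \<Longrightarrow> \<tau> x = m * x + b"
    and q: "q \<in> X" "u < fst q" "fst q < v"
  shows "sg q = (\<tau> (fst q), fst q \<in> I1 \<tau> \<and> (snd q \<longleftrightarrow> 0 < m))"
    "min (\<tau> u) (\<tau> v) < \<tau> (fst q)" "\<tau> (fst q) < max (\<tau> u) (\<tau> v)"
proof -
  have uv01: "0 \<le> u" "v \<le> 1" "u < v" using seg_01[OF uv] by auto
  have m0: "m \<noteq> 0" using m s_pos by auto
  have e: "\<tau> u = m * u + b" "\<tau> v = m * v + b" "\<tau> (fst q) = m * fst q + b" using aff q uv01 by auto
  show between: "min (\<tau> u) (\<tau> v) < \<tau> (fst q)" "\<tau> (fst q) < max (\<tau> u) (\<tau> v)"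
    unfolding e by (rule affine_image_between[OF m0 q(2,3)])+
  have "0 \<le> \<tau> u" "0 \<le> \<tau> v" "\<tau> u \<le> 1" "\<tau> v \<le> 1" using tau_01[of u] tau_01[of v] uv01 by auto
  then have t: "0 < \<tau> (fst q)" "\<tau> (fst q) < 1" using between by auto
  have I: "\<tau> (fst q) \<in> I1 \<tau> \<longleftrightarrow> fst q \<in> I1 \<tau>" using I1_tau q uv01 by auto
  have "up q \<longleftrightarrow> (snd q \<longleftrightarrow> 0 < m)"
  proof (cases "snd q")
    case True
    have "up q \<longleftrightarrow> 0 < m"
    proof (rule up_right[of q "v - fst q" m])
      fix y assume "fst q \<le> y" "y \<le> fst q + (v - fst q)"
      then show "\<tau> y = \<tau> (fst q) + m * (y - fst q)" using aff[of y] e q by (simp add: right_diff_distrib)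
    qed (use True q m in auto)
    then show ?thesis using True by simp
  next
    case False
    have "up q \<longleftrightarrow> m < 0"
    proof (rule up_left[of q "fst q - u" m])
      fix y assume "fst q - (fst q - u) \<le> y" "y \<le> fst q"
      then show "\<tau> y = \<tau> (fst q) + m * (y - fst q)" using aff[of y] e q by (simp add: right_diff_distrib)
    qed (use False q m uv01 in auto)
    then show ?thesis using False m0 by auto
  qed
  then show "sg q = (\<tau> (fst q), fst q \<in> I1 \<tau> \<and> (snd q \<longleftrightarrow> 0 < m))"
    unfolding sg_def using t I by auto
qed

lemma seg_tau:
  assumes uv: "seg u v" and m: "m = s \<or> m = - s" and aff: "\<And>x. u \<le> x \<Longrightarrow> x \<le> v \<Longrightarrow> \<tau> x = m * x + b"
  shows "seg (min (\<tau> u) (\<tau> v)) (max (\<tau> u) (\<tau> v))"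
    "max (\<tau> u) (\<tau> v) - min (\<tau> u) (\<tau> v) = s * (v - u)"
proof -
  have uv01: "0 \<le> u" "v \<le> 1" "u < v" using seg_01[OF uv] by auto
  have I: "\<tau> u \<in> I1 \<tau>" "\<tau> v \<in> I1 \<tau>" using I1_tau uv uv01 by (auto simp: seg_def)
  have "\<tau> v - \<tau> u = m * (v - u)" using aff uv01 by (simp add: right_diff_distrib)
  moreover have "\<bar>m\<bar> = s" using m s_pos by auto
  ultimately have "\<bar>\<tau> v - \<tau> u\<bar> = s * (v - u)" using uv01 by (simp add: abs_mult)
  then show d: "max (\<tau> u) (\<tau> v) - min (\<tau> u) (\<tau> v) = s * (v - u)"
    by (auto simp: max_def min_def)
  have "0 < s * (v - u)" using s_pos uv01 by simp
  then show "seg (min (\<tau> u) (\<tau> v)) (max (\<tau> u) (\<tau> v))"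
    using d I unfolding seg_def by (auto simp: min_def max_def)
qed

lemma sg_ends:
  assumes uv: "seg u v" and m: "m = s \<or> m = - s" and aff: "\<And>x. u \<le> x \<Longrightarrow> x \<le> v \<Longrightarrow> \<tau> x = m * x + b"
  defines "c \<equiv> min (\<tau> u) (\<tau> v)" and "d \<equiv> max (\<tau> u) (\<tau> v)"
  shows "sg (u, u \<noteq> 0) = (if 0 < m then (c, c \<noteq> 0) else (d, False))"
    "sg (v, False) = (if 0 < m then (d, False) else (c, c \<noteq> 0))"
proof -
  have uv01: "0 \<le> u" "v \<le> 1" "u < v" using seg_01[OF uv] by auto
  have sc: "seg c d" unfolding c_def d_def by (rule seg_tau(1)[OF uv m aff])
  have cd: "0 \<le> c" "c < d" "d \<le> 1" "c \<in> I1 \<tau>" "d \<in> I1 \<tau>"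
    using seg_01[OF sc] sc by (auto simp: seg_def)
  have diff: "\<tau> v - \<tau> u = m * (v - u)" using aff uv01 by (simp add: right_diff_distrib)
  have up1: "up (u, u \<noteq> 0) \<longleftrightarrow> 0 < m"
  proof (rule up_right[of _ "v - u"])
    fix y assume "fst (u, u \<noteq> 0) \<le> y" "y \<le> fst (u, u \<noteq> 0) + (v - u)"
    then show "\<tau> y = \<tau> (fst (u, u \<noteq> 0)) + m * (y - fst (u, u \<noteq> 0))" using aff[of y] aff[of u] uv01
      by (simp add: right_diff_distrib)
  qed (use uv01 m in auto)
  have up2: "up (v, False) \<longleftrightarrow> m < 0"
  proof (rule up_left[of _ "v - u"])
    fix y assume "fst (v, False) - (v - u) \<le> y" "y \<le> fst (v, False)"
    then show "\<tau> y = \<tau> (fst (v, False)) + m * (y - fst (v, False))" using aff[of y] aff[of v] uv01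
      by (simp add: right_diff_distrib)
  qed (use uv01 m in auto)
  have "(0 < m \<and> c = \<tau> u \<and> d = \<tau> v) \<or> (m < 0 \<and> c = \<tau> v \<and> d = \<tau> u)"
  proof (cases "0 < m")
    case True
    then have "0 < m * (v - u)" using uv01 by simp
    then show ?thesis using True diff by (auto simp: c_def d_def)
  next
    case False
    then have "m < 0" using m s_pos by auto
    then have "m * (v - u) < 0" using uv01 by (simp add: mult_neg_pos)
    then show ?thesis using \<open>m < 0\<close> diff by (auto simp: c_def d_def)
  qed
  then show "sg (u, u \<noteq> 0) = (if 0 < m then (c, c \<noteq> 0) else (d, False))"
    "sg (v, False) = (if 0 < m then (d, False) else (c, c \<noteq> 0))"
    using cd up1 up2 by (auto simp: sg_def)
qed

text \<open>The lift \<open>sg\<close> is a bijection from the order interval onto that of the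
  image, including the ends, so each fibre contributes one term or none.\<close>

lemma tr_bx:
  assumes uv: "seg u v" and m: "m = s \<or> m = - s" and aff: "\<And>x. u \<le> x \<Longrightarrow> x \<le> v \<Longrightarrow> \<tau> x = m * x + b"
    and p: "p \<in> X"
  shows "tr (bx u v) p = bx (min (\<tau> u) (\<tau> v)) (max (\<tau> u) (\<tau> v)) p"
proof -
  define c where "c = min (\<tau> u) (\<tau> v)"
  define d where "d = max (\<tau> u) (\<tau> v)"
  note ends = sg_ends[OF uv m aff, folded c_def d_def]
  have inner: "sg q = (\<tau> (fst q), fst q \<in> I1 \<tau> \<and> (snd q \<longleftrightarrow> 0 < m))" "c < \<tau> (fst q)" "\<tau> (fst q) < d"
    if "q \<in> X" "u < fst q" "fst q < v" for q
    using sg_in_interior[OF uv m aff that] unfolding c_def d_def by auto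
  have cd: "seg c d" using seg_tau(1)[OF uv m aff] by (simp add: c_def d_def)
  have uv01: "0 \<le> u" "v \<le> 1" "u < v" using seg_01[OF uv] by auto
  have m0: "m \<noteq> 0" using m s_pos by auto
  have into: "sg q \<in> ibox c d" if q: "q \<in> ibox u v" for q
  proof -
    have "sg q \<in> X" using q sg_X by (simp add: ibox_def)
    moreover consider "q \<in> X" "u < fst q" "fst q < v" | "q = (u, u \<noteq> 0)" | "q = (v, False)"
      using q by (auto simp: ibox_def)
    then have "c < fst (sg q) \<and> fst (sg q) < d \<or> sg q = (c, c \<noteq> 0) \<or> sg q = (d, False)"
      by cases (use inner(2,3)[of q] ends in auto)
    ultimately show ?thesis unfolding ibox_def by blast
  qed
  have onto: "\<exists>q\<in>ibox u v. sg q = p" if pcd: "p \<in> ibox c d"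
  proof -
    consider "c < fst p" "fst p < d" | "p = (c, c \<noteq> 0)" | "p = (d, False)" using pcd by (auto simp: ibox_def)
    then show ?thesis
    proof cases
      case 1
      define y where "y = (fst p - b) / m"
      have tu: "\<tau> u = m * u + b" "\<tau> v = m * v + b" using aff uv01 by auto
      have y: "u < y" "y < v"
        using affine_preimage_between[OF m0 uv01(3), of b "fst p"] 1 unfolding y_def c_def d_def tu by auto
      have ty: "\<tau> y = fst p" using aff[of y] y m0 by (simp add: y_def)
      have I: "y \<in> I1 \<tau> \<longleftrightarrow> fst p \<in> I1 \<tau>" using I1_tau[of y] y uv01 ty by simp
      define q where "q = (y, y \<in> I1 \<tau> \<and> (snd p \<longleftrightarrow> 0 < m))"
      have qX: "q \<in> X" using y uv01 by (simp add: q_def X_iff)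
      have "sg q = (\<tau> y, y \<in> I1 \<tau> \<and> (snd q \<longleftrightarrow> 0 < m))" using inner(1)[OF qX] y by (simp add: q_def)
      also have "\<dots> = p" using ty I p by (auto simp: q_def X_iff prod_eq_iff)
      finally show ?thesis using qX y by (intro bexI[of _ q]) (auto simp: ibox_def q_def)
    next
      case 2
      then show ?thesis
        using ends left_end_X[OF uv] right_end_X[OF uv]
        by (intro bexI[of _ "if 0 < m then (u, u \<noteq> 0) else (v, False)"]) (auto simp: ibox_def)
    next
      case 3
      then show ?thesis
        using ends left_end_X[OF uv] right_end_X[OF uv]
        by (intro bexI[of _ "if 0 < m then (v, False) else (u, u \<noteq> 0)"]) (auto simp: ibox_def)
    qed
  qed
  have inj: "q = q'" if q: "q \<in> ibox u v" "q' \<in> ibox u v" "sg q = sg q'" for q q'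
  proof -
    have r: "u \<le> fst q" "fst q \<le> v" "u \<le> fst q'" "fst q' \<le> v" using q uv01 by (auto simp: ibox_def)
    have "\<tau> (fst q) = \<tau> (fst q')" using q(3) fst_sg by metis
    then have f: "fst q = fst q'" using aff r m0 by auto
    show ?thesis
    proof (cases "u < fst q \<and> fst q < v")
      case True
      have X: "q \<in> X" "q' \<in> X" using q by (auto simp: ibox_def)
      have "(fst q \<in> I1 \<tau> \<and> (snd q \<longleftrightarrow> 0 < m)) \<longleftrightarrow> (fst q' \<in> I1 \<tau> \<and> (snd q' \<longleftrightarrow> 0 < m))"
        using inner(1)[of q] inner(1)[of q'] True X q(3) f by simp
      then have "snd q = snd q'" using f X by (auto simp: X_iff)
      then show ?thesis using f by (simp add: prod_eq_iff)
    next
      case False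
      then show ?thesis using q f uv01 by (auto simp: ibox_def)
    qed
  qed
  have fin: "finite {q. q \<in> X \<and> sg q = p}" by (rule finite_sg_fibre)
  show ?thesis
  proof (cases "p \<in> ibox c d")
    case True
    then obtain q0 where q0: "q0 \<in> ibox u v" "sg q0 = p" using onto by blast
    then have "q0 \<in> X" by (simp add: ibox_def)
    have "q \<in> ibox u v \<longleftrightarrow> q = q0" if "sg q = p" for q using inj[of q q0] q0 that by blast
    then have "tr (bx u v) p = (\<Sum>q | q \<in> X \<and> sg q = p. if q = q0 then 1 else 0)"
      unfolding tr_def bx_def by (intro sum.cong) auto
    also have "\<dots> = 1" using fin q0 \<open>q0 \<in> X\<close> by (simp add: sum.delta)
    finally show ?thesis using True by (simp add: bx_def c_def d_def)
  next
    case False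
    then have "tr (bx u v) p = 0" unfolding tr_def bx_def by (intro sum.neutral) (use into in auto)
    then show ?thesis using False by (simp add: bx_def c_def d_def)
  qed
qed

text \<open>A triple \<open>(c, u, v)\<close> in a list stands for \<open>c\<close> times the indicator of the order interval from \<open>u\<^sup>+\<close> to
  \<open>v\<^sup>-\<close>. Points of \<open>I1\<close> can serve as endpoints without any ambiguity at the cut points, so all identities
  between such combinations hold on all of \<open>X\<close>.\<close>

definition evl :: "(real \<times> real \<times> real) list \<Rightarrow> real \<times> bool \<Rightarrow> real" where
  "evl xs p = (\<Sum>(c, u, v)\<leftarrow>xs. c * bx u v p)"

definition good :: "(real \<times> real \<times> real) list \<Rightarrow> bool" where
  "good xs \<longleftrightarrow> (\<forall>(c, u, v)\<in>set xs. seg u v)"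

definition wt :: "(real \<times> real \<times> real) list \<Rightarrow> real" where
  "wt xs = (\<Sum>(c, u, v)\<leftarrow>xs. c)"

definition ar :: "(real \<times> real \<times> real) list \<Rightarrow> real" where
  "ar xs = (\<Sum>(c, u, v)\<leftarrow>xs. c * (v - u))"

definition scl :: "real \<Rightarrow> (real \<times> real \<times> real) list \<Rightarrow> (real \<times> real \<times> real) list" where
  "scl k xs = map (\<lambda>(c, u, v). (k * c, u, v)) xs"

definition coefs :: "(real \<times> real \<times> real) list \<Rightarrow> real set" where
  "coefs xs = fst ` set xs"

lemma list_simps [simp]:
  "evl [] p = 0" "evl ((c, u, v) # xs) p = c * bx u v p + evl xs p" "evl (xs @ ys) p = evl xs p + evl ys p"
  "good []" "good ((c, u, v) # xs) \<longleftrightarrow> seg u v \<and> good xs" "good (xs @ ys) \<longleftrightarrow> good xs \<and> good ys"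
  "wt [] = 0" "wt ((c, u, v) # xs) = c + wt xs" "wt (xs @ ys) = wt xs + wt ys"
  "ar [] = 0" "ar ((c, u, v) # xs) = c * (v - u) + ar xs" "ar (xs @ ys) = ar xs + ar ys"
  "coefs [] = {}" "coefs ((c, u, v) # xs) = insert c (coefs xs)" "coefs (xs @ ys) = coefs xs \<union> coefs ys"
  by (simp_all add: evl_def good_def wt_def ar_def coefs_def ball_Un image_Un)

lemma scl_simps [simp]:
  "scl k [] = []" "scl k ((c, u, v) # xs) = (k * c, u, v) # scl k xs"
  by (auto simp: scl_def)

lemma scl_props [simp]:
  "evl (scl k xs) p = k * evl xs p" "good (scl k xs) = good xs" "wt (scl k xs) = k * wt xs"
  "ar (scl k xs) = k * ar xs" "coefs (scl k xs) = (*) k ` coefs xs"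
  by (induction xs) (auto simp: distrib_left mult.assoc)

lemma evl_integral: "good xs \<Longrightarrow> ((\<lambda>x. evl xs (x, False)) has_integral ar xs) {0..1}"
proof (induction xs)
  case (Cons y xs)
  obtain c u v where y: "y = (c, u, v)" by (cases y) auto
  have "((\<lambda>x. c * bx u v (x, False) + evl xs (x, False)) has_integral (c * (v - u) + ar xs)) {0..1}"
    by (intro has_integral_add has_integral_mult_right bx_integral Cons.IH) (use Cons.prems y in auto)
  then show ?case by (simp add: y)
qed simp

lemma evl_locally_constant:
  assumes "good xs" "p \<in> X"
  shows "\<exists>\<delta>>0. \<forall>q\<in>nb p \<delta>. evl xs q = evl xs p"
  using assms(1)
proof (induction xs)
  case Nil
  show ?case by (intro exI[of _ 1]) simp
next
  case (Cons y xs)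
  obtain c u v where y: "y = (c, u, v)" by (cases y) auto
  obtain d where d: "d > 0" "\<forall>q\<in>nb p d. evl xs q = evl xs p" using Cons y by auto
  obtain e where e: "e > 0" "\<forall>q\<in>nb p e. bx u v q = bx u v p"
    using bx_locally_constant[of u v, OF _ assms(2)] Cons.prems y by auto
  show ?case
    using d e nb_mono[of "min d e" d p] nb_mono[of "min d e" e p]
    by (intro exI[of _ "min d e"]) (auto simp: y subset_iff)
qed

section \<open>Integer functions as combinations of order intervals\<close>

lemma CXZ_iff: "f \<in> CXZ \<tau> \<longleftrightarrow> f \<in> extensional X \<and> (\<forall>p\<in>X. \<exists>\<delta>>0. \<forall>q\<in>nb p \<delta>. f q = f p)"
  by (simp add: CXZ_def continuous_map_discrete_iff)

lemma CXZ_I: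
  assumes "f \<in> extensional X" "good xs" "\<And>p. p \<in> X \<Longrightarrow> real_of_int (f p) = evl xs p"
  shows "f \<in> CXZ \<tau>"
  unfolding CXZ_iff
proof (intro conjI ballI assms(1))
  fix p assume p: "p \<in> X"
  obtain d where d: "d > 0" "\<forall>q\<in>nb p d. evl xs q = evl xs p"
    using evl_locally_constant[OF assms(2) p] by blast
  have "f q = f p" if q: "q \<in> nb p d" for q
  proof -
    have "q \<in> X" using q nb_subset_X by blast
    then have "real_of_int (f q) = real_of_int (f p)" using d(2) q assms(3) p by simp
    then show ?thesis by simp
  qed
  then show "\<exists>\<delta>>0. \<forall>q\<in>nb p \<delta>. f q = f p" using d(1) by blast
qed

text \<open>Compactness of \<open>X\<close> in the form of bisection of the unit interval:
  \<open>R c d\<close>, which says that \<open>f\<close> restricted to the order interval is an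
  integral combination, holds for short intervals near any point and is inherited by
  concatenation.\<close>

lemma CXZ_rep:
  assumes f: "f \<in> CXZ \<tau>"
  obtains xs where "good xs" "coefs xs \<subseteq> \<int>" "\<And>p. p \<in> X \<Longrightarrow> real_of_int (f p) = evl xs p"
proof -
  define R where "R c d \<longleftrightarrow> (\<exists>xs. good xs \<and> coefs xs \<subseteq> \<int> \<and> (\<forall>p\<in>X. evl xs p = real_of_int (f p) * bx c d p))" for c d
  have lc: "\<exists>\<delta>>0. \<forall>q\<in>nb p \<delta>. f q = f p" if "p \<in> X" for p using f that by (simp add: CXZ_iff)
  have join: "R c d" if ce: "seg c e" and ed: "seg e d" and R: "R c e" "R e d" for c e d
  proof -
    obtain xs ys where "good xs" "coefs xs \<subseteq> \<int>" "\<forall>p\<in>X. evl xs p = real_of_int (f p) * bx c e p"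
      "good ys" "coefs ys \<subseteq> \<int>" "\<forall>p\<in>X. evl ys p = real_of_int (f p) * bx e d p"
      using R unfolding R_def by blast
    then show ?thesis unfolding R_def
      by (intro exI[of _ "xs @ ys"]) (simp add: bx_split[OF ce ed] distrib_left)
  qed
  have const: "R c d" if cd: "seg c d" and k: "\<And>p. p \<in> ibox c d \<Longrightarrow> f p = k" for c d k
    unfolding R_def using cd k
    by (intro exI[of _ "[(real_of_int k, c, d)]"]) (auto simp: bx_def)
  have loc: "\<exists>\<delta>>0. \<forall>c d. seg c d \<and> x - \<delta> < c \<and> d < x + \<delta> \<longrightarrow> R c d" if x: "0 \<le> x" "x \<le> 1" for x
  proof -
    have XF: "(x, False) \<in> X" using x by (simp add: X_iff)
    obtain d1 where d1: "d1 > 0" "\<forall>q\<in>nb (x, False) d1. f q = f (x, False)" using lc[OF XF] by blast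
    \<comment> \<open>The point over \<open>x\<close> that is approached from the right when
      \<open>x < 1\<close>: \<open>x\<^sup>+\<close> if \<open>x\<close> is doubled, otherwise
      \<open>x\<close> itself.\<close>
    define r where "r = (x, x \<in> I1 \<tau> \<and> 0 < x \<and> x < 1)"
    have rX: "r \<in> X" using x by (simp add: r_def X_iff)
    obtain d2 where d2: "d2 > 0" "\<forall>q\<in>nb r d2. f q = f r" using lc[OF rX] by blast
    define \<delta> where "\<delta> = min d1 d2"
    have \<delta>: "nb (x, False) \<delta> \<subseteq> nb (x, False) d1" "nb r \<delta> \<subseteq> nb r d2" using nb_mono by (auto simp: \<delta>_def)
    have left: "R c d" if cd: "seg c d" "x - \<delta> < c" "d \<le> x" for c d
    proof (rule const[OF cd(1)])
      fix q assume q: "q \<in> ibox c d"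
      have "q \<in> nb (x, False) \<delta>" using q cd seg_01[OF cd(1)]
        by (auto simp: ibox_def nb_def appL_def)
      then show "f q = f (x, False)" using d1 \<delta> by blast
    qed
    have right: "R c d" if cd: "seg c d" "x \<le> c" "d < x + \<delta>" for c d
    proof (rule const[OF cd(1)])
      fix q assume q: "q \<in> ibox c d"
      have "appR r" using cd seg_01[OF cd(1)] x by (auto simp: r_def appR_def)
      moreover have "r = (c, c \<noteq> 0)" if "c = x" using that cd seg_01[OF cd(1)] by (auto simp: r_def seg_def)
      moreover have "fst r = x" by (simp add: r_def)
      ultimately have "q \<in> nb r \<delta>" using q cd seg_01[OF cd(1)] left_end_X[OF cd(1)]
        by (auto simp: ibox_def nb_def)
      then show "f q = f r" using d2 \<delta> by blast
    qed
    have "R c d" if cd: "seg c d" "x - \<delta> < c" "d < x + \<delta>" for c d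
    proof -
      consider "d \<le> x" | "x \<le> c" | "c < x" "x < d" "x \<in> I1 \<tau>" | "c < x" "x < d" "x \<notin> I1 \<tau>" by linarith
      then show ?thesis
      proof cases
        case 3
        then have "seg c x" "seg x d" using cd by (auto simp: seg_def)
        then show ?thesis using join left right cd by auto
      next
        \<comment> \<open>No cut at \<open>x\<close> is possible, but none is needed: an undoubled
          point is approached from both sides, so \<open>f\<close> is constant across it.\<close>
        case 4
        show ?thesis
        proof (rule const[OF cd(1)])
          fix q assume q: "q \<in> ibox c d"
          have "x < 1" using 4 seg_01[OF cd(1)] by simp
          moreover have "q = (x, False)" if "fst q = x" using that 4 q by (cases q) (auto simp: ibox_def X_iff)
          moreover have "q \<in> X" "c \<le> fst q" "fst q \<le> d" using q cd right_end_X left_end_X seg_01[OF cd(1)] by (auto simp: ibox_def)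
          ultimately have "q \<in> nb (x, False) \<delta>" using 4 cd seg_01[OF cd(1)]
            by (cases "fst q < x"; cases "fst q = x") (auto simp: nb_def appL_def appR_def)
          then show "f q = f (x, False)" using d1 \<delta> by blast
        qed
      qed (use left right cd in auto)
    qed
    moreover have "\<delta> > 0" using d1 d2 by (simp add: \<delta>_def)
    ultimately show ?thesis by blast
  qed
  have "\<forall>c d. seg c d \<and> 0 \<le> c \<and> d \<le> 1 \<longrightarrow> R c d"
  proof (rule Bolzano[of 0 1 "\<lambda>u v. \<forall>c d. seg c d \<and> u \<le> c \<and> d \<le> v \<longrightarrow> R c d"])
    fix u y v :: real
    assume Q: "\<forall>c d. seg c d \<and> u \<le> c \<and> d \<le> y \<longrightarrow> R c d" "\<forall>c d. seg c d \<and> y \<le> c \<and> d \<le> v \<longrightarrow> R c d"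
    show "\<forall>c d. seg c d \<and> u \<le> c \<and> d \<le> v \<longrightarrow> R c d"
    proof (intro allI impI)
      fix c d assume cd: "seg c d \<and> u \<le> c \<and> d \<le> v"
      show "R c d"
      proof (cases "d \<le> y \<or> y \<le> c")
        case True then show ?thesis using Q cd by blast
      next
        case False
        then have y: "c < y" "y < d" by auto
        have cd01: "0 \<le> c" "d \<le> 1" using cd seg_01 by auto
        obtain \<delta> where \<delta>: "\<delta> > 0" "\<forall>c d. seg c d \<and> y - \<delta> < c \<and> d < y + \<delta> \<longrightarrow> R c d"
          using loc[of y] y cd01 by auto
        have l: "0 \<le> max c (y - \<delta>)" "max c (y - \<delta>) < y" "y \<le> 1" and r: "0 \<le> y" "y < min d (y + \<delta>)" "min d (y + \<delta>) \<le> 1"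
          using y cd01 \<delta>(1) by auto
        \<comment> \<open>The bisection point \<open>y\<close> need not be in \<open>I1\<close>, so
          it is enclosed between two cut points close enough for the local statement.\<close>
        obtain e where e: "e \<in> I1 \<tau>" "max c (y - \<delta>) < e" "e < y"
          by (rule I1_dense[OF l]) blast
        obtain e' where e': "e' \<in> I1 \<tau>" "y < e'" "e' < min d (y + \<delta>)"
          by (rule I1_dense[OF r]) blast
        have sg: "seg c e" "seg e e'" "seg e' d" "seg c e'" using e e' cd y by (auto simp: seg_def)
        have "R c e" "R e' d" using Q sg e e' cd by auto
        moreover have "R e e'" using \<delta>(2) sg e e' by auto
        ultimately show ?thesis using join sg by blast
      qed
    qed
  next
    fix x :: real assume "0 \<le> x" "x \<le> 1"
    then obtain \<delta> where \<delta>: "\<delta> > 0" "\<forall>c d. seg c d \<and> x - \<delta> < c \<and> d < x + \<delta> \<longrightarrow> R c d" using loc by blast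
    then show "\<exists>d>0. \<forall>u v. u \<le> x \<and> x \<le> v \<and> v - u < d \<longrightarrow> (\<forall>c d. seg c d \<and> u \<le> c \<and> d \<le> v \<longrightarrow> R c d)"
      by (intro exI[of _ \<delta>]) auto
  qed simp
  then have "R 0 1" using zero_I1 one_I1 by (simp add: seg_def)
  then show ?thesis using that bx_0_1 unfolding R_def by auto
qed

lemma real_transfer:
  assumes "p \<in> X"
  shows "real_of_int ((transfer \<tau> ^^ k) f p) = (tr ^^ k) (\<lambda>q. real_of_int (f q)) p"
  using assms
proof (induction k arbitrary: p)
  case (Suc k)
  have "real_of_int (transfer \<tau> ((transfer \<tau> ^^ k) f) p)
      = (\<Sum>q | q \<in> X \<and> local_homeo \<tau> q = p. real_of_int ((transfer \<tau> ^^ k) f q))"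
    using Suc.prems by (simp add: transfer_def)
  also have "\<dots> = (\<Sum>q | q \<in> X \<and> sg q = p. (tr ^^ k) (\<lambda>q. real_of_int (f q)) q)"
    by (rule sum.cong) (auto simp: local_homeo_eq Suc.IH)
  finally show ?case by (simp add: tr_def[of "(tr ^^ k) (\<lambda>q. real_of_int (f q))"])
qed simp

section \<open>Iterates of the transfer operator on order intervals\<close>

text \<open>A single affine branch of \<open>\<tau> ^^ k\<close> from \<open>[u, v]\<close> onto
  \<open>[c, d]\<close>; minimum and maximum absorb the orientation.\<close>

definition branch :: "nat \<Rightarrow> real \<Rightarrow> real \<Rightarrow> real \<Rightarrow> real \<Rightarrow> bool" where
  "branch k u v c d \<longleftrightarrow> {u<..<v} \<inter> brk k = {} \<and>
     min ((\<tau> ^^ k) u) ((\<tau> ^^ k) v) = c \<and> max ((\<tau> ^^ k) u) ((\<tau> ^^ k) v) = d"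

text \<open>The first step is peeled off: a point of \<open>brk k\<close> inside the image of the
  interval would pull back to a point of \<open>brk (Suc k)\<close> inside the interval.\<close>

lemma trk_bx:
  assumes uv: "seg u v" and br: "branch k u v c d"
  shows "seg c d \<and> d - c = s ^ k * (v - u) \<and> (\<forall>p\<in>X. (tr ^^ k) (bx u v) p = bx c d p)"
  using uv br
proof (induction k arbitrary: u v)
  case 0
  then show ?case by (auto simp: seg_def branch_def)
next
  case (Suc k)
  have uv01: "0 \<le> u" "u < v" "v \<le> 1" using seg_01[OF Suc.prems(1)] by auto
  have no: "{u<..<v} \<inter> brk (Suc k) = {}" using Suc.prems(2) by (simp add: branch_def)
  then have "{u<..<v} \<inter> a ` {..n} = {}"
    using uv01 by (force simp: brk_def intro: exI[of _ 0])
  then obtain m b where m: "m = s \<or> m = - s" and aff: "\<And>x. u \<le> x \<Longrightarrow> x \<le> v \<Longrightarrow> \<tau> x = m * x + b"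
    by (rule affine_off_partition[OF uv01]) blast
  have m0: "m \<noteq> 0" using m s_pos by auto
  have tu: "\<tau> u = m * u + b" "\<tau> v = m * v + b" using aff uv01 by auto
  define p where "p = min (\<tau> u) (\<tau> v)"
  define q where "q = max (\<tau> u) (\<tau> v)"
  have pq: "seg p q" "q - p = s * (v - u)" using seg_tau[OF Suc.prems(1) m aff] by (auto simp: p_def q_def)
  have "z \<notin> brk k" if z: "p < z" "z < q" for z
  proof
    assume "z \<in> brk k"
    then obtain j where j: "j < k" "(\<tau> ^^ j) z \<in> a ` {..n}" by (auto simp: brk_def)
    define y where "y = (z - b) / m"
    have y: "u < y" "y < v"
      using affine_preimage_between[OF m0 uv01(2), of b z] z unfolding y_def p_def q_def tu by auto
    have "\<tau> y = z" using aff[of y] y m0 by (simp add: y_def)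
    then have "(\<tau> ^^ Suc j) y \<in> a ` {..n}" using j by (simp add: funpow_Suc_right del: funpow.simps)
    then have "y \<in> brk (Suc k)" using j y uv01 unfolding brk_def by fastforce
    then show False using no y by auto
  qed
  moreover have "min ((\<tau> ^^ k) p) ((\<tau> ^^ k) q) = c" "max ((\<tau> ^^ k) p) ((\<tau> ^^ k) q) = d"
    using Suc.prems(2) unfolding branch_def funpow_Suc_right o_apply p_def q_def
    by (cases "\<tau> u \<le> \<tau> v"; simp add: min.commute max.commute)+
  ultimately have "branch k p q c d" by (auto simp: branch_def)
  note IH = Suc.IH[OF pq(1) this]
  have "(tr ^^ Suc k) (bx u v) r = (tr ^^ k) (bx p q) r" if "r \<in> X" for r
  proof -
    have "(tr ^^ Suc k) (bx u v) r = (tr ^^ k) (tr (bx u v)) r" by (simp add: funpow_swap1)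
    also have "\<dots> = (tr ^^ k) (bx p q) r"
      by (rule trk_cong[OF _ that]) (use tr_bx[OF Suc.prems(1) m aff] in \<open>auto simp: p_def q_def\<close>)
    finally show ?thesis .
  qed
  then show ?case using IH by (simp add: pq(2) mult.assoc del: funpow.simps)
qed

text \<open>Cutting at a break point reduces the number of those left on each side. As all
  coefficients are 1, the weight counts the pieces.\<close>

lemma trk_bx_list:
  assumes uv: "seg u v"
  shows "\<exists>ys. good ys \<and> coefs ys \<subseteq> {1} \<and> wt ys \<le> 1 + card (brk k \<inter> {u<..<v}) \<and> ar ys = s ^ k * (v - u)
     \<and> (\<forall>p\<in>X. (tr ^^ k) (bx u v) p = evl ys p)"
  using uv
proof (induction "card (brk k \<inter> {u<..<v})" arbitrary: u v rule: less_induct)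
  case less
  show ?case
  proof (cases "{u<..<v} \<inter> brk k = {}")
    case True
    then have "branch k u v (min ((\<tau> ^^ k) u) ((\<tau> ^^ k) v)) (max ((\<tau> ^^ k) u) ((\<tau> ^^ k) v))"
      by (simp add: branch_def)
    from trk_bx[OF less.prems this] show ?thesis
      by (intro exI[of _ "[(1, min ((\<tau> ^^ k) u) ((\<tau> ^^ k) v), max ((\<tau> ^^ k) u) ((\<tau> ^^ k) v))]"]) simp
  next
    case False
    then obtain e where e: "e \<in> brk k" "u < e" "e < v" by auto
    have sg: "seg u e" "seg e v" using e less.prems brk_subset_I1 by (auto simp: seg_def)
    have fin: "finite (brk k \<inter> {u<..<v})" using finite_brk by simp
    have un: "brk k \<inter> {u<..<v} = insert e ((brk k \<inter> {u<..<e}) \<union> (brk k \<inter> {e<..<v}))" using e by auto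
    have "card (brk k \<inter> {u<..<v}) = Suc (card ((brk k \<inter> {u<..<e}) \<union> (brk k \<inter> {e<..<v})))"
      unfolding un using finite_brk by (subst card_insert_disjoint) auto
    also have "card ((brk k \<inter> {u<..<e}) \<union> (brk k \<inter> {e<..<v})) = card (brk k \<inter> {u<..<e}) + card (brk k \<inter> {e<..<v})"
      using finite_brk by (intro card_Un_disjoint) auto
    finally have cd: "card (brk k \<inter> {u<..<v}) = Suc (card (brk k \<inter> {u<..<e}) + card (brk k \<inter> {e<..<v}))" .
    obtain ys where ys: "good ys" "coefs ys \<subseteq> {1}" "wt ys \<le> 1 + card (brk k \<inter> {u<..<e})" "ar ys = s ^ k * (e - u)"
      "\<forall>p\<in>X. (tr ^^ k) (bx u e) p = evl ys p" using less.hyps[OF _ sg(1)] cd by auto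
    obtain zs where zs: "good zs" "coefs zs \<subseteq> {1}" "wt zs \<le> 1 + card (brk k \<inter> {e<..<v})" "ar zs = s ^ k * (v - e)"
      "\<forall>p\<in>X. (tr ^^ k) (bx e v) p = evl zs p" using less.hyps[OF _ sg(2)] cd by auto
    have "(tr ^^ k) (bx u v) p = evl (ys @ zs) p" if p: "p \<in> X" for p
    proof -
      have "(tr ^^ k) (bx u v) p = (tr ^^ k) (\<lambda>p. bx u e p + bx e v p) p"
        by (rule trk_cong[OF _ p]) (rule bx_split[OF sg])
      then show ?thesis using ys(5) zs(5) p by (simp add: trk_add)
    qed
    then show ?thesis using ys zs cd
      by (intro exI[of _ "ys @ zs"]) (simp add: algebra_simps)
  qed
qed

lemma trk_list:
  assumes "good xs"
  shows "\<exists>ys. good ys \<and> (coefs xs \<subseteq> \<int> \<longrightarrow> coefs ys \<subseteq> \<int>) \<and> ar ys = s ^ k * ar xs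
     \<and> (\<forall>p\<in>X. (tr ^^ k) (evl xs) p = evl ys p)"
  using assms
proof (induction xs)
  case Nil
  have "evl [] = (\<lambda>p. 0)" by auto
  then show ?case by (intro exI[of _ "[]"]) (simp add: trk_zero)
next
  case (Cons y xs)
  obtain c u v where y: "y = (c, u, v)" by (cases y) auto
  obtain ys where ys: "good ys" "coefs xs \<subseteq> \<int> \<longrightarrow> coefs ys \<subseteq> \<int>" "ar ys = s ^ k * ar xs"
    "\<forall>p\<in>X. (tr ^^ k) (evl xs) p = evl ys p" using Cons y by auto
  have uv: "seg u v" using Cons y by simp
  obtain zs where zs: "good zs" "coefs zs \<subseteq> {1}" "ar zs = s ^ k * (v - u)" "\<forall>p\<in>X. (tr ^^ k) (bx u v) p = evl zs p"
    using trk_bx_list[OF uv, of k] by blast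
  have "evl (y # xs) = (\<lambda>p. c * bx u v p + evl xs p)" by (auto simp: y)
  then have "\<forall>p\<in>X. (tr ^^ k) (evl (y # xs)) p = evl (scl c zs @ ys) p"
    using ys zs by (simp add: trk_add trk_scale)
  moreover have "coefs (y # xs) \<subseteq> \<int> \<longrightarrow> coefs (scl c zs @ ys) \<subseteq> \<int>" using ys(2) zs(2) by (auto simp: y)
  moreover have "ar (scl c zs @ ys) = s ^ k * ar (y # xs)" by (simp only: y list_simps scl_props ys(3) zs(3)) (simp add: algebra_simps)
  ultimately show ?case using ys(1) zs(1) by (intro exI[of _ "scl c zs @ ys"] conjI) auto
qed

lemma transfer_extensional: "transfer \<tau> f \<in> extensional X"
  by (simp add: transfer_def)

lemma transfer_rep:
  assumes xs: "good xs" "\<And>p. p \<in> X \<Longrightarrow> real_of_int (f p) = evl xs p"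
  obtains ys where "good ys" "ar ys = s * ar xs" "\<And>p. p \<in> X \<Longrightarrow> real_of_int (transfer \<tau> f p) = evl ys p"
proof -
  obtain ys where ys: "good ys" "ar ys = s ^ 1 * ar xs" "\<forall>p\<in>X. (tr ^^ 1) (evl xs) p = evl ys p"
    using trk_list[OF xs(1), of 1] by blast
  have "real_of_int (transfer \<tau> f p) = evl ys p" if p: "p \<in> X" for p
  proof -
    have "real_of_int (transfer \<tau> f p) = (tr ^^ 1) (\<lambda>q. real_of_int (f q)) p"
      using real_transfer[OF p, of 1 f] by simp
    also have "\<dots> = (tr ^^ 1) (evl xs) p" by (rule trk_cong[OF xs(2) p])
    finally show ?thesis using ys(3) p by simp
  qed
  then show ?thesis using that ys(1,2) by simp
qed

text \<open>Lebesgue measure on \<open>X\<close>: the section \<open>(x, False)\<close> misses only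
  the countably many points \<open>x\<^sup>+\<close>.\<close>

definition Int0 :: "(real \<times> bool \<Rightarrow> int) \<Rightarrow> real" where
  "Int0 f = integral {0..1} (\<lambda>x. real_of_int (f (x, False)))"

lemma Int0_eq:
  assumes "good xs" "\<And>p. p \<in> X \<Longrightarrow> real_of_int (f p) = evl xs p"
  shows "Int0 f = ar xs"
proof -
  have "((\<lambda>x. real_of_int (f (x, False))) has_integral ar xs) {0..1}"
    by (rule has_integral_eq[OF _ evl_integral[OF assms(1)]]) (simp add: assms(2) X_iff)
  then show ?thesis unfolding Int0_def by (rule integral_unique)
qed

lemma transfer_CXZ: "f \<in> CXZ \<tau> \<Longrightarrow> transfer \<tau> f \<in> CXZ \<tau>"
  and Int0_transfer: "f \<in> CXZ \<tau> \<Longrightarrow> Int0 (transfer \<tau> f) = s * Int0 f"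
proof -
  assume "f \<in> CXZ \<tau>"
  then obtain xs where xs: "good xs" "\<And>p. p \<in> X \<Longrightarrow> real_of_int (f p) = evl xs p"
    by (rule CXZ_rep) blast
  obtain ys where ys: "good ys" "ar ys = s * ar xs" "\<And>p. p \<in> X \<Longrightarrow> real_of_int (transfer \<tau> f p) = evl ys p"
    by (rule transfer_rep[where f = f, OF xs]) blast+
  show "transfer \<tau> f \<in> CXZ \<tau>" by (rule CXZ_I[OF transfer_extensional ys(1,3)])
  show "Int0 (transfer \<tau> f) = s * Int0 f" using Int0_eq[OF xs] Int0_eq[OF ys(1,3)] ys(2) by simp
qed

subsection \<open>Nonnegative combinations of order intervals\<close>

text \<open>\<open>N\<close> bounds the total weight, which replaces the variation in the Lasota--Yorke inequality;
  \<open>A\<close> is the integral.\<close>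

definition comb :: "(real \<times> bool \<Rightarrow> real) \<Rightarrow> real \<Rightarrow> real \<Rightarrow> bool" where
  "comb p N A \<longleftrightarrow> (\<exists>xs. good xs \<and> coefs xs \<subseteq> {0..} \<and> (\<forall>q\<in>X. evl xs q = p q) \<and> wt xs \<le> N \<and> ar xs = A)"

lemma list_bounds:
  assumes "good xs" "coefs xs \<subseteq> {0..}"
  shows "0 \<le> evl xs q" "evl xs q \<le> wt xs" "0 \<le> ar xs" "0 \<le> wt xs"
proof -
  have "0 \<le> evl xs q \<and> evl xs q \<le> wt xs \<and> 0 \<le> ar xs \<and> 0 \<le> wt xs"
    using assms
  proof (induction xs)
    case (Cons y xs)
    obtain c u v where y: "y = (c, u, v)" by (cases y) auto
    have c: "0 \<le> c" "u < v" using Cons.prems y seg_01[of u v] by auto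
    have "0 \<le> bx u v q" "bx u v q \<le> 1" by (auto simp: bx_def)
    then have "0 \<le> c * bx u v q" "c * bx u v q \<le> c" "0 \<le> c * (v - u)"
      using c by (auto intro: mult_left_le)
    then show ?case using Cons y by auto
  qed simp
  then show "0 \<le> evl xs q" "evl xs q \<le> wt xs" "0 \<le> ar xs" "0 \<le> wt xs" by auto
qed

lemma comb_bounds:
  assumes "comb p N A"
  shows "q \<in> X \<Longrightarrow> 0 \<le> p q" "q \<in> X \<Longrightarrow> p q \<le> N" "0 \<le> A" "0 \<le> N"
proof -
  obtain xs where xs: "good xs" "coefs xs \<subseteq> {0..}" "\<forall>q\<in>X. evl xs q = p q" "wt xs \<le> N" "ar xs = A"
    using assms unfolding comb_def by blast
  show "0 \<le> A" "0 \<le> N" using list_bounds(3,4)[OF xs(1,2)] xs(4,5) by auto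
  show "0 \<le> p q" "p q \<le> N" if "q \<in> X" using list_bounds(1,2)[OF xs(1,2), of q] xs(3,4) that by auto
qed

lemma comb_mono: "comb p N A \<Longrightarrow> N \<le> N' \<Longrightarrow> comb p N' A"
  unfolding comb_def by force

lemma comb_cong: "comb p N A \<Longrightarrow> (\<And>q. q \<in> X \<Longrightarrow> p q = p' q) \<Longrightarrow> comb p' N A"
  unfolding comb_def by force

lemma comb_list: "good xs \<Longrightarrow> coefs xs \<subseteq> {0..} \<Longrightarrow> comb (evl xs) (wt xs) (ar xs)"
  unfolding comb_def by blast

text \<open>The Perron--Frobenius operator of Lebesgue measure, iterated \<open>k\<close> times.\<close>

definition pf :: "nat \<Rightarrow> (real \<times> bool \<Rightarrow> real) \<Rightarrow> real \<times> bool \<Rightarrow> real" where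
  "pf k f = (\<lambda>q. (1 / s ^ k) * (tr ^^ k) f q)"

lemma pf_add: "pf (k + l) f = pf k (pf l f)"
  unfolding pf_def by (simp add: funpow_add trk_scale power_add fun_eq_iff del: times_divide_eq_left)

lemma pf_cong: "(\<And>p. p \<in> X \<Longrightarrow> f p = g p) \<Longrightarrow> p \<in> X \<Longrightarrow> pf k f p = pf k g p"
  unfolding pf_def using trk_cong[of f g p k] by simp

lemma pf_mono: "(\<And>p. p \<in> X \<Longrightarrow> f p \<le> g p) \<Longrightarrow> p \<in> X \<Longrightarrow> pf k f p \<le> pf k g p"
  unfolding pf_def using trk_mono[of f g p k] s_pos by (intro mult_left_mono) auto

lemma pf_diff: "pf k (\<lambda>q. f q - g q) = (\<lambda>q. pf k f q - pf k g q)"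
  unfolding pf_def trk_diff by (simp add: right_diff_distrib)

lemma pf_scale: "pf k (\<lambda>q. c * f q) = (\<lambda>q. c * pf k f q)"
  unfolding pf_def trk_scale by (simp add: mult.left_commute)

text \<open>With at most \<open>1 + B * (v - u)\<close> break points inside, an interval yields at
  most \<open>2 + B * (v - u)\<close> pieces; this is the origin of the factor 2. The constant
  \<open>B\<close> depends on \<open>k\<close> through the break points of
  \<open>\<tau> ^^ k\<close>.\<close>

lemma Lasota_Yorke:
  obtains B where "0 \<le> B" "\<And>p N A. comb p N A \<Longrightarrow> comb (pf k p) (2 * N / s ^ k + B * A) A"
proof -
  obtain B where B: "0 \<le> B" "\<And>u v. u < v \<Longrightarrow> real (card (brk k \<inter> {u<..<v})) \<le> 1 + B * (v - u)"
    using finite_gap_bound[OF finite_brk[of k]] by blast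
  have sk: "1 \<le> s ^ k" using s_gt_1 by simp
  have L: "\<exists>ys. good ys \<and> coefs ys \<subseteq> {0..} \<and> (\<forall>q\<in>X. evl ys q = (tr ^^ k) (evl xs) q)
      \<and> wt ys \<le> 2 * wt xs + B * ar xs \<and> ar ys = s ^ k * ar xs"
    if "good xs" "coefs xs \<subseteq> {0..}" for xs
    using that
  proof (induction xs)
    case Nil
    have "evl [] = (\<lambda>q. 0)" by auto
    then show ?case by (intro exI[of _ "[]"]) (simp add: trk_zero)
  next
    case (Cons y xs)
    obtain c u v where y: "y = (c, u, v)" by (cases y) auto
    have c: "0 \<le> c" "seg u v" using Cons.prems y by auto
    obtain ys where ys: "good ys" "coefs ys \<subseteq> {0..}" "\<forall>q\<in>X. evl ys q = (tr ^^ k) (evl xs) q"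
      "wt ys \<le> 2 * wt xs + B * ar xs" "ar ys = s ^ k * ar xs" using Cons y by auto
    obtain zs where zs: "good zs" "coefs zs \<subseteq> {1}" "wt zs \<le> 1 + card (brk k \<inter> {u<..<v})"
      "ar zs = s ^ k * (v - u)" "\<forall>p\<in>X. (tr ^^ k) (bx u v) p = evl zs p"
      using trk_bx_list[OF c(2), of k] by blast
    have "wt zs \<le> 2 + B * (v - u)" using zs(3) B(2)[of u v] seg_01[OF c(2)] by linarith
    then have w: "c * wt zs \<le> c * (2 + B * (v - u))" using c by (intro mult_left_mono)
    have "evl (y # xs) = (\<lambda>p. c * bx u v p + evl xs p)" by (auto simp: y)
    then have "\<forall>q\<in>X. evl (scl c zs @ ys) q = (tr ^^ k) (evl (y # xs)) q"
      using ys zs by (simp add: trk_add trk_scale)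
    moreover have "coefs (scl c zs @ ys) \<subseteq> {0..}" using ys(2) zs(2) c by auto
    moreover have "ar (scl c zs @ ys) = s ^ k * ar (y # xs)"
      by (simp only: y list_simps scl_props ys(5) zs(4)) (simp add: algebra_simps)
    moreover have "wt (scl c zs @ ys) \<le> 2 * wt (y # xs) + B * ar (y # xs)"
      using w ys(4) by (simp add: y algebra_simps)
    ultimately show ?case using ys(1) zs(1) by (intro exI[of _ "scl c zs @ ys"] conjI) auto
  qed
  show ?thesis
  proof (rule that[OF B(1)])
    fix p N A assume "comb p N A"
    then obtain xs where xs: "good xs" "coefs xs \<subseteq> {0..}" "\<forall>q\<in>X. evl xs q = p q" "wt xs \<le> N" "ar xs = A"
      unfolding comb_def by blast
    obtain ys where ys: "good ys" "coefs ys \<subseteq> {0..}" "\<forall>q\<in>X. evl ys q = (tr ^^ k) (evl xs) q"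
      "wt ys \<le> 2 * wt xs + B * ar xs" "ar ys = s ^ k * ar xs" using L[OF xs(1,2)] by blast
    have A0: "0 \<le> B * A" using list_bounds(3)[OF xs(1,2)] xs(5) B(1) by simp
    have "wt ys / s ^ k \<le> (2 * N + B * A) / s ^ k" using ys(4) xs(4,5) sk by (intro divide_right_mono) auto
    also have "\<dots> = 2 * N / s ^ k + B * A / s ^ k" by (rule add_divide_distrib)
    \<comment> \<open>The factor \<open>1 / s ^ k\<close> in front of the integral is given away;
      only the one in front of \<open>N\<close> matters.\<close>
    also have "B * A / s ^ k \<le> B * A" using A0 sk by (simp add: divide_le_eq mult_left_le_one_le mult_le_cancel_left1)
    finally have "wt (scl (1 / s ^ k) ys) \<le> 2 * N / s ^ k + B * A" by simp
    moreover have "coefs (scl (1 / s ^ k) ys) \<subseteq> {0..}" using ys(2) sk by auto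
    moreover have "ar (scl (1 / s ^ k) ys) = A" using ys(5) xs(5) s_pos by simp
    moreover have "\<forall>q\<in>X. evl (scl (1 / s ^ k) ys) q = pf k p q"
    proof
      fix q assume q: "q \<in> X"
      have "pf k p q = pf k (evl xs) q" by (rule pf_cong[OF _ q]) (use xs(3) in auto)
      moreover have "evl (scl (1 / s ^ k) ys) q = pf k (evl xs) q" using ys(3) q by (simp add: pf_def)
      ultimately show "evl (scl (1 / s ^ k) ys) q = pf k p q" by simp
    qed
    ultimately show "comb (pf k p) (2 * N / s ^ k + B * A) A"
      unfolding comb_def using ys(1) by (intro exI[of _ "scl (1 / s ^ k) ys"]) simp
  qed
qed

text \<open>Once \<open>s ^ k > 4\<close>, each application at least halves the weight up to a
  multiple of the integral. That \<open>B\<close> does not depend on \<open>j\<close> is essential: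
  the coupling fixes the length \<open>1 / (8 * B)\<close> first and the time \<open>j * k\<close>
  afterwards.\<close>

lemma uniform_Lasota_Yorke:
  obtains k B where "1 \<le> k" "1 \<le> B"
    "\<And>j p N A. 1 \<le> j \<Longrightarrow> comb p N A \<Longrightarrow> comb (pf (j * k) p) (N / 2 + B * A) A"
proof -
  obtain k where k: "4 < s ^ k" using real_arch_pow[OF s_gt_1] by blast
  then have k1: "1 \<le> k" by (cases k) auto
  obtain B0 where B0: "0 \<le> B0" and LY: "\<And>p N A. comb p N A \<Longrightarrow> comb (pf k p) (2 * N / s ^ k + B0 * A) A"
    by (rule Lasota_Yorke[of k]) blast
  \<comment> \<open>One more application gives \<open>N / 4 + (B / 2 + B0) * A\<close>, which is at
    most \<open>N / 2 + B * A\<close> as soon as \<open>2 * B0 \<le> B\<close>.\<close>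
  define B where "B = max 1 (2 * B0)"
  have B: "1 \<le> B" "2 * B0 \<le> B" by (auto simp: B_def)
  have one: "comb (pf k p) (N / 2 + B0 * A) A" if c: "comb p N A" for p N A
  proof (rule comb_mono[OF LY[OF c]])
    have "0 \<le> N" using comb_bounds(4)[OF c] .
    then have "2 * N / s ^ k \<le> 2 * N / 4" using k by (intro divide_left_mono) auto
    then show "2 * N / s ^ k + B0 * A \<le> N / 2 + B0 * A" by simp
  qed
  have "comb (pf (j * k) p) (N / 2 + B * A) A" if "1 \<le> j" "comb p N A" for j p N A
    using that
  proof (induction j rule: nat_induct_at_least)
    case base
    have "B0 * A \<le> B * A" using B B0 comb_bounds(3)[OF base] by (intro mult_right_mono) auto
    then show ?case using comb_mono[OF one[OF base]] by simp
  next
    case (Suc j)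
    have c: "comb (pf (j * k) p) (N / 2 + B * A) A" using Suc by simp
    have AN: "0 \<le> A" "0 \<le> N" using comb_bounds(3,4)[OF Suc.prems] .
    have "(2 * B0) * A \<le> B * A" using B AN by (intro mult_right_mono) auto
    then have "B0 * A \<le> B * A / 2" by simp
    then have "(N / 2 + B * A) / 2 + B0 * A \<le> N / 2 + B * A" using AN by (simp add: add_divide_distrib)
    then show ?case using comb_mono[OF one[OF c]] pf_add[of k "j * k" p] by simp
  qed
  then show ?thesis using that[OF k1 B(1)] by blast
qed

section \<open>Common branches and the coupling step\<close>

lemma common_branch_shrink:
  fixes r :: nat and l h :: "nat \<Rightarrow> real"
  assumes "\<forall>i<r. {1/4..3/4} \<subseteq> (\<tau> ^^ m) ` {l i<..<h i}"
    and "\<forall>i<r. 0 \<le> l i \<and> l i < h i \<and> h i \<le> 1"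
  shows "\<exists>g g'. 1/4 \<le> g \<and> g < g' \<and> g' \<le> 3/4 \<and> (\<forall>i<r. \<forall>c d. g < c \<and> c < d \<and> d < g' \<longrightarrow>
    (\<exists>e e'. l i < e \<and> e < e' \<and> e' < h i \<and> branch m e e' c d))"
  using assms
proof (induction r)
  case 0
  show ?case by (intro exI[of _ "1/4"] exI[of _ "3/4"]) simp
next
  case (Suc r)
  let ?P = "\<lambda>i c d. \<exists>e e'. l i < e \<and> e < e' \<and> e' < h i \<and> branch m e e' c d"
  have "\<exists>g g'. 1/4 \<le> g \<and> g < g' \<and> g' \<le> 3/4 \<and> (\<forall>i<r. \<forall>c d. g < c \<and> c < d \<and> d < g' \<longrightarrow> ?P i c d)"
    by (rule Suc.IH) (use Suc.prems in auto)
  then obtain g g' where g: "1/4 \<le> g" "g < g'" "g' \<le> 3/4"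
    and G: "\<And>i c d. i < r \<Longrightarrow> g < c \<Longrightarrow> c < d \<Longrightarrow> d < g' \<Longrightarrow> ?P i c d" by blast
  have "finite ((\<tau> ^^ m) ` brk m)" using finite_brk by simp
  moreover have "infinite {g<..<g'}" using g by simp
  ultimately have "\<not> {g<..<g'} \<subseteq> (\<tau> ^^ m) ` brk m" using finite_subset by blast
  then obtain z where z: "z \<in> {g<..<g'}" "z \<notin> (\<tau> ^^ m) ` brk m" by blast
  have "z \<in> (\<tau> ^^ m) ` {l r<..<h r}" using Suc.prems(1)[rule_format, of r] z(1) g by auto
  then obtain y where y: "l r < y" "y < h r" "(\<tau> ^^ m) y = z" by auto
  have lr: "0 \<le> l r" "h r \<le> 1" using Suc.prems(2) by auto
  have yb: "y \<notin> brk m" using y z by blast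
  obtain \<eta>0 where \<eta>0: "\<eta>0 > 0" "\<And>x. x \<in> brk m \<Longrightarrow> \<eta>0 \<le> \<bar>y - x\<bar>"
    using separate_point_closed[OF finite_imp_closed[OF finite_brk] yb] by (auto simp: dist_real_def)
  define \<eta> where "\<eta> = min \<eta>0 (min (y - l r) (h r - y)) / 2"
  have \<eta>: "0 < \<eta>" "\<eta> < \<eta>0" "l r < y - \<eta>" "y + \<eta> < h r"
  proof -
    have "0 < 2 * \<eta>" "2 * \<eta> \<le> \<eta>0" "2 * \<eta> \<le> y - l r" "2 * \<eta> \<le> h r - y"
      using \<eta>0(1) y by (auto simp: \<eta>_def)
    then show "0 < \<eta>" "\<eta> < \<eta>0" "l r < y - \<eta>" "y + \<eta> < h r" by linarith+
  qed
  have no: "{y - \<eta><..<y + \<eta>} \<inter> brk m = {}" using \<eta>0(2) \<eta>(2) by fastforce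
  obtain \<mu> b where \<mu>: "\<mu> = s ^ m \<or> \<mu> = - (s ^ m)"
    and aff: "\<forall>x. y - \<eta> \<le> x \<longrightarrow> x \<le> y + \<eta> \<longrightarrow> (\<tau> ^^ m) x = \<mu> * x + b"
    using iter_affine[of "y - \<eta>" "y + \<eta>" m] \<eta> lr no by auto
  have \<mu>0: "\<mu> \<noteq> 0" "\<bar>\<mu>\<bar> > 0" using \<mu> s_pos by auto
  have zb: "z = \<mu> * y + b" using aff y(3) \<eta>(1) by auto
  define w where "w = \<bar>\<mu>\<bar> * \<eta>"
  have w: "0 < w" using \<mu>0 \<eta> by (simp add: w_def)
  have new: "?P r c d" if cd: "z - w < c" "c < d" "d < z + w" for c d
  proof -
    \<comment> \<open>The inverse of the affine branch through \<open>y\<close>.\<close>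
    define f where "f x = y + (x - z) / \<mu>" for x
    have fr: "\<bar>f x - y\<bar> < \<eta>" if "\<bar>x - z\<bar> < w" for x
      using that \<mu>0 by (simp add: f_def w_def abs_divide field_simps)
    have tf: "(\<tau> ^^ m) (f x) = x" if "\<bar>x - z\<bar> < w" for x
    proof -
      have "(\<tau> ^^ m) (f x) = \<mu> * f x + b" using aff fr[OF that] by (auto simp: abs_less_iff)
      moreover have "\<mu> * f x = \<mu> * y + (x - z)" using \<mu>0 by (simp add: f_def distrib_left)
      ultimately show ?thesis using zb by linarith
    qed
    have cz: "\<bar>c - z\<bar> < w" "\<bar>d - z\<bar> < w" using cd by auto
    have ne: "f c \<noteq> f d" using cd \<mu>0 by (simp add: f_def)
    let ?e = "min (f c) (f d)" and ?e' = "max (f c) (f d)"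
    have r: "y - \<eta> < ?e" "?e' < y + \<eta>" "?e < ?e'"
      using fr[OF cz(1)] fr[OF cz(2)] ne by (auto simp: abs_less_iff min_def max_def)
    moreover have "min ((\<tau> ^^ m) ?e) ((\<tau> ^^ m) ?e') = c" "max ((\<tau> ^^ m) ?e) ((\<tau> ^^ m) ?e') = d"
      using tf[OF cz(1)] tf[OF cz(2)] cd by (auto simp: min_def max_def)
    moreover have "{?e<..<?e'} \<subseteq> {y - \<eta><..<y + \<eta>}" using r by auto
    then have "{?e<..<?e'} \<inter> brk m = {}" using no by blast
    ultimately have "branch m ?e ?e' c d" by (simp add: branch_def)
    then show ?thesis using \<eta>(3,4) r by (intro exI[of _ ?e] exI[of _ ?e'] conjI) auto
  qed
  show ?case
  proof (rule exI, rule exI, intro conjI allI impI)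
    show "1/4 \<le> max g (z - w)" "max g (z - w) < min g' (z + w)" "min g' (z + w) \<le> 3/4"
      using g z(1) w by (auto intro: order_trans[OF _ max.cobounded1] order_trans[OF min.cobounded1]
          simp del: le_divide_eq_numeral1 divide_le_eq_numeral1)
    fix i c d assume "i < Suc r" and cd: "max g (z - w) < c \<and> c < d \<and> d < min g' (z + w)"
    then consider "i < r" | "i = r" by linarith
    then show "?P i c d" using G[of i c d] new[of c d] cd by cases auto
  qed
qed

text \<open>Every interval of length at least \<open>w0\<close> contains a cell of the grid of mesh
  \<open>1 / M\<close>, as \<open>M * w0 > 2\<close>; so it suffices to treat finitely many cells.
  The time is a multiple of \<open>k\<close> to fit the uniform Lasota--Yorke inequality.\<close>

lemma common_branch:
  assumes l: "0 < w0" "w0 < 1" and k: "1 \<le> k"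
  obtains j c d where "1 \<le> j" "seg c d"
    "\<And>u v. seg u v \<Longrightarrow> w0 \<le> v - u \<Longrightarrow> \<exists>e e'. u < e \<and> e' < v \<and> seg e e' \<and> branch (j * k) e e' c d"
proof -
  obtain M :: nat where M: "2 / w0 < M" using reals_Archimedean2 by blast
  have M0: "0 < real M" using M l by (smt (verit) divide_pos_pos)
  have M2: "2 < M * w0" using M l by (simp add: field_simps)
  have lh: "0 \<le> real i / M \<and> real i / M < (real i + 1) / M \<and> (real i + 1) / M \<le> 1" if "i < M" for i
    using that M0 by (auto simp: field_simps)
  have "\<exists>k0. \<forall>k\<ge>k0. {1/4..3/4} \<subseteq> (\<tau> ^^ k) ` {real i / M<..<(real i + 1) / M}" if i: "i < M" for i
  proof -
    have h: "0 \<le> real i / M" "real i / M < (real i + 1) / M" "(real i + 1) / M \<le> 1" using lh[OF i] by auto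
    obtain k0 where "\<And>k. k \<ge> k0 \<Longrightarrow> {1/4..1 - 1/4} \<subseteq> (\<tau> ^^ k) ` {real i / M<..<(real i + 1) / M}"
      by (rule covers[OF h, of "1/4"]) (simp, simp, blast)
    then show ?thesis by (intro exI[of _ k0]) simp
  qed
  then obtain K where K: "\<And>i k. i < M \<Longrightarrow> K i \<le> k \<Longrightarrow> {1/4..3/4} \<subseteq> (\<tau> ^^ k) ` {real i / M<..<(real i + 1) / M}"
    by metis
  \<comment> \<open>The sum dominates every \<open>K i\<close>, and the successor ensures
    \<open>1 \<le> j\<close>.\<close>
  define j where "j = Suc (\<Sum>i<M. K i)"
  let ?m = "j * k"
  have Kj: "K i \<le> ?m" if "i < M" for i
  proof -
    have "K i \<le> (\<Sum>i<M. K i)" using that by (intro member_le_sum) auto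
    also have "\<dots> \<le> j * 1" by (simp add: j_def)
    also have "\<dots> \<le> ?m" using k by (intro mult_le_mono2)
    finally show ?thesis .
  qed
  obtain g g' where g: "1/4 \<le> g" "g < g'" "g' \<le> 3/4" and G: "\<forall>i<M. \<forall>c d. g < c \<and> c < d \<and> d < g' \<longrightarrow>
    (\<exists>e e'. real i / M < e \<and> e < e' \<and> e' < (real i + 1) / M \<and> branch ?m e e' c d)"
    using common_branch_shrink[of M ?m "\<lambda>i. real i / M" "\<lambda>i. (real i + 1) / M"] K Kj lh by blast
  have g01: "0 \<le> g" "g' \<le> 1" using g by auto
  obtain c where c: "c \<in> I1 \<tau>" "g < c" "c < g'"
    by (rule I1_dense[OF g01(1) g(2) g01(2)]) blast
  have c0: "0 \<le> c" using c g by simp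
  obtain d where d: "d \<in> I1 \<tau>" "c < d" "d < g'"
    by (rule I1_dense[OF c0 c(3) g01(2)]) blast
  show ?thesis
  proof (rule that[of j c d])
    show "1 \<le> j" by (simp add: j_def)
    show "seg c d" using c d by (simp add: seg_def)
    fix u v assume uv: "seg u v" "w0 \<le> v - u"
    have uv01: "0 \<le> u" "v \<le> 1" using seg_01[OF uv(1)] by auto
    \<comment> \<open>The first grid cell whose left end is not below \<open>u\<close>.\<close>
    define i where "i = nat \<lceil>u * M\<rceil>"
    have i: "u * M \<le> i" "real i < u * M + 1"
      using uv01 M0 unfolding i_def by (auto simp: of_nat_nat) linarith
    have "M * w0 \<le> M * (v - u)" using uv(2) M0 by (intro mult_left_mono) auto
    then have iv: "real i + 1 < v * M" using i M2 by (simp add: algebra_simps)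
    also have "v * M \<le> M" using uv01 M0 by (simp add: mult_left_le_one_le mult_le_cancel_right1)
    finally have "i < M" by simp
    then obtain e e' where e: "real i / M < e" "e < e'" "e' < (real i + 1) / M" "branch ?m e e' c d"
      using G[rule_format, of i c d] c d by blast
    have "u \<le> real i / M" "(real i + 1) / M \<le> v" using i iv M0 by (auto simp: field_simps)
    then have ue: "u < e" "e' < v" using e by auto
    \<comment> \<open>The ends of the branch lie in \<open>I1\<close> because \<open>c\<close> and
      \<open>d\<close> do and \<open>I1\<close> is backward invariant.\<close>
    have "(\<tau> ^^ ?m) e \<in> {c, d}" "(\<tau> ^^ ?m) e' \<in> {c, d}" using e(4) by (auto simp: branch_def min_def max_def split: if_splits)
    then have "(\<tau> ^^ ?m) e \<in> I1 \<tau>" "(\<tau> ^^ ?m) e' \<in> I1 \<tau>" using c d by auto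
    then have "seg e e'" using I1_iter[of e ?m] I1_iter[of e' ?m] ue e(2) uv01 by (auto simp: seg_def)
    then show "\<exists>e e'. u < e \<and> e' < v \<and> seg e e' \<and> branch ?m e e' c d"
      using ue e by blast
  qed
qed

text \<open>The witness \<open>C\<close> is the sum of the coefficients of the intervals of length
  at least \<open>w0\<close>; the others have integral at most \<open>w0 * wt xs\<close>. From each
  long interval a fraction \<open>t\<close> of its height is removed over the piece that
  \<open>\<tau> ^^ m\<close> maps onto \<open>[c, d]\<close>.\<close>

lemma long_branch_subtract:
  fixes w0 c d :: real and m :: nat
  assumes cd: "seg c d" and w0: "0 \<le> w0"
    and br: "\<And>u v. seg u v \<Longrightarrow> w0 \<le> v - u \<Longrightarrow> \<exists>e e'. u < e \<and> e' < v \<and> seg e e' \<and> branch m e e' c d"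
    and xs: "good xs" "coefs xs \<subseteq> {0..}"
  shows "\<exists>C. 0 \<le> C \<and> ar xs \<le> C + w0 * wt xs \<and> (\<forall>t. 0 \<le> t \<and> t \<le> 1 \<longrightarrow> (\<exists>ys. good ys \<and> coefs ys \<subseteq> {0..} \<and> wt ys = wt xs + t * C \<and>
     ar ys = ar xs - t * C * (d - c) / s ^ m \<and>
     (\<forall>q\<in>X. (tr ^^ m) (evl ys) q = (tr ^^ m) (evl xs) q - t * C * bx c d q)))"
  using xs
proof (induction xs)
  case Nil
  show ?case by (intro exI[of _ 0] conjI allI impI exI[of _ "[]"]) simp_all
next
  case (Cons y xs)
  obtain b u v where y: "y = (b, u, v)" by (cases y) auto
  have b: "0 \<le> b" and uv: "seg u v" and g: "good xs" "coefs xs \<subseteq> {0..}" using Cons.prems y by auto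
  let ?Q = "\<lambda>xs C t ys. good ys \<and> coefs ys \<subseteq> {0..} \<and> wt ys = wt xs + t * C \<and>
     ar ys = ar xs - t * C * (d - c) / s ^ m \<and>
     (\<forall>q\<in>X. (tr ^^ m) (evl ys) q = (tr ^^ m) (evl xs) q - t * C * bx c d q)"
  obtain C where C: "0 \<le> C" "ar xs \<le> C + w0 * wt xs" and ex: "\<And>t. 0 \<le> t \<Longrightarrow> t \<le> 1 \<Longrightarrow> \<exists>ys. ?Q xs C t ys"
    using Cons.IH[OF g] by blast
  have e1: "(tr ^^ m) (evl (y # xs)) = (\<lambda>q. b * (tr ^^ m) (bx u v) q + (tr ^^ m) (evl xs) q)"
  proof -
    have "evl (y # xs) = (\<lambda>q. b * bx u v q + evl xs q)" by (auto simp: y)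
    then show ?thesis by (simp add: trk_add trk_scale)
  qed
  show ?case
  proof (cases "w0 \<le> v - u")
    case False
    then have "b * (v - u) \<le> b * w0" using b by (intro mult_left_mono) auto
    then have "ar (y # xs) \<le> C + w0 * wt (y # xs)" using C(2) by (simp add: y algebra_simps)
    moreover have "\<exists>ys. ?Q (y # xs) C t ys" if t: "0 \<le> t" "t \<le> 1" for t
    proof -
      obtain ys where ys: "good ys" "coefs ys \<subseteq> {0..}" "wt ys = wt xs + t * C" "ar ys = ar xs - t * C * (d - c) / s ^ m"
        "\<forall>q\<in>X. (tr ^^ m) (evl ys) q = (tr ^^ m) (evl xs) q - t * C * bx c d q" using ex[OF t] by blast
      have "evl (y # ys) = (\<lambda>q. b * bx u v q + evl ys q)" by (auto simp: y)
      then have "(tr ^^ m) (evl (y # ys)) = (\<lambda>q. b * (tr ^^ m) (bx u v) q + (tr ^^ m) (evl ys) q)"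
        by (simp add: trk_add trk_scale)
      then have "\<forall>q\<in>X. (tr ^^ m) (evl (y # ys)) q = (tr ^^ m) (evl (y # xs)) q - t * C * bx c d q"
        using ys(5) e1 by simp
      then show ?thesis using ys(1-4) b uv by (intro exI[of _ "y # ys"]) (simp add: y)
    qed
    ultimately show ?thesis using C(1) by (intro exI[of _ C]) blast
  next
    case True
    obtain e e' where e: "u < e" "e' < v" "seg e e'" "branch m e e' c d" using br[OF uv True] by blast
    have K: "d - c = s ^ m * (e' - e)" "\<forall>p\<in>X. (tr ^^ m) (bx e e') p = bx c d p"
      using trk_bx[OF e(3,4)] by auto
    have ee: "e' - e = (d - c) / s ^ m" using K(1) s_pos by simp
    have sg: "seg u e" "seg e' v" "seg u e'" using e uv by (auto simp: seg_def)
    have "\<exists>ys. ?Q (y # xs) (b + C) t ys" if t: "0 \<le> t" "t \<le> 1" for t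
    proof -
      obtain ys where ys: "good ys" "coefs ys \<subseteq> {0..}" "wt ys = wt xs + t * C" "ar ys = ar xs - t * C * (d - c) / s ^ m"
        "\<forall>q\<in>X. (tr ^^ m) (evl ys) q = (tr ^^ m) (evl xs) q - t * C * bx c d q" using ex[OF t] by blast
      \<comment> \<open>Height \<open>(1 - t) * b\<close> stays on the whole interval, while height
        \<open>t * b\<close> is kept only on the two sides of the removed piece. This costs
        \<open>t * b\<close> in weight.\<close>
      define zs where "zs = [(b * (1 - t), u, v), (b * t, u, e), (b * t, e', v)]"
      have zs: "good zs" "coefs zs \<subseteq> {0..}" "wt zs = b + t * b" "ar zs = b * (v - u) - t * b * (e' - e)"
        using sg uv b t mult_left_le[of t b] by (auto simp: zs_def algebra_simps)
      have ez: "evl zs q = b * bx u v q - (t * b) * bx e e' q" if q: "q \<in> X" for q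
        unfolding zs_def using bx_split[OF sg(1) e(3) q] bx_split[OF sg(3,2) q] by (simp add: algebra_simps)
      have "(tr ^^ m) (evl (zs @ ys)) q = (tr ^^ m) (evl (y # xs)) q - t * (b + C) * bx c d q" if q: "q \<in> X" for q
      proof -
        have "(tr ^^ m) (evl zs) q = (tr ^^ m) (\<lambda>q. b * bx u v q - (t * b) * bx e e' q) q"
          by (rule trk_cong[OF ez q])
        also have "\<dots> = b * (tr ^^ m) (bx u v) q - t * b * bx c d q"
          using K(2) q by (simp add: trk_diff trk_scale)
        finally have "(tr ^^ m) (evl zs) q = b * (tr ^^ m) (bx u v) q - t * b * bx c d q" .
        moreover have "evl (zs @ ys) = (\<lambda>q. evl zs q + evl ys q)" by auto
        ultimately show ?thesis using ys(5) q by (simp add: e1 trk_add algebra_simps)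
      qed
      moreover have "ar (zs @ ys) = ar (y # xs) - t * (b + C) * (d - c) / s ^ m"
        using zs(4) ys(4) unfolding ee by (simp add: y algebra_simps add_divide_distrib diff_divide_distrib)
      moreover have "wt (zs @ ys) = wt (y # xs) + t * (b + C)" using zs(3) ys(3) by (simp add: y algebra_simps)
      ultimately show ?thesis using zs(1,2) ys(1,2) by (intro exI[of _ "zs @ ys"] conjI) auto
    qed
    moreover have "ar (y # xs) \<le> (b + C) + w0 * wt (y # xs)"
    proof -
      have "b * (v - u) \<le> b" using b seg_01[OF uv] by (intro mult_left_le) auto
      moreover have "0 \<le> w0 * b" using b w0 by simp
      ultimately show ?thesis using C(2) by (simp add: y algebra_simps)
    qed
    moreover have "0 \<le> b + C" using b C by simp
    ultimately show ?thesis by (intro exI[of _ "b + C"]) blast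
  qed
qed

text \<open>In the cone \<open>N \<le> 4 * B * A\<close>, intervals shorter than
  \<open>1 / (8 * B)\<close> carry at most half of the integral, so the long ones have total height
  at least \<open>A / 2\<close>. The bound on \<open>\<theta>\<close> limits the cost to
  \<open>A / 8\<close> in weight and in integral, and the halving of the weight leaves enough room
  to return to the cone.\<close>

lemma coupling_step:
  obtains m B c d where "1 \<le> B" "seg c d"
    "\<And>p N A \<theta>. comb p N A \<Longrightarrow> N \<le> 4 * B * A \<Longrightarrow> 0 \<le> \<theta> \<Longrightarrow> \<theta> \<le> A / (8 * s ^ m) \<Longrightarrow>
      comb (\<lambda>q. pf m p q - \<theta> * bx c d q) (4 * B * (A - \<theta> * (d - c))) (A - \<theta> * (d - c))"
proof -
  obtain k B where k: "1 \<le> k" and B: "1 \<le> B"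
    and LY: "\<And>j p N A. 1 \<le> j \<Longrightarrow> comb p N A \<Longrightarrow> comb (pf (j * k) p) (N / 2 + B * A) A"
    by (rule uniform_Lasota_Yorke) blast
  have w0: "0 < 1 / (8 * B)" "1 / (8 * B) < 1" using B by auto
  obtain j c d where j: "1 \<le> j" and cd: "seg c d"
    and br: "\<And>u v. seg u v \<Longrightarrow> 1 / (8 * B) \<le> v - u \<Longrightarrow> \<exists>e e'. u < e \<and> e' < v \<and> seg e e' \<and> branch (j * k) e e' c d"
    by (rule common_branch[OF w0 k]) blast
  define m where "m = j * k"
  have sm: "1 \<le> s ^ m" using s_gt_1 by simp
  have cd1: "0 < d - c" "d - c \<le> 1" using seg_01[OF cd] by auto
  show ?thesis
  proof (rule that[OF B cd])
    fix p N A \<theta> assume p: "comb p N A" and N: "N \<le> 4 * B * A" and \<theta>: "0 \<le> \<theta>" "\<theta> \<le> A / (8 * s ^ m)"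
    obtain xs where xs: "good xs" "coefs xs \<subseteq> {0..}" "\<forall>q\<in>X. evl xs q = p q" "wt xs \<le> N" "ar xs = A"
      using p unfolding comb_def by blast
    have A0: "0 \<le> A" using comb_bounds(3)[OF p] .
    have \<theta>A: "\<theta> * s ^ m \<le> A / 8" using \<theta>(2) sm by (simp add: field_simps)
    have "\<theta> * 1 \<le> \<theta> * s ^ m" using \<theta>(1) sm by (intro mult_left_mono) auto
    then have \<theta>8: "\<theta> \<le> A / 8" using \<theta>A by simp
    have "\<theta> * (d - c) \<le> \<theta>" using \<theta>(1) cd1 by (intro mult_left_le) auto
    then have \<theta>h: "\<theta> * (d - c) \<le> A / 8" using \<theta>8 by simp
    have BA: "A \<le> B * A" using B A0 mult_right_mono[of 1 B A] by simp
    have br': "\<And>u v. seg u v \<Longrightarrow> 1 / (8 * B) \<le> v - u \<Longrightarrow> \<exists>e e'. u < e \<and> e' < v \<and> seg e e' \<and> branch m e e' c d"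
      unfolding m_def by (rule br)
    obtain C where C: "0 \<le> C" "ar xs \<le> C + 1 / (8 * B) * wt xs" and ex: "\<forall>t. 0 \<le> t \<and> t \<le> 1 \<longrightarrow> (\<exists>ys. good ys \<and> coefs ys \<subseteq> {0..} \<and> wt ys = wt xs + t * C \<and>
        ar ys = ar xs - t * C * (d - c) / s ^ m \<and>
        (\<forall>q\<in>X. (tr ^^ m) (evl ys) q = (tr ^^ m) (evl xs) q - t * C * bx c d q))"
      using long_branch_subtract[OF cd less_imp_le[OF w0(1)] br' xs(1,2)] by blast
    have "1 / (8 * B) * wt xs \<le> 1 / (8 * B) * (4 * B * A)" using w0 xs(4) N by (intro mult_left_mono) auto
    also have "\<dots> = A / 2" using B by simp
    finally have CA: "A / 2 \<le> C" using C(2) xs(5) by simp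
    define t where "t = \<theta> * s ^ m / C"
    have t: "t * C = \<theta> * s ^ m"
    proof (cases "C = 0")
      \<comment> \<open>\<open>C = 0\<close> forces \<open>A = 0\<close> and then
        \<open>\<theta> = 0\<close>, so the identity survives division by 0.\<close>
      case True
      then have "A = 0" using CA A0 by simp
      then show ?thesis using True \<theta>(1) \<theta>8 by simp
    qed (simp add: t_def)
    have "0 \<le> t" using \<theta>(1) sm C(1) by (simp add: t_def)
    moreover have "t \<le> 1" using \<theta>A CA C(1) A0 by (simp add: t_def divide_le_eq)
    ultimately obtain ys where ys: "good ys" "coefs ys \<subseteq> {0..}" "wt ys = wt xs + t * C"
        "ar ys = ar xs - t * C * (d - c) / s ^ m"
        "\<forall>q\<in>X. (tr ^^ m) (evl ys) q = (tr ^^ m) (evl xs) q - t * C * bx c d q" using ex by blast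
    have arA: "ar ys = A - \<theta> * (d - c)" using ys(4) t xs(5) s_pos by simp
    have "comb (evl ys) (wt ys) (A - \<theta> * (d - c))" using comb_list[OF ys(1,2)] arA by simp
    \<comment> \<open>The pieces are removed before the iteration, so the weight that this adds is
      halved as well.\<close>
    then have "comb (pf m (evl ys)) (wt ys / 2 + B * (A - \<theta> * (d - c))) (A - \<theta> * (d - c))"
      unfolding m_def by (rule LY[OF j])
    moreover have "wt ys / 2 + B * (A - \<theta> * (d - c)) \<le> 4 * B * (A - \<theta> * (d - c))"
    proof -
      have "wt ys \<le> 4 * B * A + A / 8" using ys(3) t \<theta>A xs(4) N by simp
      moreover have "B * (\<theta> * (d - c)) \<le> B * (A / 8)" using \<theta>h B by (intro mult_left_mono) auto
      moreover have "B * (A - \<theta> * (d - c)) = B * A - B * (\<theta> * (d - c))" by (rule right_diff_distrib)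
      moreover have "4 * B * (A - \<theta> * (d - c)) = 4 * (B * A) - 4 * (B * (\<theta> * (d - c)))" "4 * B * A = 4 * (B * A)"
        "B * (A / 8) = (B * A) / 8" by (simp_all add: right_diff_distrib)
      ultimately show ?thesis using BA A0 by linarith
    qed
    ultimately have "comb (pf m (evl ys)) (4 * B * (A - \<theta> * (d - c))) (A - \<theta> * (d - c))" by (rule comb_mono)
    then show "comb (\<lambda>q. pf m p q - \<theta> * bx c d q) (4 * B * (A - \<theta> * (d - c))) (A - \<theta> * (d - c))"
    proof (rule comb_cong)
      fix q assume q: "q \<in> X"
      have "pf m p q = pf m (evl xs) q" by (rule pf_cong[OF _ q]) (use xs(3) in auto)
      moreover have "pf m (evl ys) q = pf m (evl xs) q - (t * C / s ^ m) * bx c d q"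
        using ys(5) q by (simp add: pf_def diff_divide_distrib)
      ultimately show "pf m (evl ys) q = pf m p q - \<theta> * bx c d q" using t s_pos by simp
    qed
  qed
qed

section \<open>Eventual positivity\<close>

text \<open>Over \<open>I0\<close> the lift \<open>sg\<close> is just \<open>\<tau>\<close>, as no
  value is doubled. The term of one chosen preimage bounds the sum from below.\<close>

lemma trk_sg_ge:
  assumes f: "\<And>q. q \<in> X \<Longrightarrow> 0 \<le> f q" and y: "y \<in> I0 \<tau>"
  shows "f (y, False) \<le> (tr ^^ r) f ((\<tau> ^^ r) y, False) \<and> (\<tau> ^^ r) y \<in> I0 \<tau>"
proof (induction r)
  case (Suc r)
  let ?y = "(\<tau> ^^ r) y"
  have nn: "0 \<le> (tr ^^ r) f q" if "q \<in> X" for q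
    using trk_mono[of "\<lambda>q. 0" f q r] f that by (simp add: trk_zero)
  have yX: "(?y, False) \<in> X" using Suc I0_01[of ?y] by (simp add: X_iff)
  have t0: "\<tau> ?y \<in> I0 \<tau>" using Suc I0_tau by blast
  then have sgy: "sg (?y, False) = (\<tau> ?y, False)" by (simp add: sg_def I0_def)
  have "(tr ^^ r) f (?y, False) \<le> (\<Sum>q | q \<in> X \<and> sg q = (\<tau> ?y, False). (tr ^^ r) f q)"
    by (rule member_le_sum) (use yX sgy nn finite_sg_fibre[of "(\<tau> ?y, False)"] in auto)
  then have "f (y, False) \<le> tr ((tr ^^ r) f) (\<tau> ?y, False)" using Suc by (simp add: tr_def[of "(tr ^^ r) f"])
  then show ?case using t0 by simp
qed (simp add: y)

text \<open>Exactness gives every point of \<open>I0\<close> an \<open>r\<close>-th preimage between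
  \<open>c\<close> and \<open>d\<close>, again in \<open>I0\<close>. This settles the dense set
  \<open>X0\<close>; the rest follows because the iterate is locally constant.\<close>

lemma trk_bx_eventually_ge_1:
  assumes cd: "seg c d"
  shows "\<exists>r. \<forall>q\<in>X. 1 \<le> (tr ^^ r) (bx c d) q"
proof -
  have cd01: "0 \<le> c" "c < d" "d \<le> 1" using seg_01[OF cd] by auto
  obtain r where r: "(\<tau> ^^ r) ` {c<..<d} = {0..1}" using exact[OF cd01] by blast
  have X0: "1 \<le> (tr ^^ r) (bx c d) q" if q: "q \<in> X0 \<tau>" for q
  proof -
    have qi: "fst q \<in> I0 \<tau>" "q = (fst q, False)" using q by (auto simp: X0_def X_iff I0_def prod_eq_iff)
    then have "fst q \<in> (\<tau> ^^ r) ` {c<..<d}" unfolding r by (simp add: I0_def)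
    then obtain y where y: "c < y" "y < d" "(\<tau> ^^ r) y = fst q" by auto
    then have "y \<in> I0 \<tau>" using I1_iter[of y r] qi cd01 by (auto simp: I0_def)
    then have "bx c d (y, False) \<le> (tr ^^ r) (bx c d) ((\<tau> ^^ r) y, False)"
      using trk_sg_ge[of "bx c d" y r] by (auto simp: bx_def)
    moreover have "bx c d (y, False) = 1" using y cd01 by (simp add: bx_def ibox_def X_iff)
    ultimately show ?thesis using y(3) qi(2) by simp
  qed
  obtain ys where ys: "good ys" "\<forall>p\<in>X. (tr ^^ r) (bx c d) p = evl ys p"
    using trk_bx_list[OF cd, of r] by blast
  have "1 \<le> (tr ^^ r) (bx c d) q" if q: "q \<in> X" for q
  proof -
    obtain e where e: "e > 0" "\<forall>z\<in>nb q e. evl ys z = evl ys q" using evl_locally_constant[OF ys(1) q] by blast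
    obtain z where z: "z \<in> nb q e" "z \<in> X0 \<tau>" using nb_meets_X0[OF q e(1)] by blast
    then have "z \<in> X" by (simp add: X0_def)
    then have "(tr ^^ r) (bx c d) q = (tr ^^ r) (bx c d) z" using ys(2) e(2) z(1) q by simp
    then show ?thesis using X0[OF z(2)] by simp
  qed
  then show ?thesis by blast
qed

text \<open>Each round takes the same \<open>\<theta> * bx c d\<close> from both parts: the gap
  \<open>\<alpha>\<close> of the integrals stays, and the smaller integral shrinks by
  \<open>\<rho>\<close>. Once \<open>Q\<close> is uniformly small, \<open>P\<close>, whose integral
  is at least \<open>\<alpha>\<close>, dominates it after a few more steps.\<close>

lemma eventually_positive_comb:
  obtains B where "1 \<le> B"
    "\<And>p q N N' A A'. comb p N A \<Longrightarrow> comb q N' A' \<Longrightarrow> N \<le> 4 * B * A \<Longrightarrow> N' \<le> 4 * B * A' \<Longrightarrow> A' < A \<Longrightarrow>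
      \<exists>k. \<forall>x\<in>X. 0 \<le> (tr ^^ k) (\<lambda>x. p x - q x) x"
proof -
  obtain m B c d where B: "1 \<le> B" and cd: "seg c d"
    and step: "\<And>p N A \<theta>. comb p N A \<Longrightarrow> N \<le> 4 * B * A \<Longrightarrow> 0 \<le> \<theta> \<Longrightarrow> \<theta> \<le> A / (8 * s ^ m) \<Longrightarrow>
      comb (\<lambda>q. pf m p q - \<theta> * bx c d q) (4 * B * (A - \<theta> * (d - c))) (A - \<theta> * (d - c))"
    by (rule coupling_step) blast
  have sm: "1 \<le> s ^ m" using s_gt_1 by simp
  have cd1: "0 < d - c" "d - c \<le> 1" using seg_01[OF cd] by auto
  define \<rho> where "\<rho> = 1 - (d - c) / (8 * s ^ m)"
  have \<rho>: "0 \<le> \<rho>" "\<rho> < 1" using cd1 sm by (auto simp: \<rho>_def divide_le_eq)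
  obtain r where r: "\<And>q. q \<in> X \<Longrightarrow> 1 \<le> (tr ^^ r) (bx c d) q" using trk_bx_eventually_ge_1[OF cd] by blast
  have sr: "1 \<le> s ^ r" using s_gt_1 by simp
  obtain B' where B': "0 \<le> B'" and LY: "\<And>p N A. comb p N A \<Longrightarrow> comb (pf (r + m) p) (2 * N / s ^ (r + m) + B' * A) A"
    by (rule Lasota_Yorke[of "r + m"]) blast
  show ?thesis
  proof (rule that[OF B])
    fix p q N N' A A'
    assume pq: "comb p N A" "comb q N' A'" "N \<le> 4 * B * A" "N' \<le> 4 * B * A'" "A' < A"
    define \<alpha> where "\<alpha> = A - A'"
    have A'0: "0 \<le> A'" using comb_bounds(3)[OF pq(2)] .
    have \<alpha>: "0 < \<alpha>" using pq(5) by (simp add: \<alpha>_def)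
    have it: "\<exists>P Q. (\<forall>x\<in>X. pf (i * m) (\<lambda>x. p x - q x) x = P x - Q x) \<and>
        comb P (4 * B * (\<rho> ^ i * A' + \<alpha>)) (\<rho> ^ i * A' + \<alpha>) \<and> comb Q (4 * B * (\<rho> ^ i * A')) (\<rho> ^ i * A')" for i
    proof (induction i)
      case 0
      have "comb p (4 * B * A) A" "comb q (4 * B * A') A'" using pq comb_mono by auto
      then show ?case by (intro exI[of _ p] exI[of _ q]) (simp add: pf_def \<alpha>_def)
    next
      case (Suc i)
      then obtain P Q where PQ: "\<forall>x\<in>X. pf (i * m) (\<lambda>x. p x - q x) x = P x - Q x"
        "comb P (4 * B * (\<rho> ^ i * A' + \<alpha>)) (\<rho> ^ i * A' + \<alpha>)" "comb Q (4 * B * (\<rho> ^ i * A')) (\<rho> ^ i * A')" by blast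
      define a' where "a' = \<rho> ^ i * A'"
      have a'0: "0 \<le> a'" using \<rho> A'0 by (simp add: a'_def)
      \<comment> \<open>The largest amount that the step permits for the smaller part; the larger
        part permits it too. It produces the factor \<open>\<rho>\<close>.\<close>
      define \<theta> where "\<theta> = a' / (8 * s ^ m)"
      have \<theta>: "0 \<le> \<theta>" "\<theta> \<le> a' / (8 * s ^ m)" "\<theta> \<le> (a' + \<alpha>) / (8 * s ^ m)"
        using a'0 \<alpha> sm by (auto simp: \<theta>_def intro!: divide_right_mono)
      have eq: "a' - \<theta> * (d - c) = \<rho> ^ Suc i * A'" by (simp add: \<theta>_def \<rho>_def a'_def algebra_simps)
      then have eq': "(a' + \<alpha>) - \<theta> * (d - c) = \<rho> ^ Suc i * A' + \<alpha>" by simp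
      let ?P = "\<lambda>x. pf m P x - \<theta> * bx c d x" and ?Q = "\<lambda>x. pf m Q x - \<theta> * bx c d x"
      have "comb ?P (4 * B * (\<rho> ^ Suc i * A' + \<alpha>)) (\<rho> ^ Suc i * A' + \<alpha>)"
        using step[OF PQ(2)[folded a'_def] order_refl \<theta>(1,3)] unfolding eq' .
      moreover have "comb ?Q (4 * B * (\<rho> ^ Suc i * A')) (\<rho> ^ Suc i * A')"
        using step[OF PQ(3)[folded a'_def] order_refl \<theta>(1,2)] unfolding eq .
      moreover have "\<forall>x\<in>X. pf (Suc i * m) (\<lambda>x. p x - q x) x = ?P x - ?Q x"
      proof
        fix x assume x: "x \<in> X"
        have "pf (Suc i * m) (\<lambda>x. p x - q x) x = pf m (pf (i * m) (\<lambda>x. p x - q x)) x"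
          by (simp add: pf_add)
        also have "\<dots> = pf m (\<lambda>x. P x - Q x) x" by (rule pf_cong[OF _ x]) (use PQ(1) in auto)
        finally show "pf (Suc i * m) (\<lambda>x. p x - q x) x = ?P x - ?Q x" by (simp add: pf_diff)
      qed
      ultimately show ?case by - (rule exI[of _ ?P], rule exI[of _ ?Q], intro conjI)
    qed
    \<comment> \<open>The height guaranteed for the \<open>P\<close>-part everywhere:
      \<open>\<alpha> / (8 * s ^ m)\<close> over \<open>ibox c d\<close> after \<open>m\<close>
      steps, spread over \<open>X\<close> in \<open>r\<close> more steps at the price of
      \<open>1 / s ^ r\<close>.\<close>
    define \<beta> where "\<beta> = \<alpha> / (8 * s ^ m) / s ^ r"
    have \<beta>: "0 < \<beta>" using \<alpha> s_pos by (simp add: \<beta>_def)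
    have "(\<lambda>i. (8 * B + B') * (\<rho> ^ i * A')) \<longlonglongrightarrow> (8 * B + B') * (0 * A')"
      by (intro tendsto_intros LIMSEQ_realpow_zero \<rho>)
    then have "(\<lambda>i. (8 * B + B') * (\<rho> ^ i * A')) \<longlonglongrightarrow> 0" by simp
    then have "\<forall>\<^sub>F i in sequentially. (8 * B + B') * (\<rho> ^ i * A') < \<beta>" using \<beta> by (rule order_tendstoD)
    then obtain i where i: "(8 * B + B') * (\<rho> ^ i * A') < \<beta>" by (auto simp: eventually_sequentially)
    obtain P Q where PQ: "\<forall>x\<in>X. pf (i * m) (\<lambda>x. p x - q x) x = P x - Q x"
        "comb P (4 * B * (\<rho> ^ i * A' + \<alpha>)) (\<rho> ^ i * A' + \<alpha>)" "comb Q (4 * B * (\<rho> ^ i * A')) (\<rho> ^ i * A')"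
      using it[of i] by blast
    define a' where "a' = \<rho> ^ i * A'"
    have a'0: "0 \<le> a'" using \<rho> A'0 by (simp add: a'_def)
    let ?\<theta> = "\<alpha> / (8 * s ^ m)"
    have "0 \<le> ?\<theta>" "?\<theta> \<le> (a' + \<alpha>) / (8 * s ^ m)" using a'0 \<alpha> sm by (auto intro!: divide_right_mono)
    \<comment> \<open>Here the step is used only for the nonnegativity of the remainder:
      \<open>pf m P\<close> is at least the subtracted multiple of \<open>bx c d\<close>.\<close>
    note cP = step[OF PQ(2)[folded a'_def] order_refl this]
    have low: "\<beta> \<le> pf (r + m) P x" if x: "x \<in> X" for x
    proof -
      have "\<beta> \<le> ?\<theta> * pf r (bx c d) x"
      proof -
        have "1 / s ^ r \<le> pf r (bx c d) x" using r[OF x] sr by (simp add: pf_def divide_right_mono)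
        then have "?\<theta> * (1 / s ^ r) \<le> ?\<theta> * pf r (bx c d) x" using \<open>0 \<le> ?\<theta>\<close> by (rule mult_left_mono)
        then show ?thesis by (simp add: \<beta>_def)
      qed
      also have "\<dots> = pf r (\<lambda>x. ?\<theta> * bx c d x) x" by (simp only: pf_scale)
      also have "\<dots> \<le> pf r (pf m P) x"
        by (rule pf_mono[OF _ x]) (use comb_bounds(1)[OF cP] in auto)
      finally show ?thesis by (simp add: pf_add)
    qed
    have upp: "pf (r + m) Q x \<le> \<beta>" if x: "x \<in> X" for x
    proof -
      have "pf (r + m) Q x \<le> 2 * (4 * B * a') / s ^ (r + m) + B' * a'"
        by (rule comb_bounds(2)[OF LY[OF PQ(3)[folded a'_def]] x])
      also have "2 * (4 * B * a') / s ^ (r + m) \<le> 2 * (4 * B * a')"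
        using B a'0 one_le_power[of s "r + m"] s_gt_1 divide_left_mono[of 1 "s ^ (r + m)" "2 * (4 * B * a')"] by simp
      finally have "pf (r + m) Q x \<le> (8 * B + B') * a'" by (simp add: algebra_simps)
      then show ?thesis using i by (simp add: a'_def)
    qed
    have "0 \<le> (tr ^^ (r + m + i * m)) (\<lambda>x. p x - q x) x" if x: "x \<in> X" for x
    proof -
      have "pf (r + m + i * m) (\<lambda>x. p x - q x) x = pf (r + m) (pf (i * m) (\<lambda>x. p x - q x)) x"
        by (simp only: pf_add)
      also have "\<dots> = pf (r + m) (\<lambda>x. P x - Q x) x" by (rule pf_cong[OF _ x]) (use PQ(1) in auto)
      also have "\<dots> = pf (r + m) P x - pf (r + m) Q x" by (simp add: pf_diff)
      finally have "0 \<le> pf (r + m + i * m) (\<lambda>x. p x - q x) x" using low[OF x] upp[OF x] by simp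
      moreover have "(tr ^^ (r + m + i * m)) (\<lambda>x. p x - q x) x = s ^ (r + m + i * m) * pf (r + m + i * m) (\<lambda>x. p x - q x) x"
        using s_pos by (simp add: pf_def)
      moreover have "0 \<le> s ^ (r + m + i * m)" using s_pos by (intro zero_le_power) simp
      ultimately show ?thesis by (simp only: mult_nonneg_nonneg)
    qed
    then show "\<exists>k. \<forall>x\<in>X. 0 \<le> (tr ^^ k) (\<lambda>x. p x - q x) x" by blast
  qed
qed

lemma list_pos_neg:
  assumes "good xs"
  shows "\<exists>ys zs. good ys \<and> coefs ys \<subseteq> {0..} \<and> good zs \<and> coefs zs \<subseteq> {0..} \<and> ar xs = ar ys - ar zs \<and>
    (\<forall>p. evl xs p = evl ys p - evl zs p)"
  using assms
proof (induction xs)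
  case (Cons y xs)
  obtain c u v where y: "y = (c, u, v)" by (cases y) auto
  obtain ys zs where *: "good ys" "coefs ys \<subseteq> {0..}" "good zs" "coefs zs \<subseteq> {0..}" "ar xs = ar ys - ar zs"
    "\<forall>p. evl xs p = evl ys p - evl zs p" using Cons y by auto
  show ?case
  proof (cases "0 \<le> c")
    case True
    then show ?thesis using * Cons.prems by (intro exI[of _ "y # ys"] exI[of _ zs]) (simp add: y)
  next
    case False
    then show ?thesis using * Cons.prems by (intro exI[of _ ys] exI[of _ "(- c, u, v) # zs"]) (simp add: y)
  qed
qed (intro exI[of _ "[]"], simp)

lemma seg_0_1: "seg 0 1"
  using zero_I1 one_I1 by (simp add: seg_def)

lemma eventually_nonneg:
  assumes xs: "good xs" "0 < ar xs"
  shows "\<exists>k. \<forall>q\<in>X. 0 \<le> (tr ^^ k) (evl xs) q"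
proof -
  obtain B where B: "1 \<le> B" and main: "\<And>p q N N' A A'. comb p N A \<Longrightarrow> comb q N' A' \<Longrightarrow> N \<le> 4 * B * A \<Longrightarrow> N' \<le> 4 * B * A' \<Longrightarrow> A' < A \<Longrightarrow>
      \<exists>k. \<forall>x\<in>X. 0 \<le> (tr ^^ k) (\<lambda>x. p x - q x) x"
    by (rule eventually_positive_comb) blast
  obtain ys zs where *: "good ys" "coefs ys \<subseteq> {0..}" "good zs" "coefs zs \<subseteq> {0..}" "ar xs = ar ys - ar zs"
    "\<forall>p. evl xs p = evl ys p - evl zs p" using list_pos_neg[OF xs(1)] by blast
  \<comment> \<open>Adding the constant \<open>K\<close> to both parts does not change their
    difference but raises the integrals enough to bring both into the cone.\<close>
  define K where "K = max (wt ys) (wt zs)"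
  have K0: "0 \<le> K" using list_bounds(4)[OF *(1,2)] by (simp add: K_def)
  let ?ys = "(K, 0, 1) # ys" and ?zs = "(K, 0, 1) # zs"
  have g: "good ?ys" "coefs ?ys \<subseteq> {0..}" "good ?zs" "coefs ?zs \<subseteq> {0..}" using * K0 seg_0_1 by auto
  have cone: "wt ((K, 0, 1) # ws) \<le> 4 * B * ar ((K, 0, 1) # ws)" if "good ws" "coefs ws \<subseteq> {0..}" "wt ws \<le> K" for ws
  proof -
    have "0 \<le> ar ws" using list_bounds(3)[OF that(1,2)] .
    then have "1 * (K + ar ws) \<le> B * (K + ar ws)" using B K0 by (intro mult_right_mono) auto
    then have "4 * K \<le> 4 * B * (K + ar ws)" using \<open>0 \<le> ar ws\<close> by (simp add: mult.assoc)
    then show ?thesis using that(3) K0 by simp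
  qed
  have "wt ?ys \<le> 4 * B * ar ?ys" "wt ?zs \<le> 4 * B * ar ?zs" using cone[of ys] cone[of zs] * by (auto simp: K_def)
  moreover have "ar ?zs < ar ?ys" using *(5) xs(2) by simp
  ultimately have "\<exists>k. \<forall>x\<in>X. 0 \<le> (tr ^^ k) (\<lambda>x. evl ?ys x - evl ?zs x) x"
    by (rule main[OF comb_list[OF g(1,2)] comb_list[OF g(3,4)]])
  moreover have "(\<lambda>x. evl ?ys x - evl ?zs x) = evl xs" using *(6) by auto
  ultimately show ?thesis by simp
qed

subsection \<open>The range of the integral\<close>

lemma Z_adjoin_inv_ring:
  fixes r :: real
  shows "1 \<in> Z_adjoin_inv r" "r \<in> Z_adjoin_inv r" "inverse r \<in> Z_adjoin_inv r"
    "x \<in> Z_adjoin_inv r \<Longrightarrow> y \<in> Z_adjoin_inv r \<Longrightarrow> x - y \<in> Z_adjoin_inv r"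
    "x \<in> Z_adjoin_inv r \<Longrightarrow> y \<in> Z_adjoin_inv r \<Longrightarrow> x * y \<in> Z_adjoin_inv r"
proof -
  define F where "F = {R. (1 \<in> R \<and> (\<forall>x\<in>R. \<forall>y\<in>R. x - y \<in> R \<and> x * y \<in> R)) \<and> {r, inverse r} \<subseteq> R}"
  have Z: "Z_adjoin_inv r = \<Inter>F" unfolding Z_adjoin_inv_def hull_def F_def ..
  have F: "1 \<in> R \<and> r \<in> R \<and> inverse r \<in> R \<and> (\<forall>x\<in>R. \<forall>y\<in>R. x - y \<in> R \<and> x * y \<in> R)" if "R \<in> F" for R
    using that unfolding F_def by simp
  show "1 \<in> Z_adjoin_inv r" "r \<in> Z_adjoin_inv r" "inverse r \<in> Z_adjoin_inv r" unfolding Z using F by blast+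
  assume xy: "x \<in> Z_adjoin_inv r" "y \<in> Z_adjoin_inv r"
  have "x - y \<in> R \<and> x * y \<in> R" if "R \<in> F" for R
    using F[OF that] InterD[OF xy(1)[unfolded Z] that] InterD[OF xy(2)[unfolded Z] that] by simp
  then show "x - y \<in> Z_adjoin_inv r" "x * y \<in> Z_adjoin_inv r" unfolding Z by simp_all
qed

lemma Z_adjoin_inv_0: "0 \<in> Z_adjoin_inv r"
  using Z_adjoin_inv_ring(4)[OF Z_adjoin_inv_ring(1,1)[of r]] by simp

lemma Z_adjoin_inv_add: "x \<in> Z_adjoin_inv r \<Longrightarrow> y \<in> Z_adjoin_inv r \<Longrightarrow> x + y \<in> Z_adjoin_inv r"
  using Z_adjoin_inv_ring(4)[of x r "0 - y"] Z_adjoin_inv_ring(4)[OF Z_adjoin_inv_0, of y] by simp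

lemma Z_adjoin_inv_Ints: "z \<in> \<int> \<Longrightarrow> z \<in> Z_adjoin_inv r"
proof -
  have nat: "real k \<in> Z_adjoin_inv r" for k
    by (induction k) (auto intro: Z_adjoin_inv_0 Z_adjoin_inv_add Z_adjoin_inv_ring(1))
  assume "z \<in> \<int>"
  then obtain i where i: "z = of_int i" by (auto elim: Ints_cases)
  show ?thesis
  proof (cases "0 \<le> i")
    case True
    then show ?thesis using nat[of "nat i"] i by simp
  next
    case False
    then have "z = 0 - real (nat (- i))" using i by simp
    then show ?thesis using Z_adjoin_inv_ring(4)[OF Z_adjoin_inv_0 nat] by metis
  qed
qed

lemma Z_adjoin_inv_least:
  assumes "1 \<in> R" "r \<in> R" "inverse r \<in> R" "\<And>x y. x \<in> R \<Longrightarrow> y \<in> R \<Longrightarrow> x - y \<in> R"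
    "\<And>x y. x \<in> R \<Longrightarrow> y \<in> R \<Longrightarrow> x * y \<in> R"
  shows "Z_adjoin_inv r \<subseteq> R"
  unfolding Z_adjoin_inv_def by (rule hull_minimal) (use assms in auto)

section \<open>The interval module\<close>

abbreviation J :: "real set" where "J \<equiv> interval_module s n a"

lemma J_diff: "x \<in> J \<Longrightarrow> y \<in> J \<Longrightarrow> x - y \<in> J"
proof -
  assume "x \<in> J" "y \<in> J"
  then obtain c d where c: "x = (\<Sum>i = 1..n. c i * (a i - a (i - 1)))" "\<forall>i\<in>{1..n}. c i \<in> Z_adjoin_inv s"
    and d: "y = (\<Sum>i = 1..n. d i * (a i - a (i - 1)))" "\<forall>i\<in>{1..n}. d i \<in> Z_adjoin_inv s"
    unfolding interval_module_def by blast
  have "x - y = (\<Sum>i = 1..n. (c i - d i) * (a i - a (i - 1)))"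
    unfolding c(1) d(1) by (simp only: left_diff_distrib sum_subtractf)
  moreover have "\<forall>i\<in>{1..n}. c i - d i \<in> Z_adjoin_inv s" using c(2) d(2) Z_adjoin_inv_ring(4) by blast
  ultimately show "x - y \<in> J" unfolding interval_module_def by (auto intro!: exI[of _ "\<lambda>i. c i - d i"])
qed

lemma J_mult: "r \<in> Z_adjoin_inv s \<Longrightarrow> x \<in> J \<Longrightarrow> r * x \<in> J"
proof -
  assume r: "r \<in> Z_adjoin_inv s" and "x \<in> J"
  then obtain c where c: "x = (\<Sum>i = 1..n. c i * (a i - a (i - 1)))" "\<forall>i\<in>{1..n}. c i \<in> Z_adjoin_inv s"
    unfolding interval_module_def by blast
  have "r * x = (\<Sum>i = 1..n. (r * c i) * (a i - a (i - 1)))"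
    unfolding c(1) by (simp only: sum_distrib_left mult.assoc)
  moreover have "\<forall>i\<in>{1..n}. r * c i \<in> Z_adjoin_inv s" using c(2) r Z_adjoin_inv_ring(5) by blast
  ultimately show "r * x \<in> J" unfolding interval_module_def by (auto intro!: exI[of _ "\<lambda>i. r * c i"])
qed

lemma J_0: "0 \<in> J"
  unfolding interval_module_def using Z_adjoin_inv_0 by (auto intro!: exI[of _ "\<lambda>i. 0"])

lemma J_add: "x \<in> J \<Longrightarrow> y \<in> J \<Longrightarrow> x + y \<in> J"
  using J_diff[of x "0 - y"] J_diff[OF J_0, of y] by simp

lemma J_gen: "1 \<le> i \<Longrightarrow> i \<le> n \<Longrightarrow> a i - a (i - 1) \<in> J"
proof -
  assume i: "1 \<le> i" "i \<le> n"
  have "(\<Sum>j = 1..n. (if j = i then 1 else 0) * (a j - a (j - 1))) = (\<Sum>j = 1..n. if j = i then a j - a (j - 1) else 0)"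
    by (intro sum.cong) auto
  also have "\<dots> = a i - a (i - 1)" using i by (simp add: sum.delta)
  finally show ?thesis unfolding interval_module_def
    using Z_adjoin_inv_0 Z_adjoin_inv_ring(1) by (auto intro!: exI[of _ "\<lambda>j. if j = i then 1 else 0"])
qed

lemma J_partition: "i \<le> n \<Longrightarrow> a i \<in> J"
proof (induction i)
  case (Suc i)
  then show ?case using J_add[OF _ J_gen[of "Suc i"], of "a i"] by simp
qed (simp add: a_0 J_0)

lemma J_slope: "m = s \<or> m = - s \<Longrightarrow> x \<in> J \<Longrightarrow> m * x \<in> J"
  using J_mult[OF Z_adjoin_inv_ring(2), of x] J_diff[OF J_0, of "s * x"] by auto

lemma J_slope_cancel: "m = s \<or> m = - s \<Longrightarrow> m * x \<in> J \<Longrightarrow> x \<in> J"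
proof -
  assume m: "m = s \<or> m = - s" and x: "m * x \<in> J"
  have "inverse s * (m * x) = x \<or> inverse s * (m * x) = - x" using m s_pos by auto
  moreover have j: "inverse s * (m * x) \<in> J" using J_mult[OF Z_adjoin_inv_ring(3) x] .
  ultimately consider "x \<in> J" | "- x \<in> J" by metis
  then show ?thesis by cases (use J_diff[OF J_0, of "- x"] in auto)
qed

text \<open>The minimum of \<open>\<tau>\<close> cannot lie strictly inside a lap, where the slope
  is not 0.\<close>

lemma partition_point_to_0:
  obtains j where "j \<le> n" "\<tau> (a j) = 0"
proof -
  have "0 \<in> \<tau> ` {0..1}" unfolding tau_surj by simp
  then obtain x where x: "0 \<le> x" "x \<le> 1" "\<tau> x = 0" by auto
  show ?thesis
  proof (cases "x = 1")
    case True
    then show ?thesis using that[of n] a_n x by simp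
  next
    case False
    then have "0 \<le> x" "x < 1" using x by auto
    then obtain i m b where i: "1 \<le> i" "i \<le> n" "a (i - 1) \<le> x" "x < a i" and m: "m = s \<or> m = - s"
      and b: "\<And>x. a (i - 1) \<le> x \<Longrightarrow> x \<le> a i \<Longrightarrow> \<tau> x = m * x + b"
      by (rule lap_at) blast
    have e: "\<tau> (a i) = m * (a i - x)" "\<tau> (a (i - 1)) = m * (a (i - 1) - x)"
      using b[of x] b[of "a i"] b[of "a (i - 1)"] i x(3) by (auto simp: right_diff_distrib)
    have nn: "0 \<le> \<tau> (a i)" "0 \<le> \<tau> (a (i - 1))"
      using tau_01[of "a i"] tau_01[of "a (i - 1)"] a_01[of i] a_01[of "i - 1"] i by auto
    have "0 < m" using nn(1) e(1) i m s_pos by (auto simp: zero_le_mult_iff)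
    then have "a (i - 1) = x" using nn(2) e(2) i by (simp add: zero_le_mult_iff)
    then show ?thesis using that[of "i - 1"] i x by simp
  qed
qed

text \<open>Differences of values at partition points are sums of slopes times lap lengths; the
  partition point with value 0 turns differences into values. The set \<open>N\<close> is general
  because the result serves both the interval module and \<open>s\<close> times the range of the
  integral.\<close>

lemma module_contains_tau_partition:
  assumes N: "0 \<in> N" "\<And>x y. x \<in> N \<Longrightarrow> y \<in> N \<Longrightarrow> x - y \<in> N"
    and gen: "\<And>i m. 1 \<le> i \<Longrightarrow> i \<le> n \<Longrightarrow> m = s \<or> m = - s \<Longrightarrow> m * (a i - a (i - 1)) \<in> N"
    and i: "i \<le> n"
  shows "\<tau> (a i) \<in> N"
proof -
  have add: "x + y \<in> N" if "x \<in> N" "y \<in> N" for x y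
    using N(2)[OF that(1) N(2)[OF N(1) that(2)]] by simp
  have d: "\<tau> (a i) - \<tau> (a 0) \<in> N" if "i \<le> n" for i
    using that
  proof (induction i)
    case (Suc i)
    obtain m b where m: "m = s \<or> m = - s" and b: "\<And>x. a (Suc i - 1) \<le> x \<Longrightarrow> x \<le> a (Suc i) \<Longrightarrow> \<tau> x = m * x + b"
      by (rule lap_affine[of "Suc i"]) (use Suc.prems in auto)
    have le: "a i \<le> a (Suc i)" using a_less[of i] Suc.prems by simp
    have "\<tau> (a (Suc i)) - \<tau> (a i) = m * (a (Suc i) - a i)"
      using b[of "a i"] b[of "a (Suc i)"] le by (simp add: right_diff_distrib)
    also have "\<dots> \<in> N" using gen[of "Suc i" m] m Suc.prems by simp
    finally show ?case using add[of "\<tau> (a (Suc i)) - \<tau> (a i)" "\<tau> (a i) - \<tau> (a 0)"] Suc by simp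
  qed (simp add: N)
  obtain j where "j \<le> n" "\<tau> (a j) = 0" by (rule partition_point_to_0)
  then have "- \<tau> (a 0) \<in> N" using d[of j] by simp
  then show ?thesis using N(2)[OF d[OF i], of "- \<tau> (a 0)"] by simp
qed

text \<open>On a lap, \<open>\<tau> y - \<tau> (a (i - 1))\<close> is plus or minus \<open>s\<close>
  times \<open>y - a (i - 1)\<close>, and \<open>s\<close> is a unit of the ring. Hence membership
  in \<open>J\<close> passes in both directions.\<close>

lemma I1_subset_J: "I1 \<tau> \<subseteq> J"
proof -
  have ta: "\<tau> (a i) \<in> J" if "i \<le> n" for i
  proof (rule module_contains_tau_partition[OF J_0 _ _ that])
    show "x - y \<in> J" if "x \<in> J" "y \<in> J" for x y using that by (rule J_diff)
    show "m * (a i - a (i - 1)) \<in> J" if "1 \<le> i" "i \<le> n" "m = s \<or> m = - s" for i m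
      by (rule J_slope[OF that(3) J_gen[OF that(1,2)]])
  qed
  have "I1 \<tau> \<subseteq> J \<inter> {0..1}"
  proof (rule I1_least)
    fix y :: real assume y: "y \<in> {0..1}"
    have "y \<in> J \<longleftrightarrow> \<tau> y \<in> J"
    proof (cases "y = 1")
      case True
      then show ?thesis using ta[of n] J_partition[of n] a_n by simp
    next
      case False
      then have "0 \<le> y" "y < 1" using y by auto
      then obtain i m b where i: "1 \<le> i" "i \<le> n" "a (i - 1) \<le> y" "y < a i" and m: "m = s \<or> m = - s"
        and b: "\<And>x. a (i - 1) \<le> x \<Longrightarrow> x \<le> a i \<Longrightarrow> \<tau> x = m * x + b"
        by (rule lap_at) blast
      have e: "\<tau> y - \<tau> (a (i - 1)) = m * (y - a (i - 1))"
        using b[of y] b[of "a (i - 1)"] i by (simp add: right_diff_distrib)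
      have p: "a (i - 1) \<in> J" "\<tau> (a (i - 1)) \<in> J" using J_partition[of "i - 1"] ta[of "i - 1"] i by auto
      show ?thesis
      proof
        assume "y \<in> J"
        then have "\<tau> y - \<tau> (a (i - 1)) \<in> J" unfolding e using J_slope[OF m J_diff] p by blast
        then show "\<tau> y \<in> J" using J_add[OF _ p(2)] by fastforce
      next
        assume "\<tau> y \<in> J"
        then have "m * (y - a (i - 1)) \<in> J" unfolding e[symmetric] using J_diff p by blast
        then have "y - a (i - 1) \<in> J" by (rule J_slope_cancel[OF m])
        then show "y \<in> J" using J_add[OF _ p(1)] by fastforce
      qed
    qed
    then show "y \<in> J \<inter> {0..1} \<longleftrightarrow> \<tau> y \<in> J \<inter> {0..1}" using y tau_01[OF y] by blast
  qed (use J_partition a_01 in auto)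
  then show ?thesis by blast
qed

section \<open>Additivity and range of the integral\<close>

lemma CXZ_add: "f \<in> CXZ \<tau> \<Longrightarrow> g \<in> CXZ \<tau> \<Longrightarrow> (\<lambda>p\<in>X. f p + g p) \<in> CXZ \<tau>"
  and Int0_add: "f \<in> CXZ \<tau> \<Longrightarrow> g \<in> CXZ \<tau> \<Longrightarrow> Int0 (\<lambda>p\<in>X. f p + g p) = Int0 f + Int0 g"
  and CXZ_uminus: "f \<in> CXZ \<tau> \<Longrightarrow> (\<lambda>p\<in>X. - f p) \<in> CXZ \<tau>"
  and Int0_uminus: "f \<in> CXZ \<tau> \<Longrightarrow> Int0 (\<lambda>p\<in>X. - f p) = - Int0 f"
proof -
  assume f: "f \<in> CXZ \<tau>"
  obtain xs where xs: "good xs" "\<And>p. p \<in> X \<Longrightarrow> real_of_int (f p) = evl xs p"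
    by (rule CXZ_rep[OF f]) blast
  have gx: "good (scl (- 1) xs)" using xs by simp
  have ex: "real_of_int ((\<lambda>p\<in>X. - f p) p) = evl (scl (- 1) xs) p" if "p \<in> X" for p
    using xs(2)[OF that] that by simp
  show "(\<lambda>p\<in>X. - f p) \<in> CXZ \<tau>" by (rule CXZ_I[OF restrict_extensional gx ex])
  have "Int0 (\<lambda>p\<in>X. - f p) = ar (scl (- 1) xs)" by (rule Int0_eq[OF gx ex])
  then show "Int0 (\<lambda>p\<in>X. - f p) = - Int0 f" using Int0_eq[OF xs] by simp
  assume g: "g \<in> CXZ \<tau>"
  obtain ys where ys: "good ys" "\<And>p. p \<in> X \<Longrightarrow> real_of_int (g p) = evl ys p"
    by (rule CXZ_rep[OF g]) blast
  have gxy: "good (xs @ ys)" using xs ys by simp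
  have exy: "real_of_int ((\<lambda>p\<in>X. f p + g p) p) = evl (xs @ ys) p" if "p \<in> X" for p
    using xs(2)[OF that] ys(2)[OF that] that by simp
  show "(\<lambda>p\<in>X. f p + g p) \<in> CXZ \<tau>" by (rule CXZ_I[OF restrict_extensional gxy exy])
  have "Int0 (\<lambda>p\<in>X. f p + g p) = ar (xs @ ys)" by (rule Int0_eq[OF gxy exy])
  then show "Int0 (\<lambda>p\<in>X. f p + g p) = Int0 f + Int0 g"
    using Int0_eq[OF xs] Int0_eq[OF ys] by simp
qed

lemma CXZ_const: "(\<lambda>p\<in>X. k) \<in> CXZ \<tau>"
  and Int0_const: "Int0 (\<lambda>p\<in>X. k) = real_of_int k"
proof -
  have g: "good [(real_of_int k, 0, 1)]" using seg_0_1 by simp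
  have e: "real_of_int ((\<lambda>p\<in>X. k) p) = evl [(real_of_int k, 0, 1)] p" if "p \<in> X" for p
    using bx_0_1[OF that] that by simp
  show "(\<lambda>p\<in>X. k) \<in> CXZ \<tau>" by (rule CXZ_I[OF restrict_extensional g e])
  have "Int0 (\<lambda>p\<in>X. k) = ar [(real_of_int k, 0, 1)]" by (rule Int0_eq[OF g e])
  then show "Int0 (\<lambda>p\<in>X. k) = real_of_int k" by simp
qed

text \<open>The range lies in \<open>J\<close> because the cut points do. For the converse, the
  range \<open>N\<close> contains the generators and is closed under multiplication by
  \<open>s\<close> through the transfer operator; the work lies in division by
  \<open>s\<close>.\<close>

lemma Int0_image: "Int0 ` CXZ \<tau> = J"
proof
  have arJ: "ar xs \<in> J" if "good xs" "coefs xs \<subseteq> \<int>" for xs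
    using that
  proof (induction xs)
    case (Cons y xs)
    obtain c u v where y: "y = (c, u, v)" by (cases y) auto
    have "u \<in> J" "v \<in> J" "c \<in> \<int>" using Cons.prems y I1_subset_J by (auto simp: seg_def)
    then have "c * (v - u) \<in> J" by (intro J_mult Z_adjoin_inv_Ints J_diff)
    then show ?case using Cons y J_add by auto
  qed (simp add: J_0)
  show "Int0 ` CXZ \<tau> \<subseteq> J"
  proof
    fix x assume "x \<in> Int0 ` CXZ \<tau>"
    then obtain f where f: "f \<in> CXZ \<tau>" "x = Int0 f" by blast
    obtain xs where xs: "good xs" "coefs xs \<subseteq> \<int>" "\<And>p. p \<in> X \<Longrightarrow> real_of_int (f p) = evl xs p"
      by (rule CXZ_rep[OF f(1)]) blast
    then show "x \<in> J" using arJ Int0_eq[OF xs(1,3)] f(2) by simp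
  qed
  define N where "N = Int0 ` CXZ \<tau>"
  have Nadd: "x + y \<in> N" if xy: "x \<in> N" "y \<in> N" for x y
  proof -
    obtain f g where "f \<in> CXZ \<tau>" "x = Int0 f" "g \<in> CXZ \<tau>" "y = Int0 g" using xy by (auto simp: N_def)
    then show ?thesis using CXZ_add[of f g] Int0_add[of f g] unfolding N_def by (metis imageI)
  qed
  have Nneg: "- x \<in> N" if x: "x \<in> N" for x
  proof -
    obtain f where "f \<in> CXZ \<tau>" "x = Int0 f" using x by (auto simp: N_def)
    then show ?thesis using CXZ_uminus[of f] Int0_uminus[of f] unfolding N_def by (metis imageI)
  qed
  have N0: "0 \<in> N" unfolding N_def using CXZ_const[of 0] Int0_const[of 0] by (metis imageI of_int_0)
  have Ndiff: "x - y \<in> N" if "x \<in> N" "y \<in> N" for x y using Nadd[OF that(1) Nneg[OF that(2)]] by simp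
  have NI1: "c \<in> N" if c: "c \<in> I1 \<tau>" for c
  proof (cases "c = 0")
    case False
    then have sg: "seg 0 c" using c zero_I1 I1_01[OF c] by (simp add: seg_def)
    define f where "f = (\<lambda>p\<in>X. if p \<in> ibox 0 c then 1 else (0::int))"
    have g: "good [(1, 0, c)]" using sg by simp
    have e: "real_of_int (f p) = evl [(1, 0, c)] p" if "p \<in> X" for p
      using that by (simp add: f_def bx_def)
    have "f \<in> CXZ \<tau>" by (rule CXZ_I[OF _ g e]) (simp only: f_def restrict_extensional)
    moreover have "Int0 f = c" using Int0_eq[OF g e] by simp
    ultimately show ?thesis unfolding N_def by blast
  qed (simp add: N0)
  have Ns: "s * x \<in> N" if x: "x \<in> N" for x
  proof -
    obtain f where f: "f \<in> CXZ \<tau>" "x = Int0 f" using x by (auto simp: N_def)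
    then show ?thesis using transfer_CXZ[OF f(1)] Int0_transfer[OF f(1)] unfolding N_def by (metis imageI)
  qed
  \<comment> \<open>This is \<open>s\<close> times \<open>N\<close>; division by \<open>s\<close> is
    possible once it contains \<open>I1\<close>.\<close>
  define N' where "N' = {x. x / s \<in> N}"
  have N'0: "0 \<in> N'" and N'diff: "\<And>x y. x \<in> N' \<Longrightarrow> y \<in> N' \<Longrightarrow> x - y \<in> N'"
    using N0 Ndiff by (auto simp: N'_def diff_divide_distrib)
  have N'slope: "m * x \<in> N'" if "m = s \<or> m = - s" "x \<in> N" for m x
    using that Nneg s_pos by (auto simp: N'_def)
  have N'a: "\<tau> (a i) \<in> N'" if "i \<le> n" for i
  proof (rule module_contains_tau_partition[OF N'0 N'diff _ that])
    fix i m assume "1 \<le> i" "i \<le> n" "m = s \<or> m = - s"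
    then show "m * (a i - a (i - 1)) \<in> N'"
      using N'slope Ndiff[of "a i" "a (i - 1)"] NI1 partition_I1[of i] partition_I1[of "i - 1"] by simp
  qed
  \<comment> \<open>Surjectivity gives \<open>x = \<tau> y\<close> with \<open>y\<close> in
    \<open>I1\<close>, and on its lap \<open>\<tau> y\<close> is the value at a partition point plus
    a slope times a difference of points of \<open>I1\<close>.\<close>
  have N'I1: "x / s \<in> N" if x: "x \<in> I1 \<tau>" for x
  proof -
    have "x \<in> \<tau> ` {0..1}" using x I1_01[OF x] tau_surj by auto
    then obtain y where y: "y \<in> {0..1}" "\<tau> y = x" by blast
    have yI: "y \<in> I1 \<tau>" using I1_tau[OF y(1)] y x by simp
    have "\<tau> y \<in> N'"
    proof (cases "y = 1")
      case True
      then show ?thesis using N'a[of n] a_n by simp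
    next
      case False
      then have "0 \<le> y" "y < 1" using y by auto
      then obtain i m b where i: "1 \<le> i" "i \<le> n" "a (i - 1) \<le> y" "y < a i" and m: "m = s \<or> m = - s"
        and b: "\<And>x. a (i - 1) \<le> x \<Longrightarrow> x \<le> a i \<Longrightarrow> \<tau> x = m * x + b"
        by (rule lap_at) blast
      have e: "\<tau> y = \<tau> (a (i - 1)) - m * (a (i - 1) - y)"
        using b[of y] b[of "a (i - 1)"] i by (simp add: right_diff_distrib)
      have "a (i - 1) - y \<in> N" using Ndiff NI1 yI partition_I1[of "i - 1"] i by simp
      then show ?thesis unfolding e using N'diff N'slope[OF m] N'a[of "i - 1"] i by simp
    qed
    then show ?thesis using y by (simp add: N'_def)
  qed
  have arN': "ar xs / s \<in> N" if "good xs" "coefs xs \<subseteq> \<int>" for xs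
    using that
  proof (induction xs)
    case (Cons y xs)
    obtain c u v where y: "y = (c, u, v)" by (cases y) auto
    have uv: "(v - u) / s \<in> N" using Cons.prems y N'I1 Ndiff by (auto simp: seg_def diff_divide_distrib)
    have "c \<in> \<int>" using Cons.prems y by simp
    then obtain z where z: "c = of_int z" by (auto elim: Ints_cases)
    have nat: "real k * w \<in> N" if "w \<in> N" for k w
      by (induction k) (auto simp: N0 distrib_right intro: Nadd that)
    have "c * ((v - u) / s) \<in> N"
    proof (cases "0 \<le> z")
      case True
      then show ?thesis using nat[OF uv, of "nat z"] z by simp
    next
      case False
      then show ?thesis using Nneg[OF nat[OF uv, of "nat (- z)"]] z by simp
    qed
    then show ?case using Cons y Nadd by (auto simp: add_divide_distrib)
  qed (simp add: N0)
  have Ninv: "inverse s * x \<in> N" if x: "x \<in> N" for x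
  proof -
    obtain f where f: "f \<in> CXZ \<tau>" "x = Int0 f" using x by (auto simp: N_def)
    obtain xs where xs: "good xs" "coefs xs \<subseteq> \<int>" "\<And>p. p \<in> X \<Longrightarrow> real_of_int (f p) = evl xs p"
      by (rule CXZ_rep[OF f(1)]) blast
    then show ?thesis using arN'[OF xs(1,2)] Int0_eq[OF xs(1,3)] f(2) by (simp add: divide_inverse mult.commute)
  qed
  have Z: "Z_adjoin_inv s \<subseteq> {r. \<forall>x\<in>N. r * x \<in> N}"
    by (rule Z_adjoin_inv_least) (use Ns Ninv Ndiff in \<open>auto simp: left_diff_distrib mult.assoc\<close>)
  have Nsum: "(\<Sum>i\<in>S. g i) \<in> N" if "finite S" "\<And>i. i \<in> S \<Longrightarrow> g i \<in> N" for S :: "nat set" and g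
    using that by (induction S rule: finite_induct) (auto simp: N0 Nadd)
  show "J \<subseteq> Int0 ` CXZ \<tau>"
  proof
    fix x assume "x \<in> J"
    then obtain c where c: "x = (\<Sum>i = 1..n. c i * (a i - a (i - 1)))" "\<forall>i\<in>{1..n}. c i \<in> Z_adjoin_inv s"
      unfolding interval_module_def by blast
    have "c i * (a i - a (i - 1)) \<in> N" if i: "i \<in> {1..n}" for i
    proof -
      have "a i \<in> N" "a (i - 1) \<in> N" using i partition_I1[of i] partition_I1[of "i - 1"] NI1 by auto
      then have "a i - a (i - 1) \<in> N" by (rule Ndiff)
      then show ?thesis using c(2) i Z by blast
    qed
    then have "x \<in> N" unfolding c(1) by (intro Nsum) auto
    then show "x \<in> Int0 ` CXZ \<tau>" by (simp add: N_def)
  qed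
qed

subsection \<open>The dimension group\<close>

lemma transfer_add:
  "transfer \<tau> (\<lambda>p\<in>X. f p + g p) = (\<lambda>p\<in>X. transfer \<tau> f p + transfer \<tau> g p)"
proof
  fix p
  have "(\<Sum>q | q \<in> X \<and> local_homeo \<tau> q = p. (\<lambda>p\<in>X. f p + g p) q)
      = (\<Sum>q | q \<in> X \<and> local_homeo \<tau> q = p. f q + g q)"
    by (intro sum.cong) auto
  then show "transfer \<tau> (\<lambda>p\<in>X. f p + g p) p = (\<lambda>p\<in>X. transfer \<tau> f p + transfer \<tau> g p) p"
    by (simp add: transfer_def sum.distrib)
qed

lemma transfer_pow_add:
  assumes "f \<in> CXZ \<tau>" "g \<in> CXZ \<tau>"
  shows "(transfer \<tau> ^^ k) (\<lambda>p\<in>X. f p + g p) = (\<lambda>p\<in>X. (transfer \<tau> ^^ k) f p + (transfer \<tau> ^^ k) g p)"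
proof (induction k)
  case (Suc k)
  show ?case unfolding funpow.simps o_apply Suc by (rule transfer_add)
qed simp

lemma transfer_pow_CXZ: "f \<in> CXZ \<tau> \<Longrightarrow> (transfer \<tau> ^^ k) f \<in> CXZ \<tau>"
  by (induction k) (auto intro: transfer_CXZ)

lemma Int0_transfer_pow: "f \<in> CXZ \<tau> \<Longrightarrow> Int0 ((transfer \<tau> ^^ k) f) = s ^ k * Int0 f"
  by (induction k) (auto simp: Int0_transfer transfer_pow_CXZ)

lemma transfer_pow_eq_mono:
  assumes "(transfer \<tau> ^^ k) f = (transfer \<tau> ^^ k) g"
  shows "(transfer \<tau> ^^ (l + k)) f = (transfer \<tau> ^^ (l + k)) g"
  using assms by (simp add: funpow_add)

lemma DG_rel_iff:
  "(f, g) \<in> DG_rel \<tau> \<longleftrightarrow> f \<in> CXZ \<tau> \<and> g \<in> CXZ \<tau> \<and> (\<exists>k. (transfer \<tau> ^^ k) f = (transfer \<tau> ^^ k) g)"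
  by (simp add: DG_rel_def)

lemma equiv_DG_rel: "equiv (CXZ \<tau>) (DG_rel \<tau>)"
proof (rule equivI)
  show "DG_rel \<tau> \<subseteq> CXZ \<tau> \<times> CXZ \<tau>" by (auto simp: DG_rel_iff)
  show "refl_on (CXZ \<tau>) (DG_rel \<tau>)" by (auto simp: refl_on_def DG_rel_iff)
  show "sym (DG_rel \<tau>)"
  proof (rule symI)
    fix f g assume "(f, g) \<in> DG_rel \<tau>"
    then show "(g, f) \<in> DG_rel \<tau>" unfolding DG_rel_iff by metis
  qed
  show "trans (DG_rel \<tau>)"
  proof (rule transI)
    fix f g h assume "(f, g) \<in> DG_rel \<tau>" "(g, h) \<in> DG_rel \<tau>"
    then obtain k l where *: "f \<in> CXZ \<tau>" "h \<in> CXZ \<tau>" "(transfer \<tau> ^^ k) f = (transfer \<tau> ^^ k) g"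
      "(transfer \<tau> ^^ l) g = (transfer \<tau> ^^ l) h" by (auto simp: DG_rel_iff)
    have "(transfer \<tau> ^^ (l + k)) f = (transfer \<tau> ^^ (l + k)) h"
      using transfer_pow_eq_mono[OF *(3), of l] transfer_pow_eq_mono[OF *(4), of k] by (simp add: add.commute)
    then show "(f, h) \<in> DG_rel \<tau>" using *(1,2) unfolding DG_rel_iff by blast
  qed
qed

lemma DG_class_eq_iff:
  "f \<in> CXZ \<tau> \<Longrightarrow> g \<in> CXZ \<tau> \<Longrightarrow> DG_class \<tau> f = DG_class \<tau> g \<longleftrightarrow> (f, g) \<in> DG_rel \<tau>"
  unfolding DG_class_def by (rule eq_equiv_class_iff[OF equiv_DG_rel])

lemma mem_DG_class: "g \<in> DG_class \<tau> f \<longleftrightarrow> (f, g) \<in> DG_rel \<tau>"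
  by (simp add: DG_class_def)

lemma DG_class_self: "f \<in> CXZ \<tau> \<Longrightarrow> f \<in> DG_class \<tau> f"
  unfolding mem_DG_class DG_rel_iff by blast

lemma carrier_DG: "carrier (DG \<tau>) = DG_class \<tau> ` CXZ \<tau>"
  by (auto simp: DG_def quotient_def DG_class_def)

text \<open>Exponents for the two equivalences are raised to a common one, so the union in the
  definition ranges over equal classes.\<close>

lemma DG_mult:
  assumes f: "f \<in> CXZ \<tau>" and g: "g \<in> CXZ \<tau>"
  shows "DG_class \<tau> f \<otimes>\<^bsub>DG \<tau>\<^esub> DG_class \<tau> g = DG_class \<tau> (\<lambda>p\<in>X. f p + g p)"
proof -
  have "DG_class \<tau> (\<lambda>p\<in>X. f' p + g' p) = DG_class \<tau> (\<lambda>p\<in>X. f p + g p)"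
    if f': "f' \<in> DG_class \<tau> f" and g': "g' \<in> DG_class \<tau> g" for f' g'
  proof -
    obtain k l where *: "f' \<in> CXZ \<tau>" "g' \<in> CXZ \<tau>" "(transfer \<tau> ^^ k) f = (transfer \<tau> ^^ k) f'"
      "(transfer \<tau> ^^ l) g = (transfer \<tau> ^^ l) g'" using f' g' by (auto simp: mem_DG_class DG_rel_iff)
    have "(transfer \<tau> ^^ (l + k)) (\<lambda>p\<in>X. f' p + g' p) = (transfer \<tau> ^^ (l + k)) (\<lambda>p\<in>X. f p + g p)"
      using transfer_pow_eq_mono[OF *(3), of l] transfer_pow_eq_mono[OF *(4), of k]
      by (simp only: transfer_pow_add f g * add.commute)
    then show ?thesis
      unfolding DG_class_eq_iff[OF CXZ_add[OF *(1,2)] CXZ_add[OF f g]] DG_rel_iff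
      using CXZ_add[OF *(1,2)] CXZ_add[OF f g] by blast
  qed
  then have "(\<Union>f'\<in>DG_class \<tau> f. \<Union>g'\<in>DG_class \<tau> g. DG_class \<tau> (\<lambda>p\<in>X. f' p + g' p))
      = (\<Union>f'\<in>DG_class \<tau> f. \<Union>g'\<in>DG_class \<tau> g. DG_class \<tau> (\<lambda>p\<in>X. f p + g p))"
    by (intro SUP_cong refl)
  also have "\<dots> = DG_class \<tau> (\<lambda>p\<in>X. f p + g p)" using DG_class_self[OF f] DG_class_self[OF g] by blast
  finally show ?thesis by (simp add: DG_def)
qed

lemma DG_one: "\<one>\<^bsub>DG \<tau>\<^esub> = DG_class \<tau> (\<lambda>p\<in>X. 0)"
  by (simp add: DG_def)

lemma group_DG: "group (DG \<tau>)"
proof (rule groupI)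
  show "x \<otimes>\<^bsub>DG \<tau>\<^esub> y \<in> carrier (DG \<tau>)" if "x \<in> carrier (DG \<tau>)" "y \<in> carrier (DG \<tau>)" for x y
    using that DG_mult CXZ_add unfolding carrier_DG by auto
  show "\<one>\<^bsub>DG \<tau>\<^esub> \<in> carrier (DG \<tau>)" using CXZ_const[of 0] by (simp add: DG_one carrier_DG)
  show "x \<otimes>\<^bsub>DG \<tau>\<^esub> y \<otimes>\<^bsub>DG \<tau>\<^esub> z = x \<otimes>\<^bsub>DG \<tau>\<^esub> (y \<otimes>\<^bsub>DG \<tau>\<^esub> z)"
    if xyz: "x \<in> carrier (DG \<tau>)" "y \<in> carrier (DG \<tau>)" "z \<in> carrier (DG \<tau>)" for x y z
  proof -
    obtain f g h where *: "f \<in> CXZ \<tau>" "g \<in> CXZ \<tau>" "h \<in> CXZ \<tau>"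
      "x = DG_class \<tau> f" "y = DG_class \<tau> g" "z = DG_class \<tau> h" using xyz unfolding carrier_DG by blast
    have "(\<lambda>p\<in>X. (\<lambda>p\<in>X. f p + g p) p + h p) = (\<lambda>p\<in>X. f p + (\<lambda>p\<in>X. g p + h p) p)" by auto
    then show ?thesis using * by (simp only: DG_mult CXZ_add)
  qed
  show "\<one>\<^bsub>DG \<tau>\<^esub> \<otimes>\<^bsub>DG \<tau>\<^esub> x = x" if x: "x \<in> carrier (DG \<tau>)" for x
  proof -
    obtain f where f: "f \<in> CXZ \<tau>" "x = DG_class \<tau> f" using x unfolding carrier_DG by blast
    have "f \<in> extensional X" using f(1) by (simp add: CXZ_def)
    then have "(\<lambda>p\<in>X. (\<lambda>p\<in>X. 0) p + f p) = f" by (auto simp: extensional_def)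
    then show ?thesis unfolding DG_one f(2) by (simp only: DG_mult[OF CXZ_const f(1)])
  qed
  show "\<exists>y\<in>carrier (DG \<tau>). y \<otimes>\<^bsub>DG \<tau>\<^esub> x = \<one>\<^bsub>DG \<tau>\<^esub>" if x: "x \<in> carrier (DG \<tau>)" for x
  proof -
    obtain f where f: "f \<in> CXZ \<tau>" "x = DG_class \<tau> f" using x unfolding carrier_DG by blast
    have "(\<lambda>p\<in>X. (\<lambda>p\<in>X. - f p) p + f p) = (\<lambda>p\<in>X. 0)" by auto
    then have "DG_class \<tau> (\<lambda>p\<in>X. - f p) \<otimes>\<^bsub>DG \<tau>\<^esub> x = \<one>\<^bsub>DG \<tau>\<^esub>"
      unfolding DG_one f(2) by (simp only: DG_mult[OF CXZ_uminus[OF f(1)] f(1)])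
    then show ?thesis using CXZ_uminus[OF f(1)] unfolding carrier_DG by blast
  qed
qed

section \<open>The induced homomorphism and the positive cone\<close>

text \<open>The choice of representative does not matter: equal \<open>k\<close>-th transfers have
  equal integrals, each \<open>s ^ k\<close> times the original one.\<close>

definition omega :: "(real \<times> bool \<Rightarrow> int) set \<Rightarrow> real" where
  "omega A = Int0 (SOME f. f \<in> A)"

lemma omega_class: assumes f: "f \<in> CXZ \<tau>" shows "omega (DG_class \<tau> f) = Int0 f"
proof -
  have "(SOME g. g \<in> DG_class \<tau> f) \<in> DG_class \<tau> f" using DG_class_self[OF f] by (rule someI[of "\<lambda>g. g \<in> DG_class \<tau> f"])
  moreover have "Int0 g = Int0 f" if g: "g \<in> DG_class \<tau> f" for g
  proof -
    obtain k where "g \<in> CXZ \<tau>" "(transfer \<tau> ^^ k) f = (transfer \<tau> ^^ k) g"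
      using g by (auto simp: mem_DG_class DG_rel_iff)
    then have "s ^ k * Int0 f = s ^ k * Int0 g" using Int0_transfer_pow f by metis
    then show ?thesis using s_pos by simp
  qed
  ultimately show ?thesis unfolding omega_def by blast
qed

lemma transfer_star_class:
  assumes f: "f \<in> CXZ \<tau>"
  shows "transfer_star \<tau> (DG_class \<tau> f) = DG_class \<tau> (transfer \<tau> f)"
proof -
  have "DG_class \<tau> (transfer \<tau> g) = DG_class \<tau> (transfer \<tau> f)" if g: "g \<in> DG_class \<tau> f" for g
  proof -
    obtain k where gC: "g \<in> CXZ \<tau>" and k: "(transfer \<tau> ^^ k) f = (transfer \<tau> ^^ k) g"
      using g by (auto simp: mem_DG_class DG_rel_iff)
    have "(transfer \<tau> ^^ k) (transfer \<tau> g) = (transfer \<tau> ^^ k) (transfer \<tau> f)"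
      using k by (simp add: funpow_swap1[symmetric])
    then show ?thesis
      unfolding DG_class_eq_iff[OF transfer_CXZ[OF gC] transfer_CXZ[OF f]] DG_rel_iff
      using transfer_CXZ[OF gC] transfer_CXZ[OF f] by blast
  qed
  then have "transfer_star \<tau> (DG_class \<tau> f) = (\<Union>g\<in>DG_class \<tau> f. DG_class \<tau> (transfer \<tau> f))"
    unfolding transfer_star_def by (intro SUP_cong refl)
  then show ?thesis using DG_class_self[OF f] by auto
qed

text \<open>No regularity of \<open>f\<close> is assumed; a function that is not integrable has
  integral 0 by convention.\<close>

lemma Int0_nonneg:
  assumes "\<forall>p\<in>X. 0 \<le> f p"
  shows "0 \<le> Int0 f"
proof (cases "(\<lambda>x. real_of_int (f (x, False))) integrable_on {0..1}")
  case True
  then show ?thesis unfolding Int0_def by (rule integral_nonneg) (use assms in \<open>simp add: X_iff\<close>)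
qed (simp add: Int0_def not_integrable_integral)

text \<open>The sign of the integral decides positivity except at the value 0, the case that passing
  to the quotient absorbs.\<close>

lemma pos_cone_DG:
  "pos_cone (DG \<tau>) \<subseteq> carrier (DG \<tau>)"
  "x \<in> pos_cone (DG \<tau>) \<Longrightarrow> 0 \<le> omega x"
  "x \<in> carrier (DG \<tau>) \<Longrightarrow> 0 < omega x \<Longrightarrow> x \<in> pos_cone (DG \<tau>)"
  "\<one>\<^bsub>DG \<tau>\<^esub> \<in> pos_cone (DG \<tau>)"
proof -
  have pc: "pos_cone (DG \<tau>) = {DG_class \<tau> f | f. f \<in> CXZ \<tau> \<and> (\<exists>n. \<forall>p\<in>X. 0 \<le> (transfer \<tau> ^^ n) f p)}"
    by (simp add: DG_def)
  show "pos_cone (DG \<tau>) \<subseteq> carrier (DG \<tau>)" unfolding pc carrier_DG by blast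
  show "\<one>\<^bsub>DG \<tau>\<^esub> \<in> pos_cone (DG \<tau>)" unfolding pc DG_one
    using CXZ_const[of 0] by (auto intro!: exI[of _ "\<lambda>p\<in>X. 0"] exI[of _ 0])
  show "0 \<le> omega x" if x: "x \<in> pos_cone (DG \<tau>)"
  proof -
    obtain f k where f: "f \<in> CXZ \<tau>" "x = DG_class \<tau> f" "\<forall>p\<in>X. 0 \<le> (transfer \<tau> ^^ k) f p"
      using x unfolding pc by blast
    have "0 \<le> s ^ k * Int0 f" using Int0_nonneg[OF f(3)] Int0_transfer_pow[OF f(1)] by simp
    then show ?thesis using s_pos zero_less_power[OF s_pos, of k] omega_class[OF f(1)] f(2)
      by (simp add: zero_le_mult_iff not_le[symmetric])
  qed
  show "x \<in> pos_cone (DG \<tau>)" if x: "x \<in> carrier (DG \<tau>)" "0 < omega x"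
  proof -
    obtain f where f: "f \<in> CXZ \<tau>" "x = DG_class \<tau> f" using x(1) unfolding carrier_DG by blast
    obtain xs where xs: "good xs" "\<And>p. p \<in> X \<Longrightarrow> real_of_int (f p) = evl xs p"
      by (rule CXZ_rep[OF f(1)]) blast
    have "0 < ar xs" using x(2) omega_class[OF f(1)] f(2) Int0_eq[OF xs] by simp
    then obtain k where k: "\<forall>q\<in>X. 0 \<le> (tr ^^ k) (evl xs) q" using eventually_nonneg[OF xs(1)] by blast
    have "0 \<le> (transfer \<tau> ^^ k) f p" if p: "p \<in> X" for p
    proof -
      have "real_of_int ((transfer \<tau> ^^ k) f p) = (tr ^^ k) (evl xs) p"
        unfolding real_transfer[OF p] by (rule trk_cong[OF xs(2) p])
      then show ?thesis using k p by (metis of_int_0_le_iff)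
    qed
    then show ?thesis unfolding pc using f by blast
  qed
qed

lemma dimension_group_quotient:
  "\<exists>\<Phi> \<in> ordered_grp_iso (quotient_grp (DG \<tau>) (DG_inf \<tau>)) (real_ordered_grp J).
     \<forall>x \<in> carrier (DG \<tau>). \<Phi> (DG_inf \<tau> #>\<^bsub>DG \<tau>\<^esub> transfer_star \<tau> x) = s * \<Phi> (DG_inf \<tau> #>\<^bsub>DG \<tau>\<^esub> x)"
proof -
  have img: "omega ` carrier (DG \<tau>) = J"
    unfolding carrier_DG Int0_image[symmetric] image_image using omega_class by (intro image_cong refl)
  have hom: "omega \<in> hom (DG \<tau>) (real_ordered_grp J)"
  proof (rule homI)
    show "omega x \<in> carrier (real_ordered_grp J)" if "x \<in> carrier (DG \<tau>)" for x
      using img that by auto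
    show "omega (x \<otimes>\<^bsub>DG \<tau>\<^esub> y) = omega x \<otimes>\<^bsub>real_ordered_grp J\<^esub> omega y"
      if "x \<in> carrier (DG \<tau>)" "y \<in> carrier (DG \<tau>)" for x y
      using that unfolding carrier_DG by (auto simp: DG_mult omega_class CXZ_add Int0_add)
  qed
  have e: "DG_unit \<tau> \<in> carrier (DG \<tau>)" "omega (DG_unit \<tau>) = 1"
    unfolding DG_unit_def carrier_DG using CXZ_const[of 1] Int0_const[of 1] by (simp_all add: omega_class)
  have J: "group (real_ordered_grp J)" by (rule group_real_ordered_grp[OF J_0 J_diff])
  have "\<exists>\<Phi> \<in> ordered_grp_iso (quotient_grp (DG \<tau>) (DG_inf \<tau>)) (real_ordered_grp J).
      \<forall>x \<in> carrier (DG \<tau>). \<Phi> (DG_inf \<tau> #>\<^bsub>DG \<tau>\<^esub> x) = omega x"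
    unfolding DG_inf_def
    by (rule quotient_by_infinitesimals[OF group_DG J hom img e]) (fact pos_cone_DG)+
  then obtain \<Phi> where \<Phi>: "\<Phi> \<in> ordered_grp_iso (quotient_grp (DG \<tau>) (DG_inf \<tau>)) (real_ordered_grp J)"
    "\<And>x. x \<in> carrier (DG \<tau>) \<Longrightarrow> \<Phi> (DG_inf \<tau> #>\<^bsub>DG \<tau>\<^esub> x) = omega x" by blast
  show ?thesis
  proof (intro bexI[of _ \<Phi>] ballI \<Phi>(1))
    fix x assume "x \<in> carrier (DG \<tau>)"
    then obtain f where f: "f \<in> CXZ \<tau>" "x = DG_class \<tau> f" unfolding carrier_DG by blast
    have "transfer_star \<tau> x = DG_class \<tau> (transfer \<tau> f)" using f transfer_star_class by simp
    then show "\<Phi> (DG_inf \<tau> #>\<^bsub>DG \<tau>\<^esub> transfer_star \<tau> x) = s * \<Phi> (DG_inf \<tau> #>\<^bsub>DG \<tau>\<^esub> x)"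
      using f transfer_CXZ[OF f(1)] by (simp add: \<Phi>(2) carrier_DG omega_class Int0_transfer)
  qed
qed

end

theorem proposition9p1:
  fixes \<tau> :: "real \<Rightarrow> real" and s :: real and n :: nat and a :: "nat \<Rightarrow> real"
  assumes "continuous_on {0..1} \<tau>" and "\<tau> ` {0..1} \<subseteq> {0..1}"
    and "associated_partition \<tau> n a"
    and "s > 0" and "linear_with_slopes_pm \<tau> n a s"
    and "topologically_mixing \<tau>"
  shows "\<exists>\<Phi> \<in> ordered_grp_iso (quotient_grp (DG \<tau>) (DG_inf \<tau>))
                (real_ordered_grp (interval_module s n a)).
           \<forall>x \<in> carrier (DG \<tau>).
             \<Phi> (DG_inf \<tau> #>\<^bsub>DG \<tau>\<^esub> transfer_star \<tau> x) = s * \<Phi> (DG_inf \<tau> #>\<^bsub>DG \<tau>\<^esub> x)"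
proof -
  interpret pm_slope_map \<tau> s n a by (rule pm_slope_map.intro[OF assms])
  show ?thesis by (rule dimension_group_quotient)
qed

end
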